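(* Let $1<p<\infty$, $N\ge 2$, $\lambda_1,\dots,\lambda_N>0$ with $\sum_{i=1}^N\lambda_i=1$, let $\mu_1,\dots,\mu_N\in\mathcal{P}_p(\mathbb{R}^d)$, and let $\gamma_p\in\Pi(\mu_1,\dots,\mu_N)$ have $c_p$-monotone support. If $\mu_1\ll\mathcal{L}^d$, then $$(\overline{x}_p)_\#\gamma_p\ll\mathcal{L}^d.$$ It follows that, if $\mu_1\ll\mathcal{L}^d$, the $p$-Wasserstein barycenter $\nu_p$ of the measures $\mu_1,\dots,\mu_N$ with weights $\lambda_1,\dots,\lambda_N$ is absolutely continuous with respect to Lebesgue measure on $\mathbb{R}^d$.
   Context: $\mathcal{L}^d$ is Lebesgue measure; $\mathcal{P}_p(\mathbb{R}^d)$ is the set of Borel probability measures with finite $p$-th moment; $W_p$ is the $p$-Wasserstein distance. $\Pi(\mu_1,\dots,\mu_N)$ is the set of Borel probability measures on $\mathbb{R}^{Nd}$ with marginals $\mu_1,\dots,\mu_N$. For $\mathbf{x}=(x_1,\dots,x_N)\in\mathbb{R}^{Nd}$, $\overline{x}_p(\mathbf{x})$ is the unique minimizer of $z\mapsto\sum_{i}\lambda_i|x_i-z|^p$ over $\mathbb{R}^d$ and $c_p(\mathbf{x}):=\min_z\sum_i\lambda_i|x_i-z|^p$. A set $\Gamma\subset\mathbb{R}^{Nd}$ is $c_p$-monotone if for every $\mathbf{x}^1=(x_1^1,\dots,x_N^1)$ and $\mathbf{x}^2=(x_1^2,\dots,x_N^2)$ in $\Gamma$, $$c_p(x_1^1,\dots,x_N^1)+c_p(x_1^2,\dots,x_N^2)\le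 c_p\big(x_1^{\sigma_1(1)},\dots,x_N^{\sigma_N(1)}\big)+c_p\big(x_1^{\sigma_1(2)},\dots,x_N^{\sigma_N(2)}\big)$$ for all permutations $\sigma_1,\dots,\sigma_N$ of $\{1,2\}$. The $p$-Wasserstein barycenter of $(\mu_i,\lambda_i)_i$ is the minimizer of $\nu\mapsto\sum_i\lambda_iW_p^p(\mu_i,\nu)$ over $\mathcal{P}_p(\mathbb{R}^d)$; equivalently it is $(\overline{x}_p)_\#\gamma$ for $\gamma$ minimizing $\int c_p\,d\gamma$ over $\Pi(\mu_1,\dots,\mu_N)$. *)

theory Defs
  imports "HOL-Probability.Probability" "HOL-Combinatorics.Permutations"
begin

definition prob_measures_moment :: "real \<Rightarrow> 'a::euclidean_space measure set" where
  "prob_measures_moment p =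
     {\<mu>. prob_space \<mu> \<and> sets \<mu> = sets borel \<and> integrable \<mu> (\<lambda>x. norm x powr p)}"

definition transport_plans ::
  "'a::euclidean_space measure \<Rightarrow> 'a measure \<Rightarrow> ('a \<times> 'a) measure set" where
  "transport_plans \<mu> \<nu> =
     {\<pi>. prob_space \<pi> \<and> sets \<pi> = sets borel \<and> distr \<pi> borel fst = \<mu> \<and> distr \<pi> borel snd = \<nu>}"

(* For measures with finite p-th moment every plan has finite cost, so enn2real does not
   collapse an infinite value to 0 there. *)
definition wasserstein :: "real \<Rightarrow> 'a::euclidean_space measure \<Rightarrow> 'a measure \<Rightarrow> real" where
  "wasserstein p \<mu> \<nu> =
     (enn2real (INF \<pi> \<in> transport_plans \<mu> \<nu>.
        \<integral>\<^sup>+ z. ennreal (norm (fst z - snd z) powr p) \<partial>\<pi>)) powr (1 / p)"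

(* A tuple (x_1, ..., x_N) of points of 'a is an element of 'a ^ 'n with N = CARD('n). *)
definition multi_plans ::
  "('n::finite \<Rightarrow> 'a::euclidean_space measure) \<Rightarrow> ('a ^ 'n) measure set" where
  "multi_plans \<mu> =
     {\<gamma>. prob_space \<gamma> \<and> sets \<gamma> = sets borel \<and> (\<forall>i. distr \<gamma> borel (\<lambda>x. x $ i) = \<mu> i)}"

definition bary_objective ::
  "real \<Rightarrow> ('n::finite \<Rightarrow> real) \<Rightarrow> 'a::euclidean_space ^ 'n \<Rightarrow> 'a \<Rightarrow> real" where
  "bary_objective p lam x z = (\<Sum>i\<in>UNIV. lam i * norm (x $ i - z) powr p)"

definition bary_point ::
  "real \<Rightarrow> ('n::finite \<Rightarrow> real) \<Rightarrow> 'a::euclidean_space ^ 'n \<Rightarrow> 'a" where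
  "bary_point p lam x = (THE z. \<forall>w. bary_objective p lam x z \<le> bary_objective p lam x w)"

definition bary_cost ::
  "real \<Rightarrow> ('n::finite \<Rightarrow> real) \<Rightarrow> 'a::euclidean_space ^ 'n \<Rightarrow> real" where
  "bary_cost p lam x = (INF z. bary_objective p lam x z)"

definition cp_monotone ::
  "real \<Rightarrow> ('n::finite \<Rightarrow> real) \<Rightarrow> ('a::euclidean_space ^ 'n) set \<Rightarrow> bool" where
  "cp_monotone p lam \<Gamma> \<longleftrightarrow>
     (\<forall>x :: nat \<Rightarrow> 'a ^ 'n. x 1 \<in> \<Gamma> \<and> x 2 \<in> \<Gamma> \<longrightarrow>
       (\<forall>\<sigma> :: 'n \<Rightarrow> nat \<Rightarrow> nat. (\<forall>i. \<sigma> i permutes {1, 2}) \<longrightarrow>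
          bary_cost p lam (x 1) + bary_cost p lam (x 2)
            \<le> bary_cost p lam (\<chi> i. x (\<sigma> i 1) $ i) + bary_cost p lam (\<chi> i. x (\<sigma> i 2) $ i)))"

definition measure_support :: "'b::topological_space measure \<Rightarrow> 'b set" where
  "measure_support M = {x. \<forall>U. open U \<and> x \<in> U \<longrightarrow> emeasure M U > 0}"

definition is_wasserstein_barycenter ::
  "real \<Rightarrow> ('n::finite \<Rightarrow> real) \<Rightarrow> ('n \<Rightarrow> 'a::euclidean_space measure) \<Rightarrow> 'a measure \<Rightarrow> bool" where
  "is_wasserstein_barycenter p lam \<mu> \<nu> \<longleftrightarrow>
     is_arg_min (\<lambda>\<nu>. \<Sum>i\<in>UNIV. lam i * wasserstein p (\<mu> i) \<nu> powr p)
       (\<lambda>\<nu>. \<nu> \<in> prob_measures_moment p) \<nu>"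

end

theory Submission
  imports Defs
begin

text \<open>
  Let \<open>z\<close> be the barycenter of a configuration \<open>x\<close> in the support of a plan and let \<open>v\<close> be the gradient of
  \<open>|u|^p\<close> at \<open>u = x\<^sub>1 - z \<noteq> 0\<close>. Swapping one coordinate of two configurations while keeping their
  barycenters as test points, together with stationarity of the barycenter, gives the two-sided bound
  \<open>|\<langle>\<Delta>v, \<Delta>z\<rangle>| \<le> M |\<Delta>z|\<^sup>2\<close>, and configurations with the same barycenter coincide. Coordinates
  with \<open>x\<^sub>j = z\<close>, where \<open>|u|^p\<close> need not be twice differentiable, contribute nothing to stationarity, so
  the support is decomposed according to the set of these coordinates. This covers all \<open>p > 1\<close> at once.

  In general \<open>v\<close> is not a Lipschitz function of \<open>z\<close>. Still, for \<open>y = v + 2 M z\<close> the relation between \<open>z\<close> and \<open>y\<close>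
  maps null sets of \<open>z\<close> to null sets of \<open>y\<close>, hence of \<open>x\<^sub>1\<close>. To see this, trade the coordinates of \<open>z\<close> for
  those of \<open>y\<close> one at a time. By Fubini this is a question about curves \<open>\<zeta>\<close> on a compact set \<open>U\<close> of
  reals with \<open>M |\<Delta>\<zeta>|\<^sup>2 \<le> \<Delta>t \<Delta>s \<le> 3 M |\<Delta>\<zeta>|\<^sup>2\<close>, where \<open>s = \<zeta> \<bullet> e\<close> has null image: then \<open>\<zeta>\<close> moves only
  across the gaps of \<open>U\<close>, so \<open>M |\<Delta>\<zeta>|\<^sup>2\<close> is at most the total gap length times \<open>\<Delta>s\<close>. Between two points of \<open>U\<close>
  whose gaps fill less than a third of the distance this forces \<open>\<Delta>\<zeta> = 0\<close>, against injectivity.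

  A Wasserstein barycenter is the image of an optimal multi-marginal plan: glue nearly optimal
  plans approximately, pass to a weak limit, and compare costs. The support of an optimal plan
  is monotone, since otherwise exchanging coordinates of two independent samples lowers the cost.
\<close>

section \<open>Curves with null image\<close>

text \<open>Monotonicity controls only the inner product of \<Delta>v with \<Delta>z and leaves
  |\<Delta>v| free, so null sets of z cannot simply be pushed forward by a Lipschitz map. The shift
  by 2 M z makes z a Lipschitz function of y, which is the wrong direction for null sets; the curve
  argument supplies the other one. The factor 2 moves the bounds -M and M to M and 3 M, so that both
  are positive and comparable. Their ratio 3 is the parameter \<open>K\<close> of the lemmas below.

  The distances |x_j - z| are kept away from 0 for two reasons: for p < 2 the function |u|^p has no
  quadratic upper bound at 0, and for p > 2 the inverse of its gradient is not Lipschitz at 0.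

  Gluing with an error works because the exact statements return in the limit: the marginals are
  constant along the sequence, the distance between second components tends to 0, and for the cost
  an upper bound is enough, as minimality of the barycenter gives the reverse inequality.\<close>

lemma weighted_am_gm:
  fixes N X Y \<sigma> :: real
  assumes "N\<^sup>2 \<le> X * Y" "0 \<le> X" "0 \<le> Y" "\<sigma> > 0"
  shows "N \<le> (\<sigma> * X + Y / \<sigma>) / 2"
proof -
  have sq: "4 * (A * B) \<le> (A + B)\<^sup>2" for A B :: real
    using zero_le_power2[of "A - B"] by (simp add: power2_eq_square algebra_simps)
  have "(2 * N)\<^sup>2 \<le> 4 * ((\<sigma> * X) * (Y / \<sigma>))" using assms by simp
  also have "\<dots> \<le> (\<sigma> * X + Y / \<sigma>)\<^sup>2" by (rule sq)
  finally have "2 * N \<le> \<sigma> * X + Y / \<sigma>"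
    by (rule power2_le_imp_le) (use assms in auto)
  then show ?thesis by (simp only: le_divide_eq_numeral1 mult.commute[of N])
qed

text \<open>With \<open>weighted_am_gm\<close> this trades a bound by a product for a family of
  bounds by sums. Sums add up along consecutive steps of a curve, products do not; the optimal
  weight recovers the product at the end.\<close>

lemma weighted_am_gm_converse:
  fixes N X Y :: real
  assumes le: "\<And>\<sigma>. \<sigma> > 0 \<Longrightarrow> N \<le> (\<sigma> * X + Y / \<sigma>) / 2" and "0 \<le> N" "0 \<le> X" "0 \<le> Y"
  shows "N\<^sup>2 \<le> X * Y"
proof -
  have "N\<^sup>2 \<le> (X + \<eta>) * (Y + \<eta>)" if "\<eta> > 0" for \<eta>
  proof -
    \<comment> \<open>The optimal weight; adding \<open>\<eta>\<close> keeps it positive and finite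
      when \<open>X\<close> or \<open>Y\<close> vanishes.\<close>
    define \<sigma> where "\<sigma> = sqrt ((Y + \<eta>) / (X + \<eta>))"
    have pos: "X + \<eta> > 0" "Y + \<eta> > 0" using assms that by auto
    then have \<sigma>: "\<sigma> > 0" by (simp add: \<sigma>_def)
    have sq: "\<sigma>\<^sup>2 = (Y + \<eta>) / (X + \<eta>)" using pos by (simp add: \<sigma>_def)
    have "N \<le> (\<sigma> * X + Y / \<sigma>) / 2" by (rule le[OF \<sigma>])
    also have "\<dots> \<le> (\<sigma> * (X + \<eta>) + (Y + \<eta>) / \<sigma>) / 2"
      using \<sigma> that by (intro divide_right_mono add_mono mult_left_mono) auto
    also have "(Y + \<eta>) / \<sigma> = \<sigma> * (X + \<eta>)"
      using sq \<sigma> pos by (simp add: field_simps power2_eq_square)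
    finally have "N \<le> \<sigma> * (X + \<eta>)" by simp
    then have "N\<^sup>2 \<le> (\<sigma> * (X + \<eta>))\<^sup>2" using assms by (intro power_mono) auto
    also have "\<dots> = (X + \<eta>) * (Y + \<eta>)"
      using sq pos by (simp add: power_mult_distrib) (simp add: power2_eq_square)
    finally show ?thesis .
  qed
  then have ev: "\<forall>\<^sub>F \<eta> in at_right 0. N\<^sup>2 \<le> (X + \<eta>) * (Y + \<eta>)"
    by (auto simp: eventually_at_right_less intro: eventually_at_rightI[of 0 1])
  have "((\<lambda>\<eta>. (X + \<eta>) * (Y + \<eta>)) \<longlongrightarrow> (X + 0) * (Y + 0)) (at_right 0)"
    by (intro tendsto_intros)
  from tendsto_lowerbound[OF this ev] show ?thesis by simp
qed

abbreviation len :: "'a::euclidean_space set \<Rightarrow> real" where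
  "len \<equiv> measure lebesgue"

lemma lmeasurable_outer_open:
  fixes S :: "'a::euclidean_space set"
  assumes "S \<in> lmeasurable" "\<delta> > 0"
  obtains T where "open T" "S \<subseteq> T" "T \<in> lmeasurable" "len (T - S) < \<delta>"
proof -
  obtain T where T: "open T" "S \<subseteq> T" "T - S \<in> lmeasurable" "emeasure lebesgue (T - S) < ennreal \<delta>"
    using sets_lebesgue_outer_open[OF fmeasurableD[OF assms(1)] assms(2)] by blast
  have "T = S \<union> (T - S)" using T by auto
  then have "T \<in> lmeasurable" using assms(1) T(3) fmeasurable.Un by metis
  moreover have "len (T - S) < \<delta>"
    using T(3,4) by (simp add: emeasure_eq_measure2 ennreal_less_iff)
  ultimately show thesis using that T by blast
qed

text \<open>The chord length \<open>N\<close> obeys the triangle inequality, so it can be bounded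
  along short steps through \<open>U\<close>. A step across a gap of \<open>U\<close> is charged
  with weight \<open>\<tau>\<close>. A step to a nearby point of \<open>U\<close> is charged with a
  small weight \<open>\<sigma>\<close>; its increment of \<open>s\<close> lies in an open set
  \<open>W\<close> around the null image, so all such steps together cost only a multiple of
  \<open>\<sigma>\<close>. Then \<open>\<sigma>\<close> tends to 0 and \<open>\<tau>\<close> is
  optimised.\<close>

lemma monotone_curve_estimate:
  fixes U :: "real set" and \<zeta> :: "real \<Rightarrow> 'a::euclidean_space" and e :: 'a
  assumes U: "compact U" and ab: "a \<in> U" "b \<in> U" "a \<le> b" and M: "M > 0" and e: "norm e = 1"
    and ineq: "\<And>t u. t \<in> U \<Longrightarrow> u \<in> U \<Longrightarrow>
        M * (norm (\<zeta> u - \<zeta> t))\<^sup>2 \<le> (u - t) * ((\<zeta> u - \<zeta> t) \<bullet> e)"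
    and null: "negligible ((\<lambda>t. \<zeta> t \<bullet> e) ` U)"
  shows "M * (norm (\<zeta> b - \<zeta> a))\<^sup>2 \<le> len ({a..b} - U) * ((\<zeta> b - \<zeta> a) \<bullet> e)"
proof -
  define s where "s t = \<zeta> t \<bullet> e" for t
  define N where "N t u = sqrt M * norm (\<zeta> u - \<zeta> t)" for t u
  have s_diff: "(\<zeta> u - \<zeta> t) \<bullet> e = s u - s t" for t u by (simp add: s_def inner_diff_left)
  have s_norm: "\<bar>s u - s t\<bar> \<le> norm (\<zeta> u - \<zeta> t)" for t u
    using Cauchy_Schwarz_ineq2[of "\<zeta> u - \<zeta> t" e] e by (simp add: s_diff)
  have N2: "(N t u)\<^sup>2 \<le> (u - t) * (s u - s t)" if "t \<in> U" "u \<in> U" for t u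
    using ineq[OF that] M by (simp add: N_def power_mult_distrib s_diff)
  have lip: "norm (\<zeta> u - \<zeta> t) \<le> \<bar>u - t\<bar> / M" if "t \<in> U" "u \<in> U" for t u
  proof (cases "\<zeta> u = \<zeta> t")
    case False
    have "M * (norm (\<zeta> u - \<zeta> t))\<^sup>2 \<le> \<bar>u - t\<bar> * \<bar>s u - s t\<bar>"
      using ineq[OF that] abs_ge_self[of "(u - t) * (s u - s t)"] by (simp add: s_diff abs_mult)
    also have "\<dots> \<le> \<bar>u - t\<bar> * norm (\<zeta> u - \<zeta> t)" by (intro mult_left_mono s_norm) auto
    finally show ?thesis using False M by (simp add: power2_eq_square field_simps)
  qed (use M in auto)
  have s_mono: "s t \<le> s u" if "t \<in> U" "u \<in> U" "t \<le> u" for t u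
  proof (cases "t = u")
    case False
    then have "0 < u - t" using that by simp
    moreover have "0 \<le> (u - t) * (s u - s t)"
      using N2[OF that(1,2)] zero_le_power2[of "N t u"] by linarith
    ultimately show ?thesis by (simp add: zero_le_mult_iff)
  qed simp
  have N_le: "N t u \<le> (\<sigma> * (u - t) + (s u - s t) / \<sigma>) / 2"
    if "t \<in> U" "u \<in> U" "t \<le> u" "\<sigma> > 0" for t u \<sigma>
    using weighted_am_gm[OF N2[OF that(1,2)]] s_mono[OF that(1-3)] that by auto
  have N_tri: "N t v \<le> N t u + N u v" for t u v
  proof -
    have "norm (\<zeta> v - \<zeta> t) \<le> norm (\<zeta> u - \<zeta> t) + norm (\<zeta> v - \<zeta> u)"
      using norm_triangle_ineq[of "\<zeta> u - \<zeta> t" "\<zeta> v - \<zeta> u"] by simp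
    then show ?thesis unfolding N_def using M by (simp flip: distrib_left)
  qed
  have meas_U: "{x..y} - U \<in> lmeasurable" for x y :: real
    using U by (intro fmeasurable.Diff) (auto intro: lmeasurable_compact)
  have key: "N a b \<le> (\<tau> * len ({a..b} - U) + (s b - s a) / \<tau>) / 2 + \<sigma> * (b - a + 1) / 2"
    if tau: "\<tau> > 0" and sig: "\<sigma> > 0" for \<tau> \<sigma>
  proof -
    \<comment> \<open>The measure of \<open>W\<close> is divided by \<open>\<sigma>\<close> in
      \<open>D\<close>; the square leaves a term of order \<open>\<sigma>\<close>.\<close>
    obtain W where W: "open W" "s ` U \<subseteq> W" "W \<in> lmeasurable" "len W < \<sigma>\<^sup>2"
    proof -
      have sU: "s ` U \<in> lmeasurable" "len (s ` U) = 0"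
        using null by (simp_all add: s_def[abs_def] negligible_imp_measurable negligible_imp_measure0)
      obtain T where T: "open T" "s ` U \<subseteq> T" "T \<in> lmeasurable" "len (T - s ` U) < \<sigma>\<^sup>2"
        using lmeasurable_outer_open[OF sU(1), of "\<sigma>\<^sup>2"] sig by auto
      moreover have "len T = len (T - s ` U)"
        using sU T by (simp add: measurable_measure_Diff fmeasurableD)
      ultimately show ?thesis using that by auto
    qed
    have meas_W: "W \<inter> {x..y} \<in> lmeasurable" for x y :: real
      using W(3) by (intro fmeasurable.Int) auto
    \<comment> \<open>\<open>A\<close> and \<open>B\<close> pay for gaps, \<open>C\<close> and
      \<open>D\<close> for steps at accumulation points. All four are nondecreasing along
      \<open>U\<close>, so each step can use one pair and ignore the growth of the other.\<close>
    define A where "A t = \<tau> * len ({a..t} - U) / 2" for t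
    define B where "B t = (s t - s a) / \<tau> / 2" for t
    define C where "C t = \<sigma> * (t - a) / 2" for t
    define D where "D t = len (W \<inter> {s a..s t}) / \<sigma> / 2" for t
    define H where "H t = A t + B t + C t + D t" for t
    have A_mono: "A t \<le> A u" if "t \<le> u" for t u
    proof -
      have "len ({a..t} - U) \<le> len ({a..u} - U)"
        using that by (intro measure_mono_fmeasurable meas_U fmeasurableD) auto
      then show ?thesis using tau by (simp add: A_def)
    qed
    have D_mono: "D t \<le> D u" if "s t \<le> s u" for t u
    proof -
      have "len (W \<inter> {s a..s t}) \<le> len (W \<inter> {s a..s u})"
        using that by (intro measure_mono_fmeasurable meas_W fmeasurableD) auto
      then show ?thesis using sig by (simp add: D_def divide_right_mono)
    qed
    have B_mono: "B t \<le> B u" if "s t \<le> s u" for t u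
      using that tau by (simp add: B_def divide_right_mono)
    have C_mono: "C t \<le> C u" if "t \<le> u" for t u
      using that sig by (simp add: C_def)
    have H_mono: "H t \<le> H u" if "t \<in> U" "u \<in> U" "t \<le> u" for t u
      using A_mono[OF that(3)] B_mono[OF s_mono[OF that]] C_mono[OF that(3)] D_mono[OF s_mono[OF that]]
      by (simp add: H_def)
    \<comment> \<open>Continuous induction: the supremum of the good points is itself good, and it
      cannot lie before \<open>b\<close>.\<close>
    define T where "T = {t \<in> U. a \<le> t \<and> t \<le> b \<and> N a t \<le> H t}"
    have "0 \<le> H a" using tau sig by (simp add: H_def A_def B_def C_def D_def)
    then have "a \<in> T" using ab by (simp add: T_def N_def)
    define c where "c = Sup T"
    have bdd: "bdd_above T" by (auto simp: T_def bdd_above_def)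
    have c_ge: "t \<le> c" if "t \<in> T" for t using that bdd by (simp add: c_def cSup_upper)
    have ex: "\<exists>t\<in>T. c - \<eta> < t" if "\<eta> > 0" for \<eta>
      using less_cSup_iff[OF _ bdd, of "c - \<eta>"] \<open>a \<in> T\<close> that by (auto simp: c_def)
    have "c \<in> closure T"
      unfolding c_def using closure_contains_Sup[OF _ bdd] \<open>a \<in> T\<close> by blast
    then have cU: "c \<in> U"
      using closure_minimal[of T U] compact_imp_closed[OF U] by (auto simp: T_def)
    have "a \<le> c" "c \<le> b" using c_ge[OF \<open>a \<in> T\<close>] \<open>a \<in> T\<close> by (auto simp: c_def T_def intro!: cSup_least)
    \<comment> \<open>The bound survives the passage to the supremum because \<open>\<zeta>\<close>
      is Lipschitz on \<open>U\<close> and \<open>H\<close> is monotone there.\<close>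
    have "N a c \<le> H c + \<eta>" if "\<eta> > 0" for \<eta>
    proof -
      obtain t where t: "t \<in> T" "c - M * (\<eta> / sqrt M) < t" using ex[of "M * (\<eta> / sqrt M)"] M \<open>\<eta> > 0\<close> by auto
      then have tU: "t \<in> U" "t \<le> c" "N a t \<le> H t" using c_ge by (auto simp: T_def)
      have "\<bar>c - t\<bar> \<le> M * (\<eta> / sqrt M)" using t(2) tU(2) by linarith
      then have "\<bar>c - t\<bar> / M \<le> \<eta> / sqrt M" using M by (simp add: divide_le_eq mult.commute)
      then have "norm (\<zeta> c - \<zeta> t) \<le> \<eta> / sqrt M" using lip[OF tU(1) cU] by linarith
      then have "N t c \<le> \<eta>"
        unfolding N_def using M by (simp add: le_divide_eq mult.commute)
      then show ?thesis using N_tri[of a c t] H_mono[OF tU(1) cU tU(2)] tU(3) by linarith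
    qed
    then have "N a c \<le> H c" by (rule field_le_epsilon)
    have "c = b"
    proof (rule ccontr)
      assume "c \<noteq> b"
      then have "c < b" using \<open>c \<le> b\<close> by simp
      have contr: False if d: "d \<in> U" "c < d" "d \<le> b" and "N c d \<le> H d - H c" for d
      proof -
        have "N a d \<le> H d" using N_tri[of a d c] that(4) \<open>N a c \<le> H c\<close> by linarith
        then have "d \<in> T" using d \<open>a \<le> c\<close> by (auto simp: T_def)
        then show False using c_ge d by force
      qed
      \<comment> \<open>With \<open>d\<close> the infimum of the points of \<open>U\<close> beyond
        \<open>c\<close>, either a gap starts at \<open>c\<close> or \<open>U\<close> accumulates at
        \<open>c\<close> from the right.\<close>
      define V where "V = U \<inter> {c<..b}"
      have "b \<in> V" using ab \<open>c < b\<close> by (auto simp: V_def)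
      define d where "d = Inf V"
      have bddV: "bdd_below V" by (rule bdd_belowI[of _ c]) (auto simp: V_def)
      have d_le: "d \<le> t" if "t \<in> V" for t using that bddV by (simp add: d_def cInf_lower)
      have "c \<le> d" unfolding d_def using \<open>b \<in> V\<close> by (intro cInf_greatest) (auto simp: V_def)
      have "d \<le> b" using d_le \<open>b \<in> V\<close> by auto
      have "d \<in> closure V" unfolding d_def using closure_contains_Inf[OF _ bddV] \<open>b \<in> V\<close> by blast
      then have dU: "d \<in> U"
        using closure_minimal[of V U] compact_imp_closed[OF U] by (auto simp: V_def)
      show False
      proof (cases "c < d")
        case True
        have gap: "{c<..<d} \<inter> U = {}"
        proof -
          have False if "t \<in> U" "c < t" "t < d" for t
            using d_le[of t] that \<open>d \<le> b\<close> by (auto simp: V_def)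
          then show ?thesis by auto
        qed
        have "len ({a..c} - U) + (d - c) = len (({a..c} - U) \<union> {c<..<d})"
        proof -
          have "{c<..<d} - ({a..c} - U) = {c<..<d}" by auto
          then show ?thesis using True by (subst measure_Un2) (auto intro: meas_U)
        qed
        also have "\<dots> \<le> len ({a..d} - U)"
          using gap True \<open>a \<le> c\<close> by (intro measure_mono_fmeasurable meas_U) (auto intro: fmeasurableD meas_U)
        finally have "\<tau> * (len ({a..c} - U) + (d - c)) \<le> \<tau> * len ({a..d} - U)"
          using tau by (intro mult_left_mono) auto
        then have "A c + \<tau> * (d - c) / 2 \<le> A d"
          unfolding A_def distrib_left by linarith
        moreover have "N c d \<le> \<tau> * (d - c) / 2 + (B d - B c)"
          using N_le[OF cU dU _ tau] True unfolding B_def diff_divide_distrib by argo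
        moreover have "C c \<le> C d" "D c \<le> D d"
          using C_mono[of c d] D_mono[OF s_mono[of c d]] cU dU True by auto
        ultimately have "N c d \<le> H d - H c" unfolding H_def by linarith
        then show False using contr[OF dU True \<open>d \<le> b\<close>] by simp
      next
        case False
        then have "d = c" using \<open>c \<le> d\<close> by simp
        obtain \<delta> where \<delta>: "\<delta> > 0" "ball (s c) \<delta> \<subseteq> W"
          using W cU openE[of W "s c"] by blast
        \<comment> \<open>The point \<open>t\<close> is so close to \<open>c\<close> that the whole
          interval from \<open>s c\<close> to \<open>s t\<close> lies in \<open>W\<close>;
          \<open>D\<close> pays for its length.\<close>
        obtain t where t: "t \<in> V" "t < c + M * \<delta>"
          using cInf_less_iff[OF _ bddV, of "c + M * \<delta>"] \<open>b \<in> V\<close> \<open>d = c\<close> M \<delta> by (auto simp: d_def)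
        have tU: "t \<in> U" "c < t" "t \<le> b" using t by (auto simp: V_def)
        have st: "s c \<le> s t" using s_mono tU cU by auto
        have "s t - s c \<le> (t - c) / M" using s_norm[of t c] lip[OF cU tU(1)] tU by auto
        also have "\<dots> < \<delta>" using t M by (simp add: field_simps)
        finally have sub: "{s c..s t} \<subseteq> W" using \<delta>(2) by (force simp: dist_real_def)
        have "len (W \<inter> {s a..s c}) + (s t - s c) = len ((W \<inter> {s a..s c}) \<union> {s c<..s t})"
        proof -
          have "{s c<..s t} - W \<inter> {s a..s c} = {s c<..s t}" by auto
          moreover have "{s c<..s t} \<in> lmeasurable"
            by (rule bounded_set_imp_lmeasurable) (auto intro: bounded_subset[OF bounded_closed_interval[of "s c" "s t"]])
          ultimately show ?thesis using st by (subst measure_Un2) (auto intro: meas_W)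
        qed
        also have "\<dots> \<le> len (W \<inter> {s a..s t})"
          using sub st s_mono[OF ab(1) cU \<open>a \<le> c\<close>]
          by (intro measure_mono_fmeasurable meas_W sets.Un fmeasurableD[OF meas_W]) auto
        finally have "(len (W \<inter> {s a..s c}) + (s t - s c)) / \<sigma> \<le> len (W \<inter> {s a..s t}) / \<sigma>"
          using sig by (intro divide_right_mono) auto
        then have "D c + (s t - s c) / \<sigma> / 2 \<le> D t"
          unfolding D_def add_divide_distrib[symmetric] by (rule divide_right_mono) simp
        moreover have "N c t \<le> (s t - s c) / \<sigma> / 2 + (C t - C c)"
          using N_le[OF cU tU(1) _ sig] tU unfolding C_def right_diff_distrib by argo
        moreover have "A c \<le> A t" "B c \<le> B t" using A_mono[of c t] B_mono[OF st] tU by auto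
        ultimately have "N c t \<le> H t - H c" unfolding H_def by linarith
        then show False using contr[OF tU] by simp
      qed
    qed
    have "N a b \<le> H b" using \<open>N a c \<le> H c\<close> \<open>c = b\<close> by simp
    also have "H b \<le> (\<tau> * len ({a..b} - U) + (s b - s a) / \<tau>) / 2 + \<sigma> * (b - a + 1) / 2"
    proof -
      have "len (W \<inter> {s a..s b}) \<le> \<sigma>\<^sup>2"
        using measure_mono_fmeasurable[of "W \<inter> {s a..s b}" W lebesgue] W meas_W by (auto intro: fmeasurableD)
      then have "len (W \<inter> {s a..s b}) / \<sigma> \<le> \<sigma>"
        using sig by (simp add: power2_eq_square divide_le_eq)
      moreover have "\<sigma> * (b - a + 1) = \<sigma> * (b - a) + \<sigma>" by (simp add: algebra_simps)
      ultimately show ?thesis unfolding H_def A_def B_def C_def D_def by argo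
    qed
    finally show ?thesis .
  qed
  have "N a b \<le> (\<tau> * len ({a..b} - U) + (s b - s a) / \<tau>) / 2" if "\<tau> > 0" for \<tau>
  proof (rule field_le_epsilon)
    fix \<eta> :: real assume "\<eta> > 0"
    have pos: "b - a + 1 > 0" using ab by simp
    then have "2 * \<eta> / (b - a + 1) > 0" using \<open>\<eta> > 0\<close> by simp
    from key[OF that this] show "N a b \<le> (\<tau> * len ({a..b} - U) + (s b - s a) / \<tau>) / 2 + \<eta>"
      using pos by simp
  qed
  then have "(N a b)\<^sup>2 \<le> len ({a..b} - U) * (s b - s a)"
    using s_mono[OF ab] M by (intro weighted_am_gm_converse) (auto simp: N_def)
  then show ?thesis using M by (simp add: N_def power_mult_distrib s_diff)
qed

text \<open>The line is cut into cells of length \<open>h\<close>, so short that the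
  \<open>h\<close>-balls around \<open>U\<close> stay in an open \<open>W\<close> with
  \<open>len (W - U)\<close> below \<open>\<delta>\<close>. In each cell the hull of
  \<open>U\<close> is at most \<open>K\<close> times as long as its gaps, and the gaps of all cells
  are disjoint parts of \<open>W - U\<close>. Hence \<open>len U\<close> is at most K times
  \<open>\<delta>\<close>.\<close>

lemma negligible_if_gaps_everywhere:
  fixes U :: "real set"
  assumes U: "compact U" and K: "K \<ge> 0"
    and gaps: "\<And>a b. a \<in> U \<Longrightarrow> b \<in> U \<Longrightarrow> a < b \<Longrightarrow> b - a \<le> K * len ({a..b} - U)"
  shows "negligible U"
proof -
  have Um: "U \<in> lmeasurable" using U by (rule lmeasurable_compact)
  have "len U \<le> K * \<delta>" if "\<delta> > 0" for \<delta>
  proof -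
    obtain W where W: "open W" "U \<subseteq> W" "W \<in> lmeasurable" "len (W - U) < \<delta>"
      using lmeasurable_outer_open[OF Um \<open>\<delta> > 0\<close>] by auto
    obtain h where h: "h > 0" "\<And>x. x \<in> U \<Longrightarrow> ball x h \<subseteq> W"
      using Heine_Borel_lemma[OF U, of "{W}"] W by auto
    define I where "I k = {of_int k * h..<(of_int k + 1) * h}" for k :: int
    have I_iff: "x \<in> I k \<longleftrightarrow> \<lfloor>x / h\<rfloor> = k" for x k
      using h by (auto simp: I_def floor_eq_iff field_simps)
    define J where "J = (\<lambda>x. \<lfloor>x / h\<rfloor>) ` U"
    have "finite J"
    proof -
      obtain B where B: "\<And>x. x \<in> U \<Longrightarrow> \<bar>x\<bar> \<le> B" using compact_imp_bounded[OF U] by (auto simp: bounded_iff)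
      have "\<lfloor>- B / h\<rfloor> \<le> \<lfloor>x / h\<rfloor> \<and> \<lfloor>x / h\<rfloor> \<le> \<lfloor>B / h\<rfloor>" if "x \<in> U" for x
        using B[OF that] h by (intro conjI floor_mono divide_right_mono) auto
      then have "J \<subseteq> {\<lfloor>- B / h\<rfloor>..\<lfloor>B / h\<rfloor>}" by (auto simp: J_def)
      then show ?thesis using finite_subset by blast
    qed
    have disj: "disjoint_family_on I J" by (auto simp: disjoint_family_on_def I_iff)
    have I_lm: "I k \<in> lmeasurable" for k
      unfolding I_def
      by (rule bounded_set_imp_lmeasurable) (auto intro: bounded_subset[OF bounded_closed_interval])
    have UI: "U = (\<Union>k\<in>J. U \<inter> I k)" by (auto simp: J_def I_iff)
    have "len U \<le> (\<Sum>k\<in>J. len (U \<inter> I k))"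
      by (subst UI) (rule measure_UNION_le[OF \<open>finite J\<close>], use Um I_lm in \<open>auto intro!: fmeasurableD fmeasurable.Int\<close>)
    also have "\<dots> \<le> (\<Sum>k\<in>J. K * len ((W - U) \<inter> I k))"
    proof (rule sum_mono)
      fix k assume "k \<in> J"
      define V where "V = U \<inter> I k"
      have "V \<noteq> {}" using \<open>k \<in> J\<close> by (auto simp: V_def J_def I_iff)
      have bdd: "bdd_above V" "bdd_below V"
        by (rule bdd_aboveI[of _ "(of_int k + 1) * h"] bdd_belowI[of _ "of_int k * h"], auto simp: V_def I_def)+
      define a b where "a = Inf V" and "b = Sup V"
      have "closure V \<subseteq> U" using compact_imp_closed[OF U] by (intro closure_minimal) (auto simp: V_def)
      then have abU: "a \<in> U" "b \<in> U"
        using closure_contains_Inf[OF \<open>V \<noteq> {}\<close> bdd(2)] closure_contains_Sup[OF \<open>V \<noteq> {}\<close> bdd(1)]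
        by (auto simp: a_def b_def)
      have V_ab: "a \<le> x" "x \<le> b" if "x \<in> V" for x
        using that bdd by (auto simp: a_def b_def cInf_lower cSup_upper)
      have "a \<le> b" using V_ab \<open>V \<noteq> {}\<close> by fastforce
      have aI: "of_int k * h \<le> a" unfolding a_def using \<open>V \<noteq> {}\<close> by (intro cInf_greatest) (auto simp: V_def I_def)
      have bI: "b \<le> (of_int k + 1) * h" unfolding b_def using \<open>V \<noteq> {}\<close> by (intro cSup_least) (auto simp: V_def I_def)
      have "len (U \<inter> I k) \<le> len {a..b}"
        using V_ab Um I_lm by (intro measure_mono_fmeasurable) (auto simp: V_def intro!: fmeasurableD fmeasurable.Int)
      also have "\<dots> = b - a" using \<open>a \<le> b\<close> by simp
      also have "\<dots> \<le> K * len ((W - U) \<inter> I k)"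
      proof (cases "a < b")
        case True
        have "{a..b} - U \<subseteq> (W - U) \<inter> I k"
        proof
          fix x assume x: "x \<in> {a..b} - U"
          then have "x < b" "a \<le> x" using abU by (auto simp: less_le)
          \<comment> \<open>Both endpoints lie in the closure of one cell, and \<open>x < b\<close>
            makes the distance strictly less than \<open>h\<close>.\<close>
          then have "x \<in> ball a h" using aI bI by (auto simp: dist_real_def algebra_simps)
          then have "x \<in> W" using h(2)[OF abU(1)] by auto
          moreover have "x \<in> I k" using aI bI \<open>x < b\<close> \<open>a \<le> x\<close> by (auto simp: I_def)
          ultimately show "x \<in> (W - U) \<inter> I k" using x by auto
        qed
        then have "len ({a..b} - U) \<le> len ((W - U) \<inter> I k)"
          using W Um I_lm by (intro measure_mono_fmeasurable) (auto intro!: fmeasurable.Diff fmeasurable.Int fmeasurableD)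
        then have "K * len ({a..b} - U) \<le> K * len ((W - U) \<inter> I k)"
          using K by (rule mult_left_mono)
        then show ?thesis using gaps[OF abU True] by linarith
      qed (use \<open>a \<le> b\<close> K in auto)
      finally show "len (U \<inter> I k) \<le> K * len ((W - U) \<inter> I k)" .
    qed
    also have "\<dots> = K * (\<Sum>k\<in>J. len ((W - U) \<inter> I k))" by (simp add: sum_distrib_left)
    also have "(\<Sum>k\<in>J. len ((W - U) \<inter> I k)) = len (\<Union>k\<in>J. (W - U) \<inter> I k)"
    proof (rule measure_finite_Union[symmetric])
      show "(\<lambda>k. (W - U) \<inter> I k) ` J \<subseteq> sets lebesgue"
        using W Um I_lm by (auto intro!: fmeasurableD fmeasurable.Int fmeasurable.Diff)
      show "disjoint_family_on (\<lambda>k. (W - U) \<inter> I k) J"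
        using disj by (auto simp: disjoint_family_on_def)
      show "emeasure lebesgue ((W - U) \<inter> I k) \<noteq> \<infinity>" for k
        using fmeasurableD2[of "(W - U) \<inter> I k" lebesgue] W Um I_lm
        by (auto intro!: fmeasurable.Int fmeasurable.Diff fmeasurableD)
    qed (rule \<open>finite J\<close>)
    also have "\<dots> \<le> len (W - U)"
      using W Um I_lm \<open>finite J\<close> by (intro measure_mono_fmeasurable) (auto intro!: fmeasurable.Diff fmeasurableD sets.finite_UN)
    also have "\<dots> \<le> \<delta>" using W by simp
    finally show ?thesis using K by (simp add: mult_left_mono)
  qed
  note le = this
  have "len U \<le> 0 + \<eta>" if "\<eta> > 0" for \<eta>
  proof -
    \<comment> \<open>The choice \<delta> = \<eta> / (K + 1) also covers
      \<open>K = 0\<close>.\<close>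
    have "K / (K + 1) \<le> 1" using K by simp
    then have "K * (\<eta> / (K + 1)) \<le> \<eta>" using mult_right_mono[of "K / (K + 1)" 1 \<eta>] that by simp
    moreover have "\<eta> / (K + 1) > 0" using that K by simp
    ultimately show ?thesis using le[of "\<eta> / (K + 1)"] by linarith
  qed
  then have "len U \<le> 0" by (rule field_le_epsilon)
  then show ?thesis using Um by (simp add: negligible_iff_measure measure_le_0_iff)
qed

text \<open>The increment of \<open>\<zeta> \<bullet> e\<close> times \<open>b - a\<close> is at
  most K M |\<Delta>\<zeta>|^2 by \<open>upper\<close>, and M |\<Delta>\<zeta>|^2 is at most the gap
  length times the same increment. Injectivity makes the increment nonzero, so it cancels and gaps
  fill at least the fraction 1 / K of each interval.\<close>

lemma negligible_domain_of_monotone_curve: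
  fixes U :: "real set" and \<zeta> :: "real \<Rightarrow> 'a::euclidean_space" and e :: 'a
  assumes U: "compact U" and M: "M > 0" and e: "norm e = 1"
    and lower: "\<And>t u. t \<in> U \<Longrightarrow> u \<in> U \<Longrightarrow>
        M * (norm (\<zeta> u - \<zeta> t))\<^sup>2 \<le> (u - t) * ((\<zeta> u - \<zeta> t) \<bullet> e)"
    and upper: "\<And>t u. t \<in> U \<Longrightarrow> u \<in> U \<Longrightarrow>
        (u - t) * ((\<zeta> u - \<zeta> t) \<bullet> e) \<le> K * M * (norm (\<zeta> u - \<zeta> t))\<^sup>2"
    and inj: "inj_on \<zeta> U" and K: "K > 0"
    and null: "negligible ((\<lambda>t. \<zeta> t \<bullet> e) ` U)"
  shows "negligible U"
proof (rule negligible_if_gaps_everywhere[OF U, of K])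
  fix a b assume ab: "a \<in> U" "b \<in> U" "a < b"
  let ?L = "len ({a..b} - U)" and ?s = "(\<zeta> b - \<zeta> a) \<bullet> e"
  have "M * (norm (\<zeta> b - \<zeta> a))\<^sup>2 > 0" using inj_onD[OF inj _ ab(1,2)] ab M by (auto simp: zero_less_mult_iff)
  moreover have *: "M * (norm (\<zeta> b - \<zeta> a))\<^sup>2 \<le> ?L * ?s"
    using ab by (intro monotone_curve_estimate[OF U _ _ _ M e lower null]) auto
  ultimately have "?L * ?s > 0" by linarith
  then have s: "?s > 0" using measure_nonneg[of lebesgue "{a..b} - U"] by (auto simp: zero_less_mult_iff)
  have "(b - a) * ?s \<le> K * (M * (norm (\<zeta> b - \<zeta> a))\<^sup>2)" using upper[OF ab(1,2)] by simp
  also have "\<dots> \<le> K * (?L * ?s)" using * K by (intro mult_left_mono) auto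
  finally have "(b - a) * ?s \<le> (K * ?L) * ?s" by (simp add: mult.assoc)
  then show "b - a \<le> K * ?L" using s by simp
qed (use K in simp)

section \<open>Slices of closed null sets and exchange of coordinates\<close>

lemma negligible_closed_iff_AE:
  fixes E :: "'a::euclidean_space set"
  assumes "closed E"
  shows "negligible E \<longleftrightarrow> (AE x in lborel. x \<notin> E)"
proof -
  have E: "E \<in> sets lborel" using assms by auto
  have "negligible E \<longleftrightarrow> E \<in> null_sets lborel"
    unfolding negligible_iff_null_sets using E by (rule null_sets_completion_iff)
  also have "\<dots> \<longleftrightarrow> (AE x in lborel. x \<notin> E)" using AE_iff_null_sets[OF E] .
  finally show ?thesis .
qed

text \<open>Averaging over all translates along \<open>e\<close> replaces a decomposition of the space into
  the line spanned by \<open>e\<close> and a complement.\<close>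

lemma negligible_closed_iff_AE_slices:
  fixes E :: "'a::euclidean_space set" and e :: 'a
  assumes "closed E"
  shows "negligible E \<longleftrightarrow> (AE w in lborel. negligible {s. w + s *\<^sub>R e \<in> E})"
proof -
  have [measurable]: "E \<in> sets borel" using assms by auto
  have trans: "(AE w in lborel. w + v \<notin> E) \<longleftrightarrow> (AE x in lborel. x \<notin> E)" for v
  proof -
    have "(AE x in lborel. x \<notin> E) \<longleftrightarrow> (AE x in distr lborel borel ((+) v). x \<notin> E)"
      by (simp only: lborel_distr_plus)
    also have "\<dots> \<longleftrightarrow> (AE w in lborel. v + w \<notin> E)"
      by (subst AE_distr_iff) auto
    finally show ?thesis by (simp add: add.commute)
  qed
  have "closed {s. w + s *\<^sub>R e \<in> E}" for w
  proof -
    have "closed ((\<lambda>s. w + s *\<^sub>R e) -` E)"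
      by (rule continuous_closed_vimage[OF assms]) (auto intro!: continuous_intros)
    then show ?thesis by (simp add: vimage_def)
  qed
  then have "(AE w in lborel. negligible {s. w + s *\<^sub>R e \<in> E}) \<longleftrightarrow>
      (AE w in lborel. AE s in lborel. w + s *\<^sub>R e \<notin> E)"
    by (simp add: negligible_closed_iff_AE)
  also have "\<dots> \<longleftrightarrow> (AE s::real in lborel. AE w in lborel. w + s *\<^sub>R e \<notin> E)"
    by (rule lborel_pair.AE_commute[symmetric]) measurable
  also have "\<dots> \<longleftrightarrow> (AE s::real in lborel. AE x in lborel. x \<notin> E)" by (simp only: trans)
  \<comment> \<open>The inner statement no longer depends on \<open>s\<close>, and a constant holds
    almost everywhere on the line exactly when it is true.\<close>
  also have "\<dots> \<longleftrightarrow> (AE x in lborel. x \<notin> E)" by (simp add: eventually_const_iff ae_filter_eq_bot_iff)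
  finally show ?thesis using assms by (simp add: negligible_closed_iff_AE)
qed

text \<open>A chain between the two projections: \<open>Basis\<close> selects \<open>fst\<close>,
  the empty set selects \<open>snd\<close>, and removing one basis vector exchanges one
  coordinate.\<close>

definition mix_coords :: "'a::euclidean_space set \<Rightarrow> 'a \<times> 'a \<Rightarrow> 'a" where
  "mix_coords S q = (\<Sum>b\<in>Basis. (if b \<in> S then fst q \<bullet> b else snd q \<bullet> b) *\<^sub>R b)"

lemma mix_coords_inner:
  "b \<in> Basis \<Longrightarrow> mix_coords S q \<bullet> b = (if b \<in> S then fst q \<bullet> b else snd q \<bullet> b)"
  by (simp add: mix_coords_def)

lemma mix_coords_Basis: "mix_coords Basis q = fst q"
  by (simp add: mix_coords_def euclidean_representation)

lemma mix_coords_empty: "mix_coords {} q = snd q"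
  by (simp add: mix_coords_def euclidean_representation)

lemma continuous_on_mix_coords: "continuous_on A (mix_coords S)"
proof -
  have "continuous_on A (\<lambda>q. if b \<in> S then fst q \<bullet> b else snd q \<bullet> b)" for b :: 'a
    by (cases "b \<in> S") (auto intro!: continuous_intros)
  then show ?thesis unfolding mix_coords_def by (intro continuous_intros) auto
qed

text \<open>Trading the coordinate \<open>e\<close> of the first component for that of the second: on the slices in
  direction \<open>e\<close> all other terms of the inner product vanish, so the slices are monotone curves.\<close>

lemma negligible_mix_coords_remove:
  fixes Q :: "('a::euclidean_space \<times> 'a) set"
  assumes Q: "compact Q" and M: "M > 0" and K: "K > 0"
    and lower: "\<And>z y z' y'. (z, y) \<in> Q \<Longrightarrow> (z', y') \<in> Q \<Longrightarrow>
        M * (norm (z' - z))\<^sup>2 \<le> (y' - y) \<bullet> (z' - z)"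
    and upper: "\<And>z y z' y'. (z, y) \<in> Q \<Longrightarrow> (z', y') \<in> Q \<Longrightarrow>
        (y' - y) \<bullet> (z' - z) \<le> K * M * (norm (z' - z))\<^sup>2"
    and inj: "\<And>z y y'. (z, y) \<in> Q \<Longrightarrow> (z, y') \<in> Q \<Longrightarrow> y = y'"
    and e: "e \<in> Basis" "e \<notin> S"
    and null: "negligible (mix_coords (insert e S) ` Q)"
  shows "negligible (mix_coords S ` Q)"
proof -
  have closed: "closed (mix_coords T ` Q)" for T :: "'a set"
    by (intro compact_imp_closed compact_continuous_image continuous_on_mix_coords Q)
  have slice: "negligible {s. w + s *\<^sub>R e \<in> mix_coords S ` Q}"
    if w: "negligible {s. w + s *\<^sub>R e \<in> mix_coords (insert e S) ` Q}" for w
  proof -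
    \<comment> \<open>The part of \<open>Q\<close> seen by the slice through \<open>w\<close>: all
      mixed coordinates other than \<open>e\<close> are prescribed.\<close>
    define R where "R = {q \<in> Q. \<forall>b\<in>Basis - {e}. mix_coords S q \<bullet> b = w \<bullet> b}"
    have "R = Q \<inter> (\<Inter>b\<in>Basis - {e}. {q. mix_coords S q \<bullet> b = w \<bullet> b})" by (auto simp: R_def)
    moreover have "closed (\<Inter>b\<in>Basis - {e}. {q. mix_coords S q \<bullet> b = w \<bullet> b})"
      by (intro closed_INT ballI closed_Collect_eq continuous_intros continuous_on_mix_coords)
    ultimately have "compact R" using Q by (simp add: compact_Int_closed)
    have RQ: "R \<subseteq> Q" by (auto simp: R_def)
    have inner: "(snd r - snd q) \<bullet> (fst r - fst q) = ((snd r - snd q) \<bullet> e) * ((fst r - fst q) \<bullet> e)"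
      if "q \<in> R" "r \<in> R" for q r
    proof -
      \<comment> \<open>For \<open>b\<close> in \<open>S\<close> the first components agree in
        direction \<open>b\<close>, otherwise the second ones do; either way one factor is
        zero.\<close>
      have "((snd r - snd q) \<bullet> b) * ((fst r - fst q) \<bullet> b) = 0" if "b \<in> Basis - {e}" for b
      proof -
        have "mix_coords S q \<bullet> b = mix_coords S r \<bullet> b" using \<open>q \<in> R\<close> \<open>r \<in> R\<close> that by (simp add: R_def)
        then show ?thesis using that by (auto simp: mix_coords_inner inner_diff_left split: if_splits)
      qed
      then have "(\<Sum>b\<in>Basis - {e}. ((snd r - snd q) \<bullet> b) * ((fst r - fst q) \<bullet> b)) = 0"
        by (rule sum.neutral[rule_format])
      then show ?thesis
        using e(1) by (subst euclidean_inner) (simp add: sum.remove[of Basis e])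
    qed
    define U where "U = (\<lambda>q. snd q \<bullet> e) ` R"
    have "compact U" unfolding U_def
      by (intro compact_continuous_image \<open>compact R\<close> continuous_intros)
    \<comment> \<open>An arbitrary selection serves, since both bounds hold for all pairs of points
      in \<open>Q\<close>.\<close>
    define pick where "pick t = (SOME q. q \<in> R \<and> snd q \<bullet> e = t)" for t
    have pick: "pick t \<in> R \<and> snd (pick t) \<bullet> e = t" if "t \<in> U" for t
      unfolding pick_def by (rule someI_ex) (use that in \<open>unfold U_def, blast\<close>)
    define \<zeta> where "\<zeta> t = fst (pick t)" for t
    have prod: "(u - t) * ((\<zeta> u - \<zeta> t) \<bullet> e) = (snd (pick u) - snd (pick t)) \<bullet> (\<zeta> u - \<zeta> t)"
      if "t \<in> U" "u \<in> U" for t u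
      using inner[of "pick t" "pick u"] pick[OF that(1)] pick[OF that(2)]
      by (simp add: \<zeta>_def inner_diff_left)
    have inQ: "(\<zeta> t, snd (pick t)) \<in> Q" if "t \<in> U" for t
      using pick[OF that] RQ by (auto simp: \<zeta>_def)
    have "negligible U"
    proof (rule negligible_domain_of_monotone_curve[OF \<open>compact U\<close> M, of e \<zeta> K])
      show "norm e = 1" using e by simp
      show "inj_on \<zeta> U"
      proof (rule inj_onI)
        fix t u assume tu: "t \<in> U" "u \<in> U" "\<zeta> t = \<zeta> u"
        then have "snd (pick t) = snd (pick u)" using inj inQ by metis
        then show "t = u" using pick tu by metis
      qed
      \<comment> \<open>\<open>insert e S\<close> reads coordinate \<open>e\<close> from the first
        component, so up to a shift by \<open>w \<bullet> e\<close> this image lies in the slice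
        assumed to be null.\<close>
      have "(\<lambda>t. \<zeta> t \<bullet> e) ` U \<subseteq> (+) (w \<bullet> e) ` {s. w + s *\<^sub>R e \<in> mix_coords (insert e S) ` Q}"
      proof clarify
        fix t assume "t \<in> U"
        define q where "q = pick t"
        have q: "q \<in> R" using pick[OF \<open>t \<in> U\<close>] by (simp add: q_def)
        have "w + (\<zeta> t \<bullet> e - w \<bullet> e) *\<^sub>R e = mix_coords (insert e S) q"
        proof (rule euclidean_eqI)
          fix b :: 'a assume b: "b \<in> Basis"
          show "(w + (\<zeta> t \<bullet> e - w \<bullet> e) *\<^sub>R e) \<bullet> b = mix_coords (insert e S) q \<bullet> b"
          proof (cases "b = e")
            case True then show ?thesis using e by (simp add: mix_coords_inner inner_add_left q_def \<zeta>_def)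
          next
            case False
            then have "mix_coords S q \<bullet> b = w \<bullet> b" using q b by (simp add: R_def)
            then show ?thesis using False b e by (simp add: mix_coords_inner inner_add_left inner_not_same_Basis)
          qed
        qed
        then show "\<zeta> t \<bullet> e \<in> (+) (w \<bullet> e) ` {s. w + s *\<^sub>R e \<in> mix_coords (insert e S) ` Q}"
          using q RQ by (intro image_eqI[of _ _ "\<zeta> t \<bullet> e - w \<bullet> e"]) auto
      qed
      then show "negligible ((\<lambda>t. \<zeta> t \<bullet> e) ` U)"
        by (rule negligible_subset[OF negligible_translation[OF w]])
    next
      fix t u assume tu: "t \<in> U" "u \<in> U"
      show "M * (norm (\<zeta> u - \<zeta> t))\<^sup>2 \<le> (u - t) * ((\<zeta> u - \<zeta> t) \<bullet> e)"
        using lower[OF inQ[OF tu(1)] inQ[OF tu(2)]] by (simp add: prod[OF tu])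
      show "(u - t) * ((\<zeta> u - \<zeta> t) \<bullet> e) \<le> K * M * (norm (\<zeta> u - \<zeta> t))\<^sup>2"
        using upper[OF inQ[OF tu(1)] inQ[OF tu(2)]] by (simp add: prod[OF tu])
    qed (rule K)
    \<comment> \<open>\<open>S\<close> reads coordinate \<open>e\<close> from the second component,
      so a shifted copy of the parameter set covers this slice.\<close>
    moreover have "{s. w + s *\<^sub>R e \<in> mix_coords S ` Q} \<subseteq> (+) (- (w \<bullet> e)) ` U"
    proof
      fix s assume "s \<in> {s. w + s *\<^sub>R e \<in> mix_coords S ` Q}"
      then obtain q where q: "q \<in> Q" "w + s *\<^sub>R e = mix_coords S q" by auto
      have "mix_coords S q \<bullet> b = w \<bullet> b" if "b \<in> Basis - {e}" for b
        using that e by (auto simp flip: q(2) simp: inner_add_left inner_Basis)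
      then have "q \<in> R" using q by (simp add: R_def)
      moreover have "snd q \<bullet> e = w \<bullet> e + s"
        using e mix_coords_inner[OF e(1), of S q] by (simp flip: q(2) add: inner_add_left)
      ultimately show "s \<in> (+) (- (w \<bullet> e)) ` U" by (force simp: U_def)
    qed
    ultimately show ?thesis by (metis negligible_translation negligible_subset)
  qed
  have "AE w in lborel. negligible {s. w + s *\<^sub>R e \<in> mix_coords (insert e S) ` Q}"
    using null closed negligible_closed_iff_AE_slices by blast
  then have "AE w in lborel. negligible {s. w + s *\<^sub>R e \<in> mix_coords S ` Q}"
    by (rule AE_mp) (use slice in auto)
  then show ?thesis using closed negligible_closed_iff_AE_slices by blast
qed

text \<open>The two bounds and \<open>inj\<close> concern \<open>Q\<close> itself and do not depend
  on the coordinates selected, so the same relation serves every exchange.\<close>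

lemma negligible_snd_of_monotone_relation:
  fixes Q :: "('a::euclidean_space \<times> 'a) set"
  assumes Q: "compact Q" and M: "M > 0" and K: "K > 0"
    and lower: "\<And>z y z' y'. (z, y) \<in> Q \<Longrightarrow> (z', y') \<in> Q \<Longrightarrow>
        M * (norm (z' - z))\<^sup>2 \<le> (y' - y) \<bullet> (z' - z)"
    and upper: "\<And>z y z' y'. (z, y) \<in> Q \<Longrightarrow> (z', y') \<in> Q \<Longrightarrow>
        (y' - y) \<bullet> (z' - z) \<le> K * M * (norm (z' - z))\<^sup>2"
    and inj: "\<And>z y y'. (z, y) \<in> Q \<Longrightarrow> (z, y') \<in> Q \<Longrightarrow> y = y'"
    and null: "negligible (fst ` Q)"
  shows "negligible (snd ` Q)"
proof -
  have "finite S \<Longrightarrow> S \<subseteq> Basis \<Longrightarrow> negligible (mix_coords S ` Q) \<Longrightarrow> negligible (mix_coords {} ` Q)"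
    for S :: "'a set"
  proof (induction S rule: finite_induct)
    case (insert e S)
    then show ?case
      using negligible_mix_coords_remove[OF Q M K lower upper inj, where e = e and S = S] by auto
  qed
  from this[of Basis] null show ?thesis
    by (simp add: mix_coords_Basis[abs_def] mix_coords_empty[abs_def])
qed

section \<open>Barycenters of finitely many points\<close>

text \<open>The formula is the gradient also at \<open>u = 0\<close>: there
  \<open>0 powr (p - 2)\<close> is 0 by convention and the vector factor vanishes as well.\<close>

definition powr_grad :: "real \<Rightarrow> 'a::euclidean_space \<Rightarrow> 'a" where
  "powr_grad p u = (p * norm u powr (p - 2)) *\<^sub>R u"

lemma powr_mult_self: "0 \<le> a \<Longrightarrow> (a::real) powr (p - 2) * a = a powr (p - 1)"
  using powr_mult_base[of a "p - 2"] by (simp add: mult.commute)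

lemma norm_powr_grad: "p \<ge> 0 \<Longrightarrow> norm (powr_grad p u) = p * norm u powr (p - 1)"
  by (simp add: powr_grad_def mult.assoc powr_mult_self)

lemma has_derivative_norm_powr:
  fixes u :: "'a::euclidean_space"
  assumes "p > 1"
  shows "((\<lambda>u. norm u powr p) has_derivative (\<lambda>e. powr_grad p u \<bullet> e)) (at u)"
proof (cases "u = 0")
  case False
  have "((\<lambda>x. x powr p) has_real_derivative p * norm u powr (p - 1)) (at (norm u))"
    using has_real_derivative_powr[of "norm u" p] False by simp
  moreover have "(norm has_derivative (\<lambda>e. sgn u \<bullet> e)) (at u)"
    using has_derivative_norm[OF False] by (simp add: inner_commute[of _ "sgn u"])
  ultimately have "((\<lambda>u. norm u powr p) has_derivative (\<lambda>e. (sgn u \<bullet> e) * (p * norm u powr (p - 1)))) (at u)"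
    by (rule DERIV_compose_FDERIV)
  moreover have "norm u powr (p - 1) = norm u powr (p - 2) * norm u" by (simp add: powr_mult_self)
  then have "(sgn u \<bullet> e) * (p * norm u powr (p - 1)) = powr_grad p u \<bullet> e" for e
    using False by (simp add: powr_grad_def sgn_div_norm)
  ultimately show ?thesis by simp
next
  case True
  \<comment> \<open>At the origin the difference quotient is \<open>norm h powr (p - 1)\<close>,
    which tends to 0 because \<open>p > 1\<close>.\<close>
  have "((\<lambda>h::'a. norm h powr (p - 1)) \<longlongrightarrow> 0) (at 0)"
    using assms by (intro tendsto_zero_powrI[where b = "p - 1"] tendsto_norm_zero tendsto_ident_at tendsto_const) auto
  moreover have "norm h powr (p - 1) = norm (norm (0 + h) powr p - norm (0::'a) powr p - 0 \<bullet> h) / norm h"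
    if "h \<noteq> 0" for h :: 'a
    using that assms by (simp add: powr_diff)
  ultimately have "((\<lambda>h::'a. norm (norm (0 + h) powr p - norm (0::'a) powr p - 0 \<bullet> h) / norm h) \<longlongrightarrow> 0) (at 0)"
    by (rule Lim_transform_eventually[OF _ eventually_mono[OF eventually_neq_at_within]]) auto
  then show ?thesis using True by (simp add: has_derivative_at powr_grad_def bounded_linear_zero)
qed

lemma continuous_on_norm_powr [continuous_intros]:
  assumes "p > 1" "continuous_on S f"
  shows "continuous_on S (\<lambda>x. norm (f x :: 'a::euclidean_space) powr p)"
  using assms by (intro continuous_on_powr' continuous_intros) auto

text \<open>Cauchy-Schwarz reduces the claim to monotonicity of \<open>a powr (p - 1)\<close> in the
  norm. Strictness comes from this function if the norms differ, and from |u - v|^2 > 0 if they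
  agree.\<close>

lemma powr_grad_strict_mono:
  fixes u v :: "'a::euclidean_space"
  assumes p: "p > 1" and "u \<noteq> v"
  shows "(powr_grad p u - powr_grad p v) \<bullet> (u - v) > 0"
proof -
  define a b where "a = norm u" and "b = norm v"
  define s t where "s = a powr (p - 2)" and "t = b powr (p - 2)"
  have ab: "a \<ge> 0" "b \<ge> 0" "u \<bullet> u = a\<^sup>2" "v \<bullet> v = b\<^sup>2" "u \<bullet> v \<le> a * b"
    by (auto simp: a_def b_def power2_norm_eq_inner norm_cauchy_schwarz)
  have st: "s \<ge> 0" "t \<ge> 0" by (auto simp: s_def t_def)
  have eq: "(powr_grad p u - powr_grad p v) \<bullet> (u - v) = p * (s * a\<^sup>2 + t * b\<^sup>2 - (s + t) * (u \<bullet> v))"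
    unfolding powr_grad_def a_def[symmetric] b_def[symmetric] s_def[symmetric] t_def[symmetric]
    by (simp add: inner_diff inner_commute[of v u] ab algebra_simps)
  have "s * a\<^sup>2 + t * b\<^sup>2 - (s + t) * (u \<bullet> v) > 0"
  proof (cases "a = b")
    case True
    have "0 < (u - v) \<bullet> (u - v)" using \<open>u \<noteq> v\<close> by (simp only: inner_gt_zero_iff) simp
    then have "u \<bullet> v < a\<^sup>2" using True by (simp add: inner_diff inner_commute[of v u] ab)
    moreover have "a \<noteq> 0" using True \<open>u \<noteq> v\<close> by (auto simp: a_def b_def)
    then have "s > 0" by (simp add: s_def)
    moreover have "t = s" using True by (simp add: s_def t_def)
    ultimately show ?thesis using True by (simp add: algebra_simps)
  next
    case False
    have "a powr (p - 1) < b powr (p - 1)" if "a < b" using that p ab by (intro powr_less_mono2) auto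
    moreover have "b powr (p - 1) < a powr (p - 1)" if "b < a" using that p ab by (intro powr_less_mono2) auto
    ultimately have "0 < (a powr (p - 1) - b powr (p - 1)) * (a - b)"
      using False by (auto simp: zero_less_mult_iff neq_iff)
    also have "\<dots> = (s * a - t * b) * (a - b)" using ab by (simp add: s_def t_def powr_mult_self)
    also have "\<dots> = s * a\<^sup>2 + t * b\<^sup>2 - (s + t) * (a * b)" by (simp add: algebra_simps power2_eq_square)
    also have "\<dots> \<le> s * a\<^sup>2 + t * b\<^sup>2 - (s + t) * (u \<bullet> v)"
      using ab st by (simp add: mult_left_mono)
    finally show ?thesis .
  qed
  then show ?thesis using p by (simp add: eq)
qed

lemma powr_grad_inject: "p > 1 \<Longrightarrow> powr_grad p u = powr_grad p v \<longleftrightarrow> u = v"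
  using powr_grad_strict_mono[of p u v] by (cases "u = v") auto

text \<open>Away from 0, |u|^p is a smooth function of |u|^2, which is a quadratic polynomial. This
  leaves a one-dimensional Taylor bound for \<open>t powr (p / 2)\<close>, and
  \<open>norm e \<le> r / 2\<close> keeps both arguments in a compact interval of positive
  numbers.\<close>

lemma norm_powr_second_order:
  fixes r R p :: real
  assumes "r > 0"
  obtains M where "M > 0"
    "\<And>u e :: 'a::euclidean_space. r \<le> norm u \<Longrightarrow> norm u \<le> R \<Longrightarrow> norm e \<le> r / 2 \<Longrightarrow>
      norm (u + e) powr p \<le> norm u powr p + powr_grad p u \<bullet> e + M * (norm e)\<^sup>2"
proof -
  define S where "S = {r\<^sup>2 / 4..(\<bar>R\<bar> + r)\<^sup>2}"
  define \<phi>1 where "\<phi>1 t = (p / 2) * t powr (p / 2 - 1)" for t :: real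
  define \<phi>2 where "\<phi>2 t = (p / 2) * ((p / 2 - 1) * t powr (p / 2 - 2))" for t :: real
  have Spos: "t > 0" if "t \<in> S" for t
  proof -
    have "0 < r\<^sup>2" using assms by simp
    moreover have "r\<^sup>2 / 4 \<le> t" using that by (auto simp: S_def)
    ultimately show ?thesis by linarith
  qed
  have "convex S" "compact S" by (auto simp: S_def)
  have d1: "((\<lambda>t. t powr (p / 2)) has_real_derivative \<phi>1 t) (at t within S)" if "t \<in> S" for t
    using has_real_derivative_powr[OF Spos[OF that], of "p / 2"]
    by (auto simp: \<phi>1_def intro: has_field_derivative_at_within)
  have d2: "(\<phi>1 has_real_derivative \<phi>2 t) (at t within S)" if "t \<in> S" for t
  proof -
    have "((\<lambda>t. (p / 2) * t powr (p / 2 - 1)) has_real_derivative (p / 2) * ((p / 2 - 1) * t powr (p / 2 - 1 - 1))) (at t within S)"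
      using has_real_derivative_powr[OF Spos[OF that], of "p / 2 - 1"]
      by (intro DERIV_cmult) (auto intro: has_field_derivative_at_within)
    then show ?thesis by (simp add: \<phi>1_def[abs_def] \<phi>2_def)
  qed
  have bounded: "\<exists>B>0. \<forall>t\<in>S. \<bar>c * t powr q\<bar> \<le> B" for c q :: real
  proof -
    have "continuous_on S (\<lambda>t. c * t powr q)"
      using Spos by (intro continuous_intros) fastforce
    then have "compact ((\<lambda>t. c * t powr q) ` S)" using \<open>compact S\<close> by (rule compact_continuous_image)
    then obtain B where "B > 0" "\<forall>x\<in>(\<lambda>t. c * t powr q) ` S. norm x \<le> B"
      using compact_imp_bounded bounded_pos by metis
    then show ?thesis by auto
  qed
  obtain B1 where B1: "B1 > 0" "\<And>t. t \<in> S \<Longrightarrow> \<bar>\<phi>1 t\<bar> \<le> B1"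
    using bounded[of "p / 2" "p / 2 - 1"] by (auto simp: \<phi>1_def)
  obtain B2 where B2: "B2 > 0" "\<And>t. t \<in> S \<Longrightarrow> \<bar>\<phi>2 t\<bar> \<le> B2"
    using bounded[of "(p / 2) * (p / 2 - 1)" "p / 2 - 2"] by (auto simp: \<phi>2_def mult.assoc)
  \<comment> \<open>The mean value inequality is applied twice: to \<open>\<phi>1\<close>, and then
    to the function minus its linear part at \<open>a\<close>.\<close>
  have taylor: "b powr (p / 2) \<le> a powr (p / 2) + \<phi>1 a * (b - a) + B2 * (b - a)\<^sup>2"
    if "a \<in> S" "b \<in> S" for a b
  proof -
    let ?T = "closed_segment a b"
    have T: "?T \<subseteq> S" using that \<open>convex S\<close> by (rule closed_segment_subset)
    have d: "((\<lambda>t. t powr (p / 2) - \<phi>1 a * t) has_real_derivative \<phi>1 t - \<phi>1 a) (at t within ?T)"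
      if "t \<in> ?T" for t
      using DERIV_subset[OF d1[of t] T] that T by (intro DERIV_diff DERIV_cmult_Id) auto
    have le: "norm (\<phi>1 t - \<phi>1 a) \<le> B2 * \<bar>b - a\<bar>" if "t \<in> ?T" for t
    proof -
      have "norm (\<phi>1 t - \<phi>1 a) \<le> B2 * norm (t - a)"
        using that T \<open>a \<in> S\<close> B2 by (intro field_differentiable_bound[OF \<open>convex S\<close> d2]) auto
      also have "norm (t - a) \<le> \<bar>b - a\<bar>"
        using segment_bound(1)[OF that] by simp
      finally show ?thesis using B2 by (simp add: mult_left_mono)
    qed
    have "norm ((b powr (p / 2) - \<phi>1 a * b) - (a powr (p / 2) - \<phi>1 a * a)) \<le> (B2 * \<bar>b - a\<bar>) * norm (b - a)"
      by (intro field_differentiable_bound[OF convex_closed_segment d le]) auto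
    also have "\<dots> = B2 * (b - a)\<^sup>2" by (simp add: power2_eq_square mult.assoc flip: abs_mult)
    finally show ?thesis by (simp add: abs_le_iff algebra_simps)
  qed
  define L where "L = 2 * \<bar>R\<bar> + r"
  have "L > 0" using assms by (simp add: L_def)
  show thesis
  proof
    \<comment> \<open>\<open>B1\<close> pays for the term |e|^2 contained in \<open>b - a\<close>,
      and \<open>B2\<close> times the square of \<open>L\<close> for the Taylor remainder.\<close>
    show "B1 + B2 * L\<^sup>2 > 0" using B1 B2 by (simp add: add_pos_nonneg)
    fix u e :: 'a
    assume ue: "r \<le> norm u" "norm u \<le> R" "norm e \<le> r / 2"
    define a b where "a = (norm u)\<^sup>2" and "b = (norm (u + e))\<^sup>2"
    have n1: "r / 2 \<le> norm (u + e)" using ue norm_diff_ineq[of u e] by linarith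
    have n2: "norm (u + e) \<le> \<bar>R\<bar> + r" using ue norm_triangle_ineq[of u e] assms by linarith
    have "(r / 2)\<^sup>2 \<le> b" unfolding b_def using n1 assms by (intro power_mono) auto
    moreover have "b \<le> (\<bar>R\<bar> + r)\<^sup>2" unfolding b_def using n2 by (intro power_mono) auto
    ultimately have "b \<in> S" by (simp add: S_def power_divide)
    have "(r / 2)\<^sup>2 \<le> a" unfolding a_def using ue assms by (intro power_mono) auto
    moreover have "a \<le> (\<bar>R\<bar> + r)\<^sup>2" unfolding a_def using ue assms by (intro power_mono) auto
    ultimately have "a \<in> S" by (simp add: S_def power_divide)
    have ba: "b - a = 2 * (u \<bullet> e) + (norm e)\<^sup>2"
      by (simp add: a_def b_def power2_norm_eq_inner inner_add inner_commute[of e u])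
    have "\<bar>u \<bullet> e\<bar> \<le> norm u * norm e" by (rule Cauchy_Schwarz_ineq2)
    also have "\<dots> \<le> \<bar>R\<bar> * norm e" using ue by (intro mult_right_mono) auto
    finally have "\<bar>u \<bullet> e\<bar> \<le> \<bar>R\<bar> * norm e" .
    moreover have "(norm e)\<^sup>2 \<le> r * norm e"
      using ue mult_right_mono[of "norm e" r "norm e"] assms by (simp add: power2_eq_square)
    moreover have "\<bar>b - a\<bar> \<le> 2 * \<bar>u \<bullet> e\<bar> + (norm e)\<^sup>2"
      unfolding ba using abs_triangle_ineq[of "2 * (u \<bullet> e)" "(norm e)\<^sup>2"] by (simp add: abs_mult)
    ultimately have "\<bar>b - a\<bar> \<le> 2 * (\<bar>R\<bar> * norm e) + r * norm e" by linarith
    then have "\<bar>b - a\<bar> \<le> L * norm e" by (simp add: L_def algebra_simps)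
    then have "(b - a)\<^sup>2 \<le> (L * norm e)\<^sup>2" by (metis abs_ge_zero power2_abs power_mono)
    then have sq: "B2 * (b - a)\<^sup>2 \<le> B2 * L\<^sup>2 * (norm e)\<^sup>2"
      using B2 by (simp add: power_mult_distrib)
    have pw: "(norm w)\<^sup>2 powr (p / 2) = norm w powr p" if "w \<noteq> 0" for w :: 'a
      using that by (simp add: powr_powr flip: powr_numeral)
    have nz: "u \<noteq> 0" "u + e \<noteq> 0" using ue n1 assms by auto
    have \<phi>1a: "\<phi>1 a = (p / 2) * norm u powr (p - 2)"
      using nz by (simp add: \<phi>1_def a_def powr_powr algebra_simps flip: powr_numeral)
    have "norm (u + e) powr p = b powr (p / 2)" using pw nz by (simp add: b_def)
    also have "\<dots> \<le> a powr (p / 2) + \<phi>1 a * (b - a) + B2 * (b - a)\<^sup>2"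
      by (rule taylor[OF \<open>a \<in> S\<close> \<open>b \<in> S\<close>])
    also have "a powr (p / 2) = norm u powr p" using pw nz by (simp add: a_def)
    also have "\<phi>1 a * (b - a) = powr_grad p u \<bullet> e + \<phi>1 a * (norm e)\<^sup>2"
      unfolding ba by (simp add: \<phi>1a powr_grad_def distrib_left)
    also have "\<phi>1 a * (norm e)\<^sup>2 \<le> B1 * (norm e)\<^sup>2"
      using B1(2)[OF \<open>a \<in> S\<close>] by (intro mult_right_mono) auto
    finally show "norm (u + e) powr p \<le> norm u powr p + powr_grad p u \<bullet> e + (B1 + B2 * L\<^sup>2) * (norm e)\<^sup>2"
      using sq by (simp add: distrib_right)
  qed
qed

text \<open>The norm of \<open>powr_grad p u\<close> is \<open>p * norm u powr (p - 1)\<close>;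
  solving for \<open>norm u\<close> gives this inverse of the gradient away from 0.\<close>

definition powr_grad_inv :: "real \<Rightarrow> 'a::euclidean_space \<Rightarrow> 'a" where
  "powr_grad_inv p v = ((norm v / p) powr (1 / (p - 1)) / norm v) *\<^sub>R v"

lemma powr_grad_inv:
  assumes "p > 1" "u \<noteq> 0"
  shows "powr_grad_inv p (powr_grad p u) = u"
proof -
  have "norm (powr_grad p u) = p * norm u powr (p - 1)" using assms by (simp add: norm_powr_grad)
  moreover have "(norm u powr (p - 1)) powr (1 / (p - 1)) = norm u"
    using assms by (simp add: powr_powr)
  moreover have "norm u powr (p - 1) = norm u powr (p - 2) * norm u" by (simp add: powr_mult_self)
  ultimately show ?thesis using assms by (simp add: powr_grad_inv_def powr_grad_def)
qed

lemma differentiable_powr_grad_inv: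
  fixes v :: "'a::euclidean_space"
  assumes "p > 1" "v \<noteq> 0"
  shows "powr_grad_inv p differentiable (at v)"
proof -
  define g where "g t = (t / p) powr (1 / (p - 1)) / t" for t :: real
  have "\<exists>D. (g has_real_derivative D) (at (norm v))"
    unfolding g_def using assms by (intro exI) (auto intro!: derivative_eq_intros)
  then obtain D where "(g has_real_derivative D) (at (norm v))" by blast
  from DERIV_compose_FDERIV[OF this has_derivative_norm[OF assms(2)]]
  have "(\<lambda>v. g (norm v)) differentiable (at v)" by (auto simp: differentiable_def)
  then have "(\<lambda>v. g (norm v) *\<^sub>R v) differentiable (at v)"
    by (intro differentiable_scaleR) auto
  then show ?thesis by (simp add: powr_grad_inv_def[abs_def] g_def)
qed

lemma continuous_on_powr_grad:
  assumes "0 \<notin> S"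
  shows "continuous_on S (powr_grad p :: 'a::euclidean_space \<Rightarrow> 'a)"
  unfolding powr_grad_def[abs_def] using assms by (intro continuous_intros) auto

section \<open>Existence, uniqueness and continuity of the barycenter of a tuple\<close>

locale barycentric_weights =
  fixes p :: real and lam :: "'n::finite \<Rightarrow> real"
  assumes p: "p > 1" and lam_pos: "\<And>i. lam i > 0"
begin

abbreviation "objective \<equiv> bary_objective p lam"
abbreviation "bary \<equiv> bary_point p lam"
abbreviation "cost \<equiv> bary_cost p lam"

lemma objective_nonneg: "0 \<le> objective x z"
  unfolding bary_objective_def using lam_pos by (intro sum_nonneg mult_nonneg_nonneg) (auto intro: less_imp_le)

lemma continuous_on_objective [continuous_intros]:
  fixes f :: "'b::topological_space \<Rightarrow> 'a::euclidean_space ^ 'n"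
  assumes "continuous_on S f" "continuous_on S g"
  shows "continuous_on S (\<lambda>t. objective (f t) (g t))"
  unfolding bary_objective_def using p assms by (intro continuous_intros) auto

lemma has_derivative_objective:
  "(objective x has_derivative (\<lambda>e. - (\<Sum>i\<in>UNIV. lam i *\<^sub>R powr_grad p (x $ i - z)) \<bullet> e)) (at z)"
proof -
  have "((\<lambda>z. lam i * norm (x $ i - z) powr p) has_derivative
      (\<lambda>e. lam i * (powr_grad p (x $ i - z) \<bullet> - e))) (at z)" for i
  proof (rule has_derivative_mult_right)
    have "((\<lambda>z. x $ i - z) has_derivative uminus) (at z)"
      by (auto intro!: derivative_eq_intros)
    from has_derivative_compose[OF this has_derivative_norm_powr[OF p]]
    show "((\<lambda>z. norm (x $ i - z) powr p) has_derivative (\<lambda>e. powr_grad p (x $ i - z) \<bullet> - e)) (at z)" .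
  qed
  then have "((\<lambda>z. \<Sum>i\<in>UNIV. lam i * norm (x $ i - z) powr p) has_derivative
      (\<lambda>e. \<Sum>i\<in>UNIV. lam i * (powr_grad p (x $ i - z) \<bullet> - e))) (at z)"
    by (rule has_derivative_sum)
  then show ?thesis
    by (simp add: bary_objective_def[abs_def] inner_sum_left sum_negf)
qed

lemma stationary:
  assumes "\<And>w. objective x z \<le> objective x w"
  shows "(\<Sum>i\<in>UNIV. lam i *\<^sub>R powr_grad p (x $ i - z)) = 0"
proof -
  let ?g = "\<Sum>i\<in>UNIV. lam i *\<^sub>R powr_grad p (x $ i - z)"
  have "(\<lambda>e. - ?g \<bullet> e) = (\<lambda>e. 0)"
    using has_derivative_local_min[OF has_derivative_objective[of x z]] assms by (simp add: always_eventually)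
  then have "- ?g \<bullet> ?g = 0" by metis
  then show ?thesis by simp
qed

text \<open>Every summand has a strictly monotone gradient, hence so has the objective, which
  therefore cannot be stationary at two points.\<close>

lemma minimizer_unique:
  assumes "\<And>w. objective x z \<le> objective x w" "\<And>w. objective x z' \<le> objective x w"
  shows "z = z'"
proof (rule ccontr)
  assume "z \<noteq> z'"
  have "(powr_grad p (x $ i - z) - powr_grad p (x $ i - z')) \<bullet> (z' - z) > 0" for i
    using powr_grad_strict_mono[OF p, of "x $ i - z" "x $ i - z'"] \<open>z \<noteq> z'\<close> by auto
  then have "0 < (\<Sum>i\<in>UNIV. lam i * ((powr_grad p (x $ i - z) - powr_grad p (x $ i - z')) \<bullet> (z' - z)))"
    using lam_pos by (intro sum_pos) auto
  also have "\<dots> = ((\<Sum>i\<in>UNIV. lam i *\<^sub>R powr_grad p (x $ i - z))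
      - (\<Sum>i\<in>UNIV. lam i *\<^sub>R powr_grad p (x $ i - z'))) \<bullet> (z' - z)"
    by (simp add: inner_sum_left inner_diff_left right_diff_distrib sum_subtractf)
  also have "\<dots> = 0" by (simp add: stationary[OF assms(1)] stationary[OF assms(2)])
  finally show False by simp
qed

text \<open>Each \<open>x $ i\<close> is closer to 0 than to such a \<open>z\<close>. This confines
  minimizers to a compact ball and yields the bound on the barycenter.\<close>

lemma objective_far:
  assumes "\<And>i. norm (x $ i) \<le> R" "norm z > 2 * R"
  shows "objective x 0 < objective x z"
  unfolding bary_objective_def
proof (rule sum_strict_mono)
  fix i :: 'n
  have "norm z \<le> norm (x $ i) + norm (x $ i - z)"
    using norm_triangle_ineq4[of "x $ i" "x $ i - z"] by simp
  then have "norm (x $ i) < norm (x $ i - z)" using assms(1)[of i] assms(2) by linarith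
  then show "lam i * norm (x $ i - 0) powr p < lam i * norm (x $ i - z) powr p"
    using lam_pos p by (simp add: powr_less_mono2)
qed auto

lemma ex_minimizer: "\<exists>z. \<forall>w. objective x z \<le> objective x w"
proof -
  define R where "R = norm x"
  have R: "norm (x $ i) \<le> R" for i by (simp add: R_def Finite_Cartesian_Product.norm_nth_le)
  have "\<exists>z\<in>cball 0 (2 * R). \<forall>w\<in>cball 0 (2 * R). objective x z \<le> objective x w"
    by (rule continuous_attains_inf) (auto simp: R_def intro!: continuous_intros)
  then obtain z where "\<forall>w\<in>cball 0 (2 * R). objective x z \<le> objective x w" by blast
  then have z: "objective x z \<le> objective x w" if "norm w \<le> 2 * R" for w using that by simp
  have "objective x z \<le> objective x w" for w
    using z[of w] z[of 0] objective_far[OF R, of w] by (force simp: R_def)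
  then show ?thesis by blast
qed

lemma bary_minimal: "objective x (bary x) \<le> objective x w"
proof -
  obtain z where "\<forall>w. objective x z \<le> objective x w" using ex_minimizer by blast
  then have "\<forall>w. objective x (bary x) \<le> objective x w"
    unfolding bary_point_def by (rule theI) (use \<open>\<forall>w. objective x z \<le> objective x w\<close> minimizer_unique in blast)
  then show ?thesis by blast
qed

lemma bary_eqI: "(\<And>w. objective x z \<le> objective x w) \<Longrightarrow> bary x = z"
  using bary_minimal minimizer_unique by blast

lemma cost_eq: "cost x = objective x (bary x)"
  unfolding bary_cost_def
  by (rule antisym) (auto intro!: cINF_lower cINF_greatest bdd_belowI2[where m = 0] simp: objective_nonneg bary_minimal)

lemma cost_le: "cost x \<le> objective x z"
  by (simp add: cost_eq bary_minimal)

lemma cost_nonneg: "0 \<le> cost x"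
  by (simp add: cost_eq objective_nonneg)

lemma bary_stationary: "(\<Sum>i\<in>UNIV. lam i *\<^sub>R powr_grad p (x $ i - bary x)) = 0"
  by (rule stationary) (rule bary_minimal)

lemma bary_eq_if_cost: "objective x z \<le> cost x \<Longrightarrow> bary x = z"
  using bary_eqI cost_le order_trans by blast

lemma norm_bary_le:
  assumes "\<And>i. norm (x $ i) \<le> R"
  shows "norm (bary x) \<le> 2 * R"
  using objective_far[OF assms, of "bary x"] bary_minimal[of x 0] by force

text \<open>On a ball the values stay in a compact ball, and by uniqueness the graph is cut out by
  the closed conditions that define a minimizer. A closed graph with values in a compact set gives
  continuity.\<close>

lemma continuous_on_bary [continuous_intros]:
  fixes f :: "'b::topological_space \<Rightarrow> 'a::euclidean_space ^ 'n"
  assumes "continuous_on S f"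
  shows "continuous_on S (\<lambda>t. bary (f t))"
proof -
  have cb: "continuous_on (cball 0 R) (bary :: 'a ^ 'n \<Rightarrow> 'a)" for R
  proof (rule continuous_from_closed_graph[of "cball 0 (2 * R)"])
    show "(bary :: 'a ^ 'n \<Rightarrow> 'a) \<in> cball 0 R \<rightarrow> cball 0 (2 * R)"
      by (auto intro!: norm_bary_le intro: order_trans[OF Finite_Cartesian_Product.norm_nth_le])
    have "(\<lambda>x. (x, bary x)) ` cball (0 :: 'a ^ 'n) R =
        {q. fst q \<in> cball 0 R} \<inter> (\<Inter>w. {q. objective (fst q) (snd q) \<le> objective (fst q) w})"
    proof (intro equalityI subsetI)
      fix q :: "('a ^ 'n) \<times> 'a"
      assume q: "q \<in> {q. fst q \<in> cball 0 R} \<inter> (\<Inter>w. {q. objective (fst q) (snd q) \<le> objective (fst q) w})"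
      then have "bary (fst q) = snd q" by (intro bary_eqI) blast
      then have "q = (fst q, bary (fst q))" by simp
      then show "q \<in> (\<lambda>x. (x, bary x)) ` cball 0 R" using q by blast
    next
      fix q :: "('a ^ 'n) \<times> 'a" assume "q \<in> (\<lambda>x. (x, bary x)) ` cball 0 R"
      then obtain x where "q = (x, bary x)" "x \<in> cball 0 R" by blast
      then show "q \<in> {q. fst q \<in> cball 0 R} \<inter> (\<Inter>w. {q. objective (fst q) (snd q) \<le> objective (fst q) w})"
        by (simp add: bary_minimal)
    qed
    also have "closed \<dots>"
    proof (intro closed_Int closed_INT ballI closed_Collect_le continuous_intros)
      have "closed (fst -` cball (0 :: 'a ^ 'n) R :: (('a ^ 'n) \<times> 'a) set)"
        by (intro continuous_closed_vimage) (auto intro: continuous_intros)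
      then show "closed {q :: ('a ^ 'n) \<times> 'a. fst q \<in> cball 0 R}" by (simp add: vimage_def)
    qed
    finally show "closed ((\<lambda>x. (x, bary x)) ` cball (0 :: 'a ^ 'n) R)" .
  qed simp
  have "isCont bary x" for x :: "'a ^ 'n"
  proof (rule continuous_on_interior[OF cb])
    show "x \<in> interior (cball 0 (norm x + 1))" by simp
  qed
  then have "continuous_on UNIV (bary :: 'a ^ 'n \<Rightarrow> 'a)" by (simp add: continuous_at_imp_continuous_on)
  from continuous_on_compose2[OF this assms] show ?thesis by simp
qed

lemma continuous_on_cost [continuous_intros]:
  fixes f :: "'b::topological_space \<Rightarrow> 'a::euclidean_space ^ 'n"
  assumes "continuous_on S f"
  shows "continuous_on S (\<lambda>t. cost (f t))"
  unfolding cost_eq using assms by (intro continuous_intros)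

end

section \<open>Plans with monotone support\<close>

lemma closed_measure_support: "closed (measure_support M)"
proof -
  have "- measure_support M = \<Union>{U. open U \<and> \<not> emeasure M U > 0}"
    by (auto simp: measure_support_def)
  then show ?thesis by (auto simp: closed_def)
qed

text \<open>The complement is a union of open null sets, and by Lindelof countably many of them
  already cover it.\<close>

lemma emeasure_compl_measure_support:
  fixes M :: "'b::second_countable_topology measure"
  assumes "sets M = sets borel"
  shows "emeasure M (- measure_support M) = 0"
proof -
  let ?F = "{U. open U \<and> \<not> emeasure M U > 0}"
  obtain F where F: "F \<subseteq> ?F" "countable F" "\<Union>F = \<Union>?F"
    using Lindelof[of ?F] by blast
  have "- measure_support M = \<Union>?F" by (auto simp: measure_support_def)
  moreover have "(\<Union>U\<in>F. U) \<in> null_sets M"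
    using F(1,2) assms by (intro null_sets_UN') (auto intro!: null_setsI)
  ultimately show ?thesis using F(3) by auto
qed

definition swap_coords :: "'n set \<Rightarrow> 'a ^ 'n::finite \<Rightarrow> 'a ^ 'n \<Rightarrow> 'a ^ 'n" where
  "swap_coords S a b = (\<chi> i. if i \<in> S then b $ i else a $ i)"

text \<open>The definition is applied with a transposition on \<open>S\<close> and the identity
  elsewhere.\<close>

lemma cp_monotone_swap:
  assumes "cp_monotone p lam \<Gamma>" "a \<in> \<Gamma>" "b \<in> \<Gamma>"
  shows "bary_cost p lam a + bary_cost p lam b \<le>
    bary_cost p lam (swap_coords S a b) + bary_cost p lam (swap_coords S b a)"
proof -
  define x where "x k = (if k = 1 then a else b)" for k :: nat
  define \<sigma> where "\<sigma> i = (if i \<in> S then Transposition.transpose 1 (2 :: nat) else id)" for i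
  have "\<forall>i. \<sigma> i permutes {1, 2 :: nat}"
    by (auto simp: \<sigma>_def intro: permutes_swap_id permutes_id)
  then have "bary_cost p lam (x 1) + bary_cost p lam (x 2)
      \<le> bary_cost p lam (\<chi> i. x (\<sigma> i 1) $ i) + bary_cost p lam (\<chi> i. x (\<sigma> i 2) $ i)"
    using assms(1)[unfolded cp_monotone_def, rule_format, of x \<sigma>] assms(2,3) by (simp add: x_def)
  moreover have "(\<chi> i. x (\<sigma> i 1) $ i) = swap_coords S a b" "(\<chi> i. x (\<sigma> i 2) $ i) = swap_coords S b a"
    by (auto simp: swap_coords_def x_def \<sigma>_def vec_eq_iff)
  ultimately show ?thesis by (simp add: x_def)
qed

lemma sum_swap_single:
  fixes F :: "'n::finite \<Rightarrow> 'a \<Rightarrow> 'b::ab_group_add"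
  shows "(\<Sum>j\<in>UNIV. F j (swap_coords {i} a b $ j)) = (\<Sum>j\<in>UNIV. F j (a $ j)) + (F i (b $ i) - F i (a $ i))"
  by (simp add: sum.remove[of UNIV i] swap_coords_def)

context barycentric_weights
begin

lemma objective_swap_single:
  "objective (swap_coords {i} a b) z =
    objective a z + lam i * (norm (b $ i - z) powr p - norm (a $ i - z) powr p)"
  unfolding bary_objective_def
  using sum_swap_single[of "\<lambda>j y. lam j * norm (y - z) powr p" i a b] by (simp add: right_diff_distrib)

lemma monotone_single_swap:
  assumes "cp_monotone p lam \<Gamma>" "x \<in> \<Gamma>" "y \<in> \<Gamma>"
  shows "norm (x $ i - bary x) powr p + norm (y $ i - bary y) powr p \<le>
    norm (y $ i - bary x) powr p + norm (x $ i - bary y) powr p"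
proof -
  have "cost x + cost y \<le> objective (swap_coords {i} x y) (bary x) + objective (swap_coords {i} y x) (bary y)"
    using cp_monotone_swap[OF assms, of "{i}"] cost_le[of "swap_coords {i} x y" "bary x"]
      cost_le[of "swap_coords {i} y x" "bary y"] by linarith
  then have "0 \<le> lam i * (norm (y $ i - bary x) powr p - norm (x $ i - bary x) powr p
      + (norm (x $ i - bary y) powr p - norm (y $ i - bary y) powr p))"
    by (simp add: objective_swap_single cost_eq distrib_left)
  then have "0 \<le> norm (y $ i - bary x) powr p - norm (x $ i - bary x) powr p
      + (norm (x $ i - bary y) powr p - norm (y $ i - bary y) powr p)"
    using lam_pos[of i] by (simp add: zero_le_mult_iff)
  then show ?thesis by linarith
qed

text \<open>If two points of a monotone set have the same barycenter, then it remains the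
  barycenter after swapping one coordinate, and stationarity determines that coordinate.\<close>

lemma bary_inj_on_monotone:
  fixes \<Gamma> :: "('a::euclidean_space ^ 'n) set"
  assumes mono: "cp_monotone p lam \<Gamma>"
  shows "inj_on bary \<Gamma>"
proof (rule inj_onI)
  fix x y assume xy: "x \<in> \<Gamma>" "y \<in> \<Gamma>" and eq: "bary x = bary y"
  have "x $ i = y $ i" for i
  proof -
    let ?A = "swap_coords {i} x y" and ?B = "swap_coords {i} y x" and ?z = "bary x"
    have "objective ?A ?z + objective ?B ?z = cost x + cost y"
      using eq by (simp add: objective_swap_single cost_eq algebra_simps)
    also have "\<dots> \<le> cost ?A + cost ?B" by (rule cp_monotone_swap[OF mono xy])
    \<comment> \<open>The cost of \<open>?B\<close> is at most its objective at \<open>?z\<close>,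
      so the inequality between the sums passes to \<open>?A\<close> alone.\<close>
    finally have "objective ?A ?z \<le> cost ?A" using cost_le[of ?B ?z] by linarith
    then have "bary ?A = ?z" by (rule bary_eq_if_cost)
    then have "(\<Sum>j\<in>UNIV. lam j *\<^sub>R powr_grad p (?A $ j - ?z)) = 0"
      using bary_stationary[of ?A] by simp
    \<comment> \<open>The stationarity sums of \<open>x\<close> and \<open>?A\<close> at
      \<open>?z\<close> differ only in term \<open>i\<close>.\<close>
    then have "lam i *\<^sub>R powr_grad p (y $ i - ?z) = lam i *\<^sub>R powr_grad p (x $ i - ?z)"
      using bary_stationary[of x] sum_swap_single[of "\<lambda>j w. lam j *\<^sub>R powr_grad p (w - ?z)" i x y] by simp
    then show ?thesis using lam_pos[of i] by (simp add: powr_grad_inject[OF p])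
  qed
  then show "x = y" by (simp add: vec_eq_iff)
qed

text \<open>The null set of barycenters is carried on in two steps: from z to \<open>Y\<close> by
  the exchange of coordinates, and from \<open>Y\<close> to coordinate \<open>k\<close> by a locally
  Lipschitz map. The conditions \<open>notJ\<close> and \<open>small\<close> place all displacements
  within reach of the second-order bound.\<close>

lemma negligible_coordinate_of_piece:
  fixes C :: "('a::euclidean_space ^ 'n) set"
  assumes mono: "cp_monotone p lam \<Gamma>" and C: "compact C" "C \<subseteq> \<Gamma>" and r: "r > 0"
    and J: "\<And>x i. x \<in> C \<Longrightarrow> i \<in> J \<Longrightarrow> x $ i = bary x"
    and notJ: "\<And>x i. x \<in> C \<Longrightarrow> i \<notin> J \<Longrightarrow> r \<le> norm (x $ i - bary x)"
    and small: "\<And>x y. x \<in> C \<Longrightarrow> y \<in> C \<Longrightarrow> norm (bary y - bary x) \<le> r / 2"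
    and null: "negligible (bary ` C)"
  shows "negligible ((\<lambda>x. x $ k) ` C)"
proof (cases "k \<in> J")
  case True
  then have "(\<lambda>x. x $ k) ` C = bary ` C" using J by (intro image_cong) auto
  then show ?thesis using null by simp
next
  case False
  have "\<exists>R. \<forall>x\<in>C. \<forall>i. norm (x $ i - bary x) \<le> R"
  proof -
    obtain B where B: "\<And>x. x \<in> C \<Longrightarrow> norm x \<le> B"
      using compact_imp_bounded[OF C(1)] by (auto simp: bounded_iff)
    have "norm (x $ i - bary x) \<le> B + 2 * B" if "x \<in> C" for x i
    proof -
      have "norm (x $ j) \<le> B" for j
        using B[OF that] Finite_Cartesian_Product.norm_nth_le[of x j] by linarith
      then show ?thesis
        using norm_triangle_ineq4[of "x $ i" "bary x"] norm_bary_le[of x B] by (metis add_mono order_trans)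
    qed
    then show ?thesis by blast
  qed
  then obtain R where R: "\<And>x i. x \<in> C \<Longrightarrow> norm (x $ i - bary x) \<le> R" by blast
  obtain M where M: "M > 0"
    "\<And>u e :: 'a. r \<le> norm u \<Longrightarrow> norm u \<le> R \<Longrightarrow> norm e \<le> r / 2 \<Longrightarrow>
      norm (u + e) powr p \<le> norm u powr p + powr_grad p u \<bullet> e + M * (norm e)\<^sup>2"
    using norm_powr_second_order[OF r] by metis
  define G where "G i x = powr_grad p (x $ i - bary x)" for i and x :: "'a ^ 'n"
  \<comment> \<open>The second-order bounds at the two configurations are added to the swap
    inequality; the powers cancel and only the gradient difference and 2 M |\<Delta>z|^2
    remain.\<close>
  have one_sided: "- (2 * M * (norm (bary y - bary x))\<^sup>2) \<le> (G i y - G i x) \<bullet> (bary y - bary x)"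
    if "x \<in> C" "y \<in> C" for x y i
  proof (cases "i \<in> J")
    case True
    then have "G i x = 0" "G i y = 0" using J that by (auto simp: G_def powr_grad_def)
    then show ?thesis using M by simp
  next
    case False
    let ?d = "bary y - bary x"
    have "norm (x $ i - bary y) powr p \<le> norm (x $ i - bary x) powr p - G i x \<bullet> ?d + M * (norm ?d)\<^sup>2"
      using M(2)[of "x $ i - bary x" "- ?d"] notJ[OF that(1) False] R[OF that(1)] small[OF that(2,1)]
      by (simp add: G_def inner_diff_right norm_minus_commute algebra_simps)
    moreover have "norm (y $ i - bary x) powr p \<le> norm (y $ i - bary y) powr p + G i y \<bullet> ?d + M * (norm ?d)\<^sup>2"
      using M(2)[of "y $ i - bary y" ?d] notJ[OF that(2) False] R[OF that(2)] small[OF that]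
      by (simp add: G_def)
    moreover have "norm (x $ i - bary x) powr p + norm (y $ i - bary y) powr p \<le>
        norm (y $ i - bary x) powr p + norm (x $ i - bary y) powr p"
      using monotone_single_swap[OF mono] that C by blast
    ultimately show ?thesis by (simp add: inner_diff_left)
  qed
  define L where "L = (\<Sum>i\<in>UNIV - {k}. lam i)"
  have "L \<ge> 0" unfolding L_def using lam_pos by (intro sum_nonneg) (auto intro: less_imp_le)
  \<comment> \<open>The first summand serves the lower bound. The second gives the upper bound: by
    stationarity the weighted inner products sum to zero, so the lower bounds for the other
    coordinates bound that of \<open>k\<close> from above, with factor
    \<open>L / lam k\<close>.\<close>
  define M' where "M' = 2 * M + 2 * M * L / lam k"
  have "M' > 0" using M lam_pos[of k] \<open>L \<ge> 0\<close> by (simp add: M'_def add_pos_nonneg)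
  have two_sided: "- (M' * (norm (bary y - bary x))\<^sup>2) \<le> (G k y - G k x) \<bullet> (bary y - bary x)"
    "(G k y - G k x) \<bullet> (bary y - bary x) \<le> M' * (norm (bary y - bary x))\<^sup>2"
    if "x \<in> C" "y \<in> C" for x y
  proof -
    let ?d = "bary y - bary x"
    have M': "M' * (norm ?d)\<^sup>2 = 2 * M * (norm ?d)\<^sup>2 + (2 * M * L * (norm ?d)\<^sup>2) / lam k"
      by (simp add: M'_def distrib_right)
    have "0 \<le> (2 * M * L * (norm ?d)\<^sup>2) / lam k" using M lam_pos[of k] \<open>L \<ge> 0\<close> by simp
    then show "- (M' * (norm ?d)\<^sup>2) \<le> (G k y - G k x) \<bullet> ?d"
      using one_sided[OF that, of k] M' by linarith
    have "(\<Sum>i\<in>UNIV. lam i *\<^sub>R (G i y - G i x)) = 0"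
      using bary_stationary[of x] bary_stationary[of y]
      by (simp add: G_def scaleR_diff_right sum_subtractf)
    then have "(\<Sum>i\<in>UNIV. lam i *\<^sub>R (G i y - G i x)) \<bullet> ?d = 0" by simp
    then have "(\<Sum>i\<in>UNIV. lam i * ((G i y - G i x) \<bullet> ?d)) = 0"
      by (simp only: inner_sum_left inner_scaleR_left)
    then have "lam k * ((G k y - G k x) \<bullet> ?d) = (\<Sum>i\<in>UNIV - {k}. lam i * - ((G i y - G i x) \<bullet> ?d))"
      by (simp add: sum.remove[of UNIV k] sum_negf)
    also have "\<dots> \<le> (\<Sum>i\<in>UNIV - {k}. lam i * (2 * M * (norm ?d)\<^sup>2))"
      using one_sided[OF that] lam_pos by (intro sum_mono mult_left_mono) (auto simp: less_imp_le minus_le_iff)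
    also have "\<dots> = 2 * M * L * (norm ?d)\<^sup>2"
      by (simp add: L_def flip: sum_distrib_right)
    finally have "(G k y - G k x) \<bullet> ?d \<le> (2 * M * L * (norm ?d)\<^sup>2) / lam k"
      using lam_pos[of k] by (simp add: pos_le_divide_eq mult.commute)
    then show "(G k y - G k x) \<bullet> ?d \<le> M' * (norm ?d)\<^sup>2"
    proof -
      have "0 \<le> 2 * M * (norm ?d)\<^sup>2" using M(1) by simp
      then show ?thesis using M' \<open>(G k y - G k x) \<bullet> ?d \<le> (2 * M * L * (norm ?d)\<^sup>2) / lam k\<close> by linarith
    qed
  qed
  \<comment> \<open>The shift moves the bounds from -M' and M' to M' and 3 M'.\<close>
  define Y where "Y x = G k x + (2 * M') *\<^sub>R bary x" for x
  have Y_diff: "(Y y - Y x) \<bullet> (bary y - bary x) =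
      (G k y - G k x) \<bullet> (bary y - bary x) + 2 * M' * (norm (bary y - bary x))\<^sup>2" for x y
    by (simp add: Y_def inner_diff_left inner_add_left power2_norm_eq_inner inner_diff_right algebra_simps)
  have lower: "M' * (norm (bary y - bary x))\<^sup>2 \<le> (Y y - Y x) \<bullet> (bary y - bary x)"
    if "x \<in> C" "y \<in> C" for x y using two_sided(1)[OF that] by (simp add: Y_diff)
  have inj: "x = y" if "x \<in> C" "y \<in> C" "bary x = bary y" for x y
    using bary_inj_on_monotone[OF mono] C(2) that by (auto dest: inj_onD)
  have nz: "x $ k - bary x \<noteq> 0" if "x \<in> C" for x using notJ[OF that False] r by auto
  have "continuous_on C Y"
  proof -
    have "continuous_on ((\<lambda>x. x $ k - bary x) ` C) (powr_grad p)"
      using nz by (intro continuous_on_powr_grad) (auto simp: image_iff)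
    then have "continuous_on C (G k)"
      unfolding G_def[abs_def] by (rule continuous_on_compose2) (auto intro!: continuous_intros)
    then show ?thesis unfolding Y_def[abs_def] by (intro continuous_intros)
  qed
  define Q where "Q = (\<lambda>x. (bary x, Y x)) ` C"
  have "negligible (snd ` Q)"
  proof (rule negligible_snd_of_monotone_relation[of Q M' 3])
    show "compact Q" unfolding Q_def
      using \<open>continuous_on C Y\<close> by (intro compact_continuous_image continuous_intros C)
    show "negligible (fst ` Q)" using null by (simp add: Q_def image_image)
    fix z y z' y' assume "(z, y) \<in> Q" "(z', y') \<in> Q"
    then obtain a b where ab: "a \<in> C" "b \<in> C" "z = bary a" "y = Y a" "z' = bary b" "y' = Y b"
      by (auto simp: Q_def)
    show "M' * (norm (z' - z))\<^sup>2 \<le> (y' - y) \<bullet> (z' - z)" using lower ab by simp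
    show "(y' - y) \<bullet> (z' - z) \<le> 3 * M' * (norm (z' - z))\<^sup>2"
      using two_sided(2)[OF ab(1,2)] unfolding ab Y_diff by linarith
  next
    fix z y y' assume "(z, y) \<in> Q" "(z, y') \<in> Q"
    then show "y = y'" using inj by (auto simp: Q_def)
  qed (use \<open>M' > 0\<close> in auto)
  then have "negligible (Y ` C)" by (simp add: Q_def image_image)
  \<comment> \<open>Strong monotonicity makes the barycenter a Lipschitz function of
    \<open>Y\<close>; since the barycenter determines the configuration, so does
    \<open>Y\<close>.\<close>
  have bary_Y: "norm (bary y - bary x) \<le> norm (Y y - Y x) / M'" if "x \<in> C" "y \<in> C" for x y
  proof (cases "bary y = bary x")
    case neq: False
    have "M' * (norm (bary y - bary x))\<^sup>2 \<le> norm (Y y - Y x) * norm (bary y - bary x)"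
      using lower[OF that] norm_cauchy_schwarz[of "Y y - Y x" "bary y - bary x"] by linarith
    then show ?thesis using neq \<open>M' > 0\<close> by (simp add: power2_eq_square field_simps)
  qed (use \<open>M' > 0\<close> in simp)
  have Y_inj: "x = y" if "x \<in> C" "y \<in> C" "Y x = Y y" for x y
    using bary_Y[OF that(1,2)] that by (intro inj) auto
  define f where "f w = inv_into C Y w $ k" for w
  have f: "f (Y x) = x $ k" if "x \<in> C" for x
    using that Y_inj by (simp add: f_def inj_on_def)
  \<comment> \<open>Coordinate \<open>k\<close> equals
    \<open>powr_grad_inv p (G k x) + bary x\<close>, and both \<open>G k x\<close> and
    \<open>bary x\<close> are Lipschitz in \<open>Y\<close>. A Lipschitz bound relative to each base
    point is enough here, so differentiability of the inverse gradient at that point provides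
    it.\<close>
  have "negligible (f ` (Y ` C))"
  proof (rule negligible_locally_Lipschitz_image[OF _ \<open>negligible (Y ` C)\<close>])
    fix w assume "w \<in> Y ` C"
    then obtain x where x: "x \<in> C" "w = Y x" by blast
    have "G k x \<noteq> 0" using nz[OF x(1)] p powr_grad_inject[OF p, of "x $ k - bary x" 0]
      by (simp add: G_def) (simp add: powr_grad_def)
    then obtain D where D: "(powr_grad_inv p has_derivative D) (at (G k x))"
      using differentiable_powr_grad_inv[OF p] by (auto simp: differentiable_def)
    obtain B where B: "B > 0" "\<And>v. norm (D v) \<le> norm v * B"
      using bounded_linear.pos_bounded[OF has_derivative_bounded_linear[OF D]] by blast
    obtain \<delta> where \<delta>: "\<delta> > 0" "\<And>v. norm (v - G k x) < \<delta> \<Longrightarrow>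
        norm (powr_grad_inv p v - powr_grad_inv p (G k x) - D (v - G k x)) \<le> 1 * norm (v - G k x)"
      using D unfolding has_derivative_at_alt by (metis zero_less_one)
    have G_inv: "powr_grad_inv p (G k y) = y $ k - bary y" if "y \<in> C" for y
      using nz[OF that] p by (simp add: G_def powr_grad_inv)
    \<comment> \<open>\<open>G k\<close> varies at most 3 times as fast as \<open>Y\<close>, hence
      the radius \<open>\<delta> / 3\<close>.\<close>
    have lip: "norm (f v - f w) \<le> (3 * (B + 1) + 1 / M') * norm (v - w)"
      if v: "v \<in> Y ` C \<inter> ball w (\<delta> / 3)" for v
    proof -
      obtain y where y: "y \<in> C" "v = Y y" using v by blast
      have d: "norm (Y y - Y x) < \<delta> / 3" using v x y by (simp add: dist_norm norm_minus_commute)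
      have z: "norm (bary y - bary x) \<le> norm (Y y - Y x) / M'" by (rule bary_Y[OF x(1) y(1)])
      have "G k y - G k x = (Y y - Y x) - (2 * M') *\<^sub>R (bary y - bary x)"
        by (simp add: Y_def algebra_simps)
      then have "norm (G k y - G k x) \<le> norm (Y y - Y x) + 2 * M' * norm (bary y - bary x)"
        using norm_triangle_ineq4[of "Y y - Y x" "(2 * M') *\<^sub>R (bary y - bary x)"] \<open>M' > 0\<close> by simp
      also have "\<dots> \<le> 3 * norm (Y y - Y x)"
        using z \<open>M' > 0\<close> by (simp add: field_simps)
      finally have g: "norm (G k y - G k x) \<le> 3 * norm (Y y - Y x)" .
      let ?a = "powr_grad_inv p (G k y) - powr_grad_inv p (G k x)"
      have "norm ?a \<le> norm (?a - D (G k y - G k x)) + norm (D (G k y - G k x))"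
        using norm_triangle_ineq[of "?a - D (G k y - G k x)" "D (G k y - G k x)"] by simp
      also have "\<dots> \<le> norm (G k y - G k x) + norm (G k y - G k x) * B"
        using \<delta>(2)[of "G k y"] g d B(2) by (intro add_mono) auto
      also have "\<dots> = (B + 1) * norm (G k y - G k x)" by (simp add: algebra_simps)
      also have "\<dots> \<le> (B + 1) * (3 * norm (Y y - Y x))" using g B by (intro mult_left_mono) auto
      finally have a: "norm ?a \<le> (B + 1) * (3 * norm (Y y - Y x))" .
      have "f v - f w = ?a + (bary y - bary x)"
        using x y by (simp add: f G_inv)
      then have "norm (f v - f w) \<le> norm ?a + norm (bary y - bary x)"
        using norm_triangle_ineq by metis
      also have "\<dots> \<le> (B + 1) * (3 * norm (Y y - Y x)) + norm (Y y - Y x) / M'"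
        using a z by linarith
      finally show ?thesis using x y by (simp add: algebra_simps)
    qed
    show "\<exists>T B. open T \<and> w \<in> T \<and> (\<forall>v\<in>Y ` C \<inter> T. norm (f v - f w) \<le> B * norm (v - w))"
      using lip \<delta>(1) by (intro exI[of _ "ball w (\<delta> / 3)"] exI conjI ballI) auto
  qed simp
  also have "f ` (Y ` C) = (\<lambda>x. x $ k) ` C" unfolding image_image using f by (intro image_cong) auto
  finally show ?thesis .
qed

lemma borel_measurable_bary: "bary \<in> borel_measurable (borel :: ('a::euclidean_space ^ 'n) measure)"
  by (intro borel_measurable_continuous_onI continuous_intros)

text \<open>The preimage of a null set is merely Borel, whereas the estimate on pieces concerns
  compact sets. Inner regularity bridges this on countably many closed pieces: a compact part has at
  most the mass that \<open>\<mu> k\<close> gives to its projection, and this projection is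
  null.\<close>

theorem absolutely_continuous_bary:
  fixes \<mu> :: "'n \<Rightarrow> 'a::euclidean_space measure"
  assumes \<gamma>: "\<gamma> \<in> multi_plans \<mu>" and mono: "cp_monotone p lam (measure_support \<gamma>)"
    and ac: "absolutely_continuous lborel (\<mu> k)"
  shows "absolutely_continuous lborel (distr \<gamma> borel bary)"
  unfolding absolutely_continuous_def
proof
  fix N :: "'a set" assume N: "N \<in> null_sets lborel"
  interpret prob_space \<gamma> using \<gamma> by (simp add: multi_plans_def)
  have sets_\<gamma> [measurable_cong]: "sets \<gamma> = sets borel" using \<gamma> by (simp add: multi_plans_def)
  have space_\<gamma>: "space \<gamma> = UNIV" using sets_eq_imp_space_eq[OF sets_\<gamma>] by simp
  have marg: "distr \<gamma> borel (\<lambda>x. x $ k) = \<mu> k" using \<gamma> by (simp add: multi_plans_def)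
  have [measurable]: "bary \<in> borel_measurable \<gamma>" by (subst measurable_cong_sets[OF sets_\<gamma> refl]) (rule borel_measurable_bary)
  have nth [measurable]: "(\<lambda>x. x $ k) \<in> borel_measurable \<gamma>"
    by (subst measurable_cong_sets[OF sets_\<gamma> refl]) (intro borel_measurable_continuous_onI continuous_intros)
  have Nb [measurable]: "N \<in> sets borel" using N by auto
  have "negligible N" using N by (simp add: negligible_iff_null_sets null_sets_completionI)
  let ?S = "measure_support \<gamma>"
  have closed_S: "closed ?S" by (rule closed_measure_support)
  obtain D :: "'a set" where D: "countable D" "\<And>X. open X \<Longrightarrow> X \<noteq> {} \<Longrightarrow> \<exists>d\<in>D. d \<in> X"
    using countable_dense_exists by blast
  define rad where "rad m = inverse (real (Suc m))" for m
  have rad: "rad m > 0" for m by (simp add: rad_def)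
  \<comment> \<open>\<open>J\<close> collects the coordinates equal to the barycenter and
    \<open>rad m\<close> bounds the other distances from below. Barycenters within
    \<open>rad m / 4\<close> of \<open>c\<close> have mutual distance at most
    \<open>rad m / 2\<close>.\<close>
  define P where "P J m c = (\<Inter>i\<in>J. {x. x $ i = bary x}) \<inter> (\<Inter>i\<in>- J. {x. rad m \<le> norm (x $ i - bary x)})
      \<inter> {x. dist c (bary x) \<le> rad m / 4}" for J m and c :: 'a
  have closed_P: "closed (P J m c)" for J m c
    unfolding P_def
    by (intro closed_Int closed_INT ballI closed_Collect_eq closed_Collect_le continuous_intros)
  let ?B = "bary -` N"
  have B_sets [measurable]: "?B \<in> sets \<gamma>"
    using measurable_sets[of bary \<gamma> borel N] space_\<gamma> by simp
  have null_K: "emeasure \<gamma> K = 0" if K: "K \<subseteq> ?B \<inter> (?S \<inter> P J m c)" "compact K" for K J m c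
  proof -
    have "negligible ((\<lambda>x. x $ k) ` K)"
    proof (rule negligible_coordinate_of_piece[OF mono K(2) _ rad[of m], where J = J])
      show "negligible (bary ` K)" by (rule negligible_subset[OF \<open>negligible N\<close>]) (use K in auto)
      show "norm (bary y - bary x) \<le> rad m / 2" if "x \<in> K" "y \<in> K" for x y
      proof -
        have "dist c (bary x) \<le> rad m / 4" "dist c (bary y) \<le> rad m / 4"
          using that K by (auto simp: P_def)
        then have "dist (bary y) (bary x) \<le> rad m / 2"
          using dist_triangle2[of "bary y" "bary x" c] by (simp add: dist_commute)
        then show ?thesis by (simp add: dist_norm)
      qed
    qed (use K in \<open>auto simp: P_def\<close>)
    moreover have "compact ((\<lambda>x. x $ k) ` K)" using K(2)
      by (intro compact_continuous_image continuous_intros)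
    ultimately have null: "(\<lambda>x. x $ k) ` K \<in> null_sets lborel" and b: "(\<lambda>x. x $ k) ` K \<in> sets borel"
      by (auto simp: negligible_iff_null_sets null_sets_completion_iff compact_imp_closed)
    have "emeasure \<gamma> K \<le> emeasure \<gamma> ((\<lambda>x. x $ k) -` ((\<lambda>x. x $ k) ` K) \<inter> space \<gamma>)"
      using measurable_sets[OF nth b] by (intro emeasure_mono) (auto simp: space_\<gamma>)
    also have "\<dots> = emeasure (\<mu> k) ((\<lambda>x. x $ k) ` K)"
      using b nth by (subst marg[symmetric], subst emeasure_distr) auto
    also have "\<dots> = 0" using ac null by (auto simp: absolutely_continuous_def)
    finally show ?thesis by simp
  qed
  have null_piece: "?B \<inter> (?S \<inter> P J m c) \<in> null_sets \<gamma>" for J m c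
  proof (rule null_setsI)
    show sets: "?B \<inter> (?S \<inter> P J m c) \<in> sets \<gamma>"
      using closed_S closed_P by (intro sets.Int B_sets) (auto simp: sets_\<gamma>)
    have "emeasure \<gamma> (?B \<inter> (?S \<inter> P J m c)) =
        (SUP K\<in>{K. K \<subseteq> ?B \<inter> (?S \<inter> P J m c) \<and> compact K}. emeasure \<gamma> K)"
      using sets by (intro inner_regular) (auto simp: sets_\<gamma>)
    also have "\<dots> = (SUP K\<in>{K. K \<subseteq> ?B \<inter> (?S \<inter> P J m c) \<and> compact K}. 0)"
      using null_K by (intro SUP_cong) auto
    also have "\<dots> = 0" by (rule cSUP_const) (auto intro!: exI[of _ "{}"])
    finally show "emeasure \<gamma> (?B \<inter> (?S \<inter> P J m c)) = 0" .
  qed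
  have "?B \<subseteq> - ?S \<union> (\<Union>J\<in>UNIV. \<Union>m\<in>UNIV. \<Union>c\<in>D. ?B \<inter> (?S \<inter> P J m c))"
  proof
    fix x assume x: "x \<in> ?B"
    define J where "J = {i. x $ i = bary x}"
    \<comment> \<open>Finitely many positive distances admit a common lower bound
      \<open>rad m\<close>.\<close>
    have "\<exists>m. \<forall>i\<in>- J. rad m \<le> norm (x $ i - bary x)"
    proof -
      have "\<forall>\<^sub>F m in sequentially. rad m \<le> norm (x $ i - bary x)" if "i \<in> - J" for i
      proof -
        have "(rad \<longlongrightarrow> 0) sequentially" unfolding rad_def[abs_def] by (rule LIMSEQ_inverse_real_of_nat)
        moreover have "0 < norm (x $ i - bary x)" using that by (simp add: J_def)
        ultimately have "\<forall>\<^sub>F m in sequentially. rad m < norm (x $ i - bary x)" by (rule order_tendstoD(2))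
        then show ?thesis by (rule eventually_mono) simp
      qed
      then have "\<forall>\<^sub>F m in sequentially. \<forall>i\<in>- J. rad m \<le> norm (x $ i - bary x)"
        by (simp add: eventually_ball_finite)
      then show ?thesis using eventually_happens' sequentially_bot by blast
    qed
    then obtain m where m: "\<forall>i\<in>- J. rad m \<le> norm (x $ i - bary x)" ..
    obtain c where c: "c \<in> D" "c \<in> ball (bary x) (rad m / 4)"
      using D(2)[of "ball (bary x) (rad m / 4)"] rad[of m] by (auto simp: not_le)
    have "x \<in> P J m c" using m c by (auto simp: P_def J_def dist_commute)
    then show "x \<in> - ?S \<union> (\<Union>J\<in>UNIV. \<Union>m\<in>UNIV. \<Union>c\<in>D. ?B \<inter> (?S \<inter> P J m c))"
      using x c by blast
  qed
  moreover have "- ?S \<union> (\<Union>J\<in>UNIV. \<Union>m\<in>UNIV. \<Union>c\<in>D. ?B \<inter> (?S \<inter> P J m c)) \<in> null_sets \<gamma>"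
  proof (rule null_sets.Un)
    show "- ?S \<in> null_sets \<gamma>"
      using closed_S emeasure_compl_measure_support[OF sets_\<gamma>] by (auto simp: null_sets_def sets_\<gamma>)
  qed (intro null_sets_UN' null_piece D(1) countableI_type)
  ultimately have "?B \<in> null_sets \<gamma>" using B_sets null_sets_subset by blast
  then have "emeasure \<gamma> ?B = 0" by auto
  then show "N \<in> null_sets (distr \<gamma> borel bary)"
    using Nb space_\<gamma> by (auto simp: null_sets_def emeasure_distr)
qed

end

section \<open>Weak compactness\<close>

definition bin_digit :: "nat \<Rightarrow> real \<Rightarrow> real" where
  "bin_digit k x = of_int \<lfloor>2 ^ Suc k * x\<rfloor> - 2 * of_int \<lfloor>2 ^ k * x\<rfloor>"

lemma bin_digit_cases: "bin_digit k x = 0 \<or> bin_digit k x = 1"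
proof -
  define y where "y = 2 ^ k * x"
  have "\<lfloor>2 * y\<rfloor> = 2 * \<lfloor>y\<rfloor> \<or> \<lfloor>2 * y\<rfloor> = 2 * \<lfloor>y\<rfloor> + 1"
    by linarith
  then show ?thesis by (auto simp: bin_digit_def y_def mult.assoc)
qed

text \<open>The partial sums telescope to the dyadic truncations of \<open>x\<close>.\<close>

lemma bin_digit_sums:
  assumes "0 \<le> x" "x < 1"
  shows "(\<lambda>k. bin_digit k x / 2 ^ Suc k) sums x"
proof -
  have partial: "(\<Sum>k<m. bin_digit k x / 2 ^ Suc k) = of_int \<lfloor>2 ^ m * x\<rfloor> / 2 ^ m" for m
  proof (induction m)
    case 0
    have "\<lfloor>x\<rfloor> = 0" using assms by (simp add: floor_eq_iff)
    then show ?case by simp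
  next
    case (Suc m)
    then show ?case by (simp add: bin_digit_def diff_divide_distrib)
  qed
  have "(\<lambda>m. of_int \<lfloor>2 ^ m * x\<rfloor> / 2 ^ m) \<longlonglongrightarrow> x"
  proof (rule tendsto_sandwich)
    show "\<forall>\<^sub>F m in sequentially. x - (1 / 2) ^ m \<le> of_int \<lfloor>2 ^ m * x\<rfloor> / 2 ^ m"
    proof (rule always_eventually, rule allI)
      fix m
      have "2 ^ m * x - 1 \<le> of_int \<lfloor>2 ^ m * x\<rfloor>" by linarith
      then have "(2 ^ m * x - 1) / 2 ^ m \<le> of_int \<lfloor>2 ^ m * x\<rfloor> / 2 ^ m" by (intro divide_right_mono) auto
      then show "x - (1 / 2) ^ m \<le> of_int \<lfloor>2 ^ m * x\<rfloor> / 2 ^ m"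
        by (simp add: diff_divide_distrib power_one_over)
    qed
    show "\<forall>\<^sub>F m in sequentially. of_int \<lfloor>2 ^ m * x\<rfloor> / 2 ^ m \<le> x"
      by (rule always_eventually) (simp add: divide_le_eq mult.commute)
    have "(\<lambda>m. x - (1 / 2) ^ m) \<longlonglongrightarrow> x - 0" by (intro tendsto_intros) auto
    then show "(\<lambda>m. x - (1 / 2) ^ m) \<longlonglongrightarrow> x" by simp
  qed auto
  then show ?thesis unfolding sums_def partial .
qed

text \<open>The point of the Cantor set with ternary digits 0 and 2; omitting the digit 1 leaves
  gaps in which a continuous function can pass from one digit value to the other.\<close>

definition cantor_code :: "(nat \<Rightarrow> real) \<Rightarrow> real" where
  "cantor_code b = (\<Sum>m. 2 * b m / 3 ^ Suc m)"

lemma cantor_code_summable: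
  assumes "\<And>m. b m = 0 \<or> b m = (1::real)"
  shows "summable (\<lambda>m. 2 * b m / 3 ^ Suc m)"
proof (rule summable_comparison_test)
  show "\<exists>N. \<forall>m\<ge>N. norm (2 * b m / 3 ^ Suc m) \<le> (1 / 3) ^ m"
  proof (intro exI[of _ 0] allI impI)
    fix m
    show "norm (2 * b m / 3 ^ Suc m) \<le> (1 / 3) ^ m"
      using assms[of m] by (auto simp: power_one_over field_simps)
  qed
  show "summable (\<lambda>m. (1 / 3 :: real) ^ m)" by (rule summable_geometric) simp
qed

lemma cantor_code_nonneg: "(\<And>m. b m = 0 \<or> b m = (1::real)) \<Longrightarrow> 0 \<le> cantor_code b"
  unfolding cantor_code_def using zero_le_one
  by (intro suminf_nonneg cantor_code_summable) (auto simp: zero_le_divide_iff, metis order_refl zero_le_one)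

lemma cantor_code_le_1:
  assumes "\<And>m. b m = 0 \<or> b m = (1::real)"
  shows "cantor_code b \<le> 1"
proof -
  have geo: "(\<lambda>m. (2 / 3) * (1 / 3 :: real) ^ m) sums ((2 / 3) * (1 / (1 - 1 / 3)))"
    by (intro sums_mult geometric_sums) simp
  have "cantor_code b \<le> (\<Sum>m. (2 / 3) * (1 / 3 :: real) ^ m)"
    unfolding cantor_code_def
  proof (rule suminf_le)
    show "2 * b m / 3 ^ Suc m \<le> 2 / 3 * (1 / 3) ^ m" for m
      using assms[of m] by (auto simp: power_one_over field_simps)
  qed (use assms cantor_code_summable geo in \<open>auto simp: sums_iff\<close>)
  also have "\<dots> = 1" using geo by (simp add: sums_iff)
  finally show ?thesis .
qed

lemma cantor_code_shift:
  assumes "\<And>m. b m = 0 \<or> b m = (1::real)"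
  shows "3 * cantor_code b = 2 * b 0 + cantor_code (\<lambda>m. b (Suc m))"
proof -
  have s: "summable (\<lambda>m. 2 * b m / 3 ^ Suc m)" using assms by (rule cantor_code_summable)
  have "(\<Sum>m. 2 * b (Suc m) / 3 ^ Suc (Suc m)) = (\<Sum>m. (2 * b (Suc m) / 3 ^ Suc m) / 3)"
    by (simp add: field_simps)
  also have "\<dots> = cantor_code (\<lambda>m. b (Suc m)) / 3"
    unfolding cantor_code_def by (rule suminf_divide) (intro cantor_code_summable assms)
  finally show ?thesis
    using suminf_split_head[OF s] by (simp add: cantor_code_def)
qed

text \<open>Multiplication by 3 shifts the ternary digits, and since these are 0 or 2 the integer
  split off is even. This matches the period 2 of \<open>digit_reader\<close>.\<close>

lemma cantor_code_expand:
  assumes "\<And>m. b m = 0 \<or> b m = (1::real)"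
  shows "\<exists>K::int. 3 ^ m * cantor_code b = 2 * of_int K + cantor_code (\<lambda>j. b (j + m))"
  using assms
proof (induction m arbitrary: b)
  case 0
  then show ?case by (intro exI[of _ 0]) simp
next
  case (Suc m)
  obtain K :: int where K: "3 ^ m * cantor_code (\<lambda>j. b (Suc j)) = 2 * of_int K + cantor_code (\<lambda>j. b (Suc (j + m)))"
    using Suc.IH[of "\<lambda>j. b (Suc j)"] Suc.prems by auto
  obtain c :: int where c: "b 0 = of_int c" using Suc.prems[of 0] by (metis of_int_0 of_int_1)
  have "3 ^ Suc m * cantor_code b = 3 ^ m * (3 * cantor_code b)" by simp
  also have "\<dots> = 2 * of_int (3 ^ m * c + K) + cantor_code (\<lambda>j. b (Suc (j + m)))"
    unfolding cantor_code_shift[OF Suc.prems] using K c by (simp add: algebra_simps)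
  finally show ?case by (intro exI[of _ "3 ^ m * c + K"]) simp
qed

text \<open>Continuous and 2-periodic, equal to 0 on [0, 1/3] and to 1 on [2/3, 1], because cos (pi
  / 3) = 1/2.\<close>

definition digit_reader :: "real \<Rightarrow> real" where
  "digit_reader t = max 0 (min 1 (1 / 2 - cos (pi * t)))"

lemma digit_reader_cantor_code:
  assumes b: "\<And>m. b m = 0 \<or> b m = (1::real)"
  shows "digit_reader (3 ^ m * cantor_code b) = b m"
proof -
  obtain K :: int where K: "3 ^ m * cantor_code b = 2 * of_int K + cantor_code (\<lambda>j. b (j + m))"
    using cantor_code_expand[of b m, OF b] by blast
  define c where "c = cantor_code (\<lambda>j. b (j + m))"
  define d where "d = cantor_code (\<lambda>j. b (Suc j + m))"
  have c: "3 * c = 2 * b m + d"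
    using cantor_code_shift[of "\<lambda>j. b (j + m)"] b by (simp add: c_def d_def)
  have d: "0 \<le> d" "d \<le> 1"
    unfolding d_def using b by (auto intro: cantor_code_nonneg cantor_code_le_1)
  have "cos (pi * (2 * of_int K + c)) = cos (pi * c + (2 * pi) * of_int K)" by (simp add: algebra_simps)
  also have "\<dots> = cos (pi * c)"
    unfolding cos_add cos_int_2pin sin_int_2pin by simp
  finally have eq: "digit_reader (3 ^ m * cantor_code b) = digit_reader c"
    by (simp add: digit_reader_def K c_def)
  have "digit_reader c = b m"
  proof (cases "b m = 0")
    case True
    then have "0 \<le> c" "c \<le> 1 / 3" using c d by auto
    then have "cos (pi / 3) \<le> cos (pi * c)" by (intro cos_monotone_0_pi_le) auto
    then show ?thesis using True by (simp add: digit_reader_def cos_60)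
  next
    case False
    then have "b m = 1" using b by blast
    then have "2 / 3 \<le> c" "c \<le> 1" using c d by auto
    then have "cos (pi * c) \<le> cos (pi * (2 / 3))" by (intro cos_monotone_0_pi_le) auto
    also have "cos (pi * (2 / 3)) = - cos (pi / 3)"
      using cos_pi_minus[of "pi / 3"] by (simp add: field_simps)
    finally show ?thesis using \<open>b m = 1\<close> by (simp add: digit_reader_def cos_60)
  qed
  then show ?thesis using eq by simp
qed

text \<open>Schoenberg's space-filling curve: \<open>schoenberg n i\<close> reads the ternary digits in the
  positions congruent to \<open>i\<close> modulo \<open>n\<close>, so finitely many coordinates are coded continuously
  by one real parameter.\<close>

definition schoenberg :: "nat \<Rightarrow> nat \<Rightarrow> real \<Rightarrow> real" where
  "schoenberg n i t = (\<Sum>k. digit_reader (3 ^ (n * k + i) * t) / 2 ^ Suc k)"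

lemma continuous_on_schoenberg: "continuous_on UNIV (schoenberg n i)"
proof -
  have "uniform_limit UNIV (\<lambda>N t. \<Sum>k<N. digit_reader (3 ^ (n * k + i) * t) / 2 ^ Suc k)
      (schoenberg n i) sequentially"
    unfolding schoenberg_def[abs_def]
  proof (rule Weierstrass_m_test)
    show "norm (digit_reader (3 ^ (n * k + i) * t) / 2 ^ Suc k) \<le> (1 / 2) ^ k" for k t
      by (simp add: digit_reader_def power_one_over divide_simps)
    show "summable (\<lambda>k. (1 / 2 :: real) ^ k)" by (rule summable_geometric) simp
  qed
  then show ?thesis
    by (rule uniform_limit_theorem[rotated])
       (auto simp: digit_reader_def intro!: always_eventually continuous_intros)
qed

text \<open>A Borel section of the curve formed by the functions \<open>schoenberg n i\<close>,
  defined on the half-open unit cube.\<close>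

definition interleaved_code :: "nat \<Rightarrow> (nat \<Rightarrow> real) \<Rightarrow> real" where
  "interleaved_code n u = cantor_code (\<lambda>m. bin_digit (m div n) (u (m mod n)))"

lemma schoenberg_interleaved_code:
  assumes "i < n" "0 \<le> u i" "u i < 1"
  shows "schoenberg n i (interleaved_code n u) = u i"
proof -
  have "digit_reader (3 ^ (n * k + i) * interleaved_code n u) = bin_digit k (u i)" for k
    unfolding interleaved_code_def
    by (subst digit_reader_cantor_code) (use bin_digit_cases assms(1) in auto)
  then show ?thesis
    using bin_digit_sums[OF assms(2,3)] by (simp add: schoenberg_def sums_iff)
qed

lemma interleaved_code_bounds: "0 \<le> interleaved_code n u" "interleaved_code n u \<le> 1"
  unfolding interleaved_code_def
  by (intro cantor_code_nonneg cantor_code_le_1 bin_digit_cases)+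

lemma borel_measurable_interleaved_code:
  assumes "\<And>i. (\<lambda>x. u x i) \<in> borel_measurable M"
  shows "(\<lambda>x. interleaved_code n (u x)) \<in> borel_measurable M"
  unfolding interleaved_code_def cantor_code_def bin_digit_def
  using assms by (intro borel_measurable_suminf borel_measurable_times borel_measurable_divide
      borel_measurable_diff borel_measurable_const measurable_compose[OF _ borel_measurable_real_floor])

text \<open>The coordinates are squashed into (0, 1) and coded by one real, which reduces the claim
  to selection of weakly convergent subsequences on the line. \<open>code\<close> is only Borel, but
  integrals of \<open>f\<close> become integrals of \<open>f\<close> after \<open>decode\<close>,
  and \<open>decode\<close> is continuous except where a coordinate reaches 0 or 1. Tightness makes
  these exceptional points null for the limit.\<close>

theorem tight_imp_weakly_convergent_subsequence:
  fixes P :: "nat \<Rightarrow> 'e::euclidean_space measure"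
  assumes prob: "\<And>n. prob_space (P n)" and sets_P: "\<And>n. sets (P n) = sets borel"
    and tight: "\<And>\<epsilon>. \<epsilon> > 0 \<Longrightarrow> \<exists>R. \<forall>n. measure (P n) {x. R < norm x} \<le> \<epsilon>"
  obtains r Q where "strict_mono r" "prob_space Q" "sets Q = sets borel"
    "\<And>(f :: 'e \<Rightarrow> real) B. continuous_on UNIV f \<Longrightarrow> (\<And>x. \<bar>f x\<bar> \<le> B) \<Longrightarrow>
      (\<lambda>n. \<integral>x. f x \<partial>P (r n)) \<longlonglongrightarrow> (\<integral>x. f x \<partial>Q)"
proof -
  define n where "n = DIM('e)"
  obtain ix :: "'e \<Rightarrow> nat" where ix: "bij_betw ix Basis {..<n}"
    using ex_bij_betw_finite_nat[OF finite_Basis] by (auto simp: n_def atLeast0LessThan)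
  define ixi where "ixi = inv_into Basis ix"
  have ix_less: "ix b < n" if "b \<in> Basis" for b using ix that by (auto simp: bij_betw_def)
  have ixi: "ixi (ix b) = b" if "b \<in> Basis" for b
    using ix that by (simp add: ixi_def bij_betw_def)
  define squash where "squash t = 1 / 2 + arctan t / pi" for t :: real
  have squash: "0 < squash t" "squash t < 1" "tan (pi * (squash t - 1 / 2)) = t" for t
    using arctan_bounded[of t] by (auto simp: squash_def field_simps tan_arctan)
  have squash_mono: "squash s \<le> squash t" if "s \<le> t" for s t
    using that by (simp add: squash_def divide_right_mono arctan_monotone')
  have squash_minus: "squash (- t) = 1 - squash t" for t by (simp add: squash_def arctan_minus)
  define code where "code x = interleaved_code n (\<lambda>i. squash (x \<bullet> ixi i))" for x :: 'e
  define ph where "ph b = schoenberg n (ix b)" for b :: 'e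
  define decode where "decode t = (\<Sum>b\<in>Basis. tan (pi * (ph b t - 1 / 2)) *\<^sub>R b)" for t
  have ph_code: "ph b (code x) = squash (x \<bullet> b)" if "b \<in> Basis" for b x
    using schoenberg_interleaved_code[OF ix_less[OF that], of "\<lambda>i. squash (x \<bullet> ixi i)"] squash[of "x \<bullet> b"] that
    by (simp add: ph_def code_def ixi)
  have decode_code: "decode (code x) = x" for x
    by (simp add: decode_def ph_code squash euclidean_representation)
  have ph_cont: "continuous_on UNIV (ph b)" for b unfolding ph_def by (rule continuous_on_schoenberg)
  have ph_meas [measurable]: "ph b \<in> borel_measurable borel" for b
    using ph_cont by (rule borel_measurable_continuous_onI)
  have decode_meas [measurable]: "decode \<in> borel_measurable borel"
    unfolding decode_def[abs_def] tan_def by measurable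
  have squash_meas: "squash \<in> borel_measurable borel"
    unfolding squash_def[abs_def] by (intro borel_measurable_continuous_onI continuous_intros) auto
  have code_meas [measurable]: "code \<in> borel_measurable borel"
    unfolding code_def[abs_def]
    by (intro borel_measurable_interleaved_code measurable_compose[OF _ squash_meas]) measurable
  have code_meas_P [measurable]: "code \<in> borel_measurable (P k)" for k
    using code_meas by (subst measurable_cong_sets[OF sets_P refl])
  define \<mu> where "\<mu> k = distr (P k) borel code" for k
  have rd: "real_distribution (\<mu> k)" for k
  proof -
    interpret prob_space "P k" by (rule prob)
    show ?thesis unfolding \<mu>_def by (rule real_distribution_distr) simp
  qed
  have "tight \<mu>"
    unfolding tight_def
  proof (intro conjI allI impI rd)
    fix \<epsilon> :: real assume "\<epsilon> > 0"
    \<comment> \<open>Codes lie in [0, 1]; the left endpoint -1 lets the half-open interval contain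
      0.\<close>
    have "measure (\<mu> k) {-1<..1} = 1" for k
    proof -
      interpret prob_space "P k" by (rule prob)
      have "code -` {-1<..1} \<inter> space (P k) = space (P k)"
        using interleaved_code_bounds(2) less_le_trans[OF _ interleaved_code_bounds(1), of "-1"]
        by (auto simp: code_def)
      then show ?thesis unfolding \<mu>_def by (subst measure_distr) (auto simp: prob_space)
    qed
    then have "\<forall>k. 1 - \<epsilon> < measure (\<mu> k) {-1<..1}" using \<open>\<epsilon> > 0\<close> by simp
    moreover have "(-1 :: real) < 1" by simp
    ultimately show "\<exists>a b. a < b \<and> (\<forall>k. 1 - \<epsilon> < measure (\<mu> k) {a<..b})" by blast
  qed
  then obtain r m where r: "strict_mono r" and m: "real_distribution m" "weak_conv_m (\<mu> \<circ> id \<circ> r) m"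
    using tight_imp_convergent_subsubsequence[of \<mu> id] by (auto simp: strict_mono_def)
  interpret m: real_distribution m by (rule m(1))
  have conv: "(\<lambda>k. integral\<^sup>L (\<mu> (r k)) f) \<longlonglongrightarrow> integral\<^sup>L m f"
    if "emeasure m {t. \<not> isCont f t} = 0" "\<And>t. norm (f t) \<le> B" "f \<in> borel_measurable borel"
    for f :: "real \<Rightarrow> real" and B
    using weak_conv_imp_bdd_ae_continuous_conv[OF _ m(1) _ that, of "\<mu> \<circ> id \<circ> r"] m(2) rd by simp
  define bad where "bad = {t. \<exists>b\<in>Basis. ph b t \<le> 0 \<or> 1 \<le> ph b t}"
  \<comment> \<open>A continuous upper bound for the indicator of \<open>bad\<close>, so that weak
    convergence applies to it; for large \<open>K\<close> it vanishes on the codes of a fixed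
    ball.\<close>
  define q where "q K t = min 1 (\<Sum>b\<in>Basis. max 0 (1 - real K * ph b t) + max 0 (1 - real K * (1 - ph b t)))" for K t
  have q_cont: "continuous_on UNIV (q K)" for K
    unfolding q_def[abs_def] using ph_cont by (intro continuous_intros) auto
  have q_bound: "0 \<le> q K t" "q K t \<le> 1" for K t
    by (auto simp: q_def intro!: sum_nonneg)
  have bad_meas [measurable]: "bad \<in> sets borel"
    unfolding bad_def by measurable
  have q_bad: "indicator bad t \<le> q K t" for K t
  proof (cases "t \<in> bad")
    case True
    then obtain b where b: "b \<in> Basis" "ph b t \<le> 0 \<or> 1 \<le> ph b t" by (auto simp: bad_def)
    have "1 \<le> max 0 (1 - real K * ph b t) + max 0 (1 - real K * (1 - ph b t))"
      using b(2)
    proof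
      assume "ph b t \<le> 0"
      then have "real K * ph b t \<le> 0" by (simp add: mult_nonneg_nonpos)
      then show ?thesis by linarith
    next
      assume "1 \<le> ph b t"
      then have "real K * (1 - ph b t) \<le> 0" by (simp add: mult_nonneg_nonpos)
      then show ?thesis by linarith
    qed
    also have "\<dots> \<le> (\<Sum>b\<in>Basis. max 0 (1 - real K * ph b t) + max 0 (1 - real K * (1 - ph b t)))"
      using b(1) by (intro member_le_sum) auto
    finally show ?thesis using True by (simp add: q_def)
  qed (simp add: q_bound)
  have "measure m bad \<le> 0 + \<epsilon>" if "\<epsilon> > 0" for \<epsilon>
  proof -
    obtain R where R: "\<And>k. measure (P k) {x. R < norm x} \<le> \<epsilon>" using tight[OF \<open>\<epsilon> > 0\<close>] by blast
    \<comment> \<open>On the ball of radius \<open>R\<close> every squashed coordinate lies in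
      [h, 1 - h].\<close>
    define h where "h = squash (- \<bar>R\<bar>)"
    have "h > 0" by (simp add: h_def squash)
    obtain K :: nat where K: "1 / h \<le> real K" using real_arch_simple by blast
    then have K1: "1 \<le> real K * h" using \<open>h > 0\<close> by (simp add: field_simps)
    have q_code: "q K (code x) = 0" if "norm x \<le> R" for x
    proof -
      have z: "max 0 (1 - real K * ph b (code x)) + max 0 (1 - real K * (1 - ph b (code x))) = 0"
        if "b \<in> Basis" for b
      proof -
        have "\<bar>x \<bullet> b\<bar> \<le> \<bar>R\<bar>" using Basis_le_norm[OF that, of x] \<open>norm x \<le> R\<close> by linarith
        then have "h \<le> squash (x \<bullet> b)" "squash (x \<bullet> b) \<le> 1 - h"
          using squash_mono[of "- \<bar>R\<bar>" "x \<bullet> b"] squash_mono[of "x \<bullet> b" "\<bar>R\<bar>"]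
          by (auto simp: h_def squash_minus)
        then have "real K * h \<le> real K * ph b (code x)" "real K * h \<le> real K * (1 - ph b (code x))"
          using ph_code[OF that, of x] by (auto intro!: mult_left_mono)
        then show ?thesis using K1 by simp
      qed
      then show ?thesis by (simp add: q_def)
    qed
    have "(\<lambda>k. integral\<^sup>L (\<mu> (r k)) (q K)) \<longlonglongrightarrow> integral\<^sup>L m (q K)"
    proof (rule conv)
      show "norm (q K t) \<le> 1" for t using q_bound[of K t] by simp
      show "emeasure m {t. \<not> isCont (q K) t} = 0"
        using q_cont by (simp add: continuous_on_eq_continuous_at)
      show "q K \<in> borel_measurable borel" using q_cont by (rule borel_measurable_continuous_onI)
    qed
    moreover have "integral\<^sup>L (\<mu> k) (q K) \<le> \<epsilon>" for k
    proof -
      interpret prob_space "P k" by (rule prob)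
      have qm [measurable]: "q K \<in> borel_measurable borel" using q_cont by (rule borel_measurable_continuous_onI)
      have tail [measurable]: "{x. R < norm x} \<in> sets (P k)" by (simp add: sets_P)
      have "integral\<^sup>L (\<mu> k) (q K) = (\<integral>x. q K (code x) \<partial>P k)"
        unfolding \<mu>_def by (rule integral_distr) auto
      also have "\<dots> \<le> (\<integral>x. indicator {x. R < norm x} x \<partial>P k)"
      proof (rule integral_mono)
        show "integrable (P k) (\<lambda>x. q K (code x))"
          by (rule integrable_const_bound[where B = 1]) (use q_bound in auto)
        show "integrable (P k) (indicator {x. R < norm x} :: 'e \<Rightarrow> real)"
          by (rule integrable_const_bound[where B = 1]) auto
        show "q K (code x) \<le> indicator {x. R < norm x} x" for x
          using q_code[of x] q_bound by (auto simp: indicator_def)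
      qed
      also have "\<dots> = measure (P k) {x. R < norm x}" using tail sets.sets_into_space by simp
      finally show ?thesis using R[of k] by simp
    qed
    ultimately have "integral\<^sup>L m (q K) \<le> \<epsilon>" by (auto intro: LIMSEQ_le_const2)
    moreover have "measure m bad \<le> integral\<^sup>L m (q K)"
    proof -
      have "(\<integral>t. indicator bad t \<partial>m) \<le> integral\<^sup>L m (q K)"
      proof (rule integral_mono)
        show "integrable m (q K)"
          using q_bound borel_measurable_continuous_onI[OF q_cont]
          by (intro m.integrable_const_bound[where B = 1]) auto
        show "integrable m (indicator bad :: real \<Rightarrow> real)"
          by (rule m.integrable_const_bound[where B = 1]) auto
      qed (rule q_bad)
      then show ?thesis by simp
    qed
    ultimately show ?thesis by simp
  qed
  then have "measure m bad \<le> 0" by (rule field_le_epsilon)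
  then have "emeasure m bad = 0" by (simp add: m.emeasure_eq_measure measure_le_0_iff)
  have decode_cont: "isCont decode t" if "t \<notin> bad" for t
  proof -
    have "isCont (\<lambda>t. tan (pi * (ph b t - 1 / 2))) t" if "b \<in> Basis" for b
    proof -
      have "0 < ph b t" "ph b t < 1" using that \<open>t \<notin> bad\<close> by (auto simp: bad_def not_le)
      then have "- (pi / 2) < pi * (ph b t - 1 / 2)" "pi * (ph b t - 1 / 2) < pi / 2"
        by (auto simp: field_simps)
      then have "cos (pi * (ph b t - 1 / 2)) \<noteq> 0" using cos_gt_zero_pi by fastforce
      moreover have "isCont (ph b) t" using ph_cont by (simp add: continuous_on_eq_continuous_at)
      ultimately show ?thesis by (intro continuous_intros) auto
    qed
    then show ?thesis unfolding decode_def[abs_def]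
      by (intro continuous_sum continuous_scaleR continuous_const)
  qed
  define Q where "Q = distr m borel decode"
  show thesis
  proof (rule that[OF r, of Q])
    show "prob_space Q" unfolding Q_def by (rule m.prob_space_distr) simp
    show "sets Q = sets borel" by (simp add: Q_def)
    fix f :: "'e \<Rightarrow> real" and B
    assume f: "continuous_on UNIV f" "\<And>x. \<bar>f x\<bar> \<le> B"
    have fm [measurable]: "f \<in> borel_measurable borel" using f(1) by (rule borel_measurable_continuous_onI)
    have "isCont (\<lambda>t. f (decode t)) t" if "t \<notin> bad" for t
      using f(1) by (intro isCont_o2[OF decode_cont[OF that]]) (simp add: continuous_on_eq_continuous_at)
    then have "{t. \<not> isCont (\<lambda>t. f (decode t)) t} \<subseteq> bad" by blast
    then have "emeasure m {t. \<not> isCont (\<lambda>t. f (decode t)) t} \<le> emeasure m bad"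
      by (intro emeasure_mono) simp_all
    then have "emeasure m {t. \<not> isCont (\<lambda>t. f (decode t)) t} = 0" using \<open>emeasure m bad = 0\<close> by simp
    then have "(\<lambda>k. \<integral>t. f (decode t) \<partial>\<mu> (r k)) \<longlonglongrightarrow> (\<integral>t. f (decode t) \<partial>m)"
      by (rule conv) (use f(2) in auto)
    moreover have "(\<integral>t. f (decode t) \<partial>\<mu> k) = (\<integral>x. f x \<partial>P k)" for k
      unfolding \<mu>_def by (subst integral_distr) (auto simp: decode_code)
    moreover have "(\<integral>t. f (decode t) \<partial>m) = (\<integral>x. f x \<partial>Q)"
      unfolding Q_def by (subst integral_distr) auto
    ultimately show "(\<lambda>k. \<integral>x. f x \<partial>P (r k)) \<longlonglongrightarrow> (\<integral>x. f x \<partial>Q)" by simp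
  qed
qed

section \<open>Gluing along a common marginal\<close>

lemma borel_measurable_continuousI:
  "continuous_on UNIV f \<Longrightarrow> sets M = sets borel \<Longrightarrow> f \<in> borel_measurable M"
  using borel_measurable_continuous_onI by (subst measurable_cong_sets[OF _ refl])

text \<open>Closed sets form an intersection-stable generator, and the indicator of a closed set is
  a pointwise limit of continuous functions of the distance to it.\<close>

lemma borel_measure_eqI_continuous:
  fixes M N :: "'a::metric_space measure"
  assumes M: "prob_space M" "sets M = sets borel" and N: "prob_space N" "sets N = sets borel"
    and eq: "\<And>(f :: 'a \<Rightarrow> real) B. continuous_on UNIV f \<Longrightarrow> (\<And>x. \<bar>f x\<bar> \<le> B) \<Longrightarrow>
        (\<integral>x. f x \<partial>M) = (\<integral>x. f x \<partial>N)"
  shows "M = N"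
proof -
  have closed_limit: "(\<lambda>k. \<integral>x. max 0 (1 - real k * infdist x C) \<partial>L) \<longlonglongrightarrow> measure L C"
    if C: "closed C" "C \<noteq> {}" and L: "prob_space L" "sets L = sets borel" for C :: "'a set" and L
  proof -
    interpret L: prob_space L by (rule L(1))
    have [measurable]: "C \<in> sets L" using C(1) by (simp add: L(2))
    have meas: "(\<lambda>x. max 0 (1 - real k * infdist x C)) \<in> borel_measurable L" for k
      by (subst measurable_cong_sets[OF L(2) refl])
         (intro borel_measurable_continuous_onI continuous_intros)
    have "(\<lambda>k. \<integral>x. max 0 (1 - real k * infdist x C) \<partial>L) \<longlonglongrightarrow> (\<integral>x. indicator C x \<partial>L)"
    proof (rule integral_dominated_convergence[where w = "\<lambda>_. 1"])
      show "AE x in L. (\<lambda>k. max 0 (1 - real k * infdist x C)) \<longlonglongrightarrow> indicator C x"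
      proof (rule AE_I2)
        fix x
        show "(\<lambda>k. max 0 (1 - real k * infdist x C)) \<longlonglongrightarrow> indicator C x"
        proof (cases "x \<in> C")
          case False
          then have pos: "infdist x C > 0" using C infdist_pos_not_in_closed by blast
          obtain K :: nat where K: "1 / infdist x C \<le> real K" using real_arch_simple by blast
          have "max 0 (1 - real k * infdist x C) = 0" if "k \<ge> K" for k
          proof -
            have "1 / infdist x C \<le> real k" using K that by linarith
            then show ?thesis using pos by (simp add: divide_le_eq)
          qed
          then show ?thesis using False
            by (intro tendsto_eventually) (auto simp: eventually_sequentially)
        qed simp
      qed
      show "AE x in L. norm (max 0 (1 - real k * infdist x C)) \<le> 1" for k
        by (rule AE_I2) (simp add: infdist_nonneg)
    qed (use meas in auto)
    then show ?thesis using L.emeasure_finite by (simp add: L(2) sets_eq_imp_space_eq[OF L(2)])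
  qed
  interpret M: prob_space M by (rule M(1))
  interpret N: prob_space N by (rule N(1))
  have "emeasure M C = emeasure N C" if C: "closed C" for C
  proof (cases "C = {}")
    case False
    have "(\<integral>x. max 0 (1 - real k * infdist x C) \<partial>M) = (\<integral>x. max 0 (1 - real k * infdist x C) \<partial>N)" for k
      by (rule eq[where B = 1]) (auto intro!: continuous_intros simp: infdist_nonneg)
    then have "measure M C = measure N C"
      using closed_limit[OF C False M] closed_limit[OF C False N] LIMSEQ_unique by simp
    then show ?thesis by (simp add: M.emeasure_eq_measure N.emeasure_eq_measure)
  qed simp
  then show ?thesis
    using M N M.emeasure_finite
    by (intro measure_eqI_generator_eq[where E = "Collect closed" and \<Omega> = UNIV and A = "\<lambda>_. UNIV"])
       (auto simp: Int_stable_def borel_eq_closed sigma_sets_def)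
qed

lemma (in prob_space) tail_small:
  fixes f :: "'a \<Rightarrow> 'b::euclidean_space"
  assumes [measurable]: "f \<in> borel_measurable M" and "\<epsilon> > 0"
  shows "\<exists>R\<ge>0. prob {x \<in> space M. R < norm (f x)} \<le> \<epsilon>"
proof -
  have "(\<lambda>k. prob {x \<in> space M. real k < norm (f x)}) \<longlonglongrightarrow> prob (\<Inter>k. {x \<in> space M. real k < norm (f x)})"
    by (rule finite_Lim_measure_decseq) (auto simp: decseq_def)
  moreover have "(\<Inter>k. {x \<in> space M. real k < norm (f x)}) = {}"
  proof -
    have "\<exists>k. \<not> real k < norm (f x)" for x
      using reals_Archimedean2[of "norm (f x)"] by (meson less_asym)
    then show ?thesis by blast
  qed
  ultimately have "(\<lambda>k. prob {x \<in> space M. real k < norm (f x)}) \<longlonglongrightarrow> 0" by simp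
  then have "\<forall>\<^sub>F k in sequentially. prob {x \<in> space M. real k < norm (f x)} < \<epsilon>"
    using \<open>\<epsilon> > 0\<close> by (rule order_tendstoD(2))
  then obtain k where "prob {x \<in> space M. real k < norm (f x)} < \<epsilon>"
    using eventually_happens' sequentially_bot by blast
  then show ?thesis by (intro exI[of _ "real k"]) auto
qed

text \<open>Each point is labelled by the first member of a dense sequence within \<epsilon> / 2;
  taking the least index makes the label measurable.\<close>

lemma ex_countable_small_partition:
  fixes \<epsilon> :: real
  assumes "\<epsilon> > 0"
  obtains c :: "'a::euclidean_space \<Rightarrow> nat"
  where "c \<in> measurable borel (count_space UNIV)" "\<And>x y. c x = c y \<Longrightarrow> dist x y \<le> \<epsilon>"
proof -
  obtain D :: "'a set" where D: "countable D" "\<And>X. open X \<Longrightarrow> X \<noteq> {} \<Longrightarrow> \<exists>d\<in>D. d \<in> X"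
    using countable_dense_exists by blast
  have "D \<noteq> {}" using D(2)[of UNIV] by auto
  define d where "d = from_nat_into D"
  have ex: "\<exists>n. dist x (d n) < \<epsilon> / 2" for x
  proof -
    obtain y where "y \<in> D" "y \<in> ball x (\<epsilon> / 2)" using D(2)[of "ball x (\<epsilon> / 2)"] assms by auto
    moreover then obtain n where "d n = y" using from_nat_into_surj[OF D(1)] by (auto simp: d_def)
    ultimately show ?thesis by auto
  qed
  define c where "c x = (LEAST n. dist x (d n) < \<epsilon> / 2)" for x
  have c: "dist x (d (c x)) < \<epsilon> / 2" for x unfolding c_def using ex by (rule LeastI_ex)
  show thesis
  proof
    show "c \<in> measurable borel (count_space UNIV)"
      unfolding c_def[abs_def] by measurable
    show "dist x y \<le> \<epsilon>" if "c x = c y" for x y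
      using c[of x] c[of y] that dist_triangle2[of x y "d (c x)"] by (auto simp: dist_commute)
  qed
qed

lemma borel_measurable_vec_lambda:
  fixes \<pi> :: "'n::finite \<Rightarrow> 'b::euclidean_space measure"
  assumes "\<And>i. sets (\<pi> i) = sets borel"
  shows "vec_lambda \<in> borel_measurable (Pi\<^sub>M UNIV \<pi>)"
proof (subst borel_measurable_euclidean_space, rule ballI)
  fix b :: "'b ^ 'n" assume "b \<in> Basis"
  then obtain i u where b: "b = axis i u" "u \<in> Basis" by (auto simp: Basis_vec_def)
  have "(\<lambda>w. w i) \<in> measurable (Pi\<^sub>M UNIV \<pi>) (\<pi> i)" by (rule measurable_component_singleton) simp
  then have "(\<lambda>w. w i) \<in> borel_measurable (Pi\<^sub>M UNIV \<pi>)"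
    using measurable_cong_sets[OF refl assms] by blast
  then show "(\<lambda>w. vec_lambda w \<bullet> b) \<in> borel_measurable (Pi\<^sub>M UNIV \<pi>)"
    by (simp add: b inner_axis)
qed

text \<open>Inside each cell of a countable partition the plans are combined independently. This
  keeps every plan as an exact marginal and avoids disintegration.\<close>

lemma approximate_gluing:
  fixes \<pi> :: "'n::finite \<Rightarrow> ('a::euclidean_space \<times> 'a) measure" and \<nu> :: "'a measure"
  assumes prob: "\<And>i. prob_space (\<pi> i)" and sets_\<pi>: "\<And>i. sets (\<pi> i) = sets borel"
    and snd_\<pi>: "\<And>i. distr (\<pi> i) borel snd = \<nu>" and "\<epsilon> > 0"
  obtains P :: "(('a \<times> 'a) ^ 'n) measure" where "prob_space P" "sets P = sets borel"
    "\<And>i. distr P borel (\<lambda>w. w $ i) = \<pi> i"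
    "AE w in P. \<forall>i j. dist (snd (w $ i)) (snd (w $ j)) \<le> \<epsilon>"
proof -
  obtain c :: "'a \<Rightarrow> nat" where c [measurable]: "c \<in> measurable borel (count_space UNIV)"
    and c_dist: "\<And>x y. c x = c y \<Longrightarrow> dist x y \<le> \<epsilon>"
    using ex_countable_small_partition[OF \<open>\<epsilon> > 0\<close>] by blast
  interpret product_prob_space \<pi> UNIV by (simp add: product_prob_spaceI prob)
  define E where "E k = {q :: 'a \<times> 'a. c (snd q) = k}" for k
  have E_borel [measurable]: "E k \<in> sets borel" for k
  proof -
    have "(\<lambda>q :: 'a \<times> 'a. c (snd q)) \<in> measurable borel (count_space UNIV)"
      using measurable_compose[OF borel_measurable_continuous_onI[OF continuous_on_snd[OF continuous_on_id]] c] by simp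
    from measurable_sets[OF this, of "{k}"] show ?thesis by (simp add: E_def vimage_def)
  qed
  have E_\<pi> [measurable]: "E k \<in> sets (\<pi> i)" for k i by (simp add: sets_\<pi>)
  \<comment> \<open>The mass of cell \<open>k\<close> is the same for all plans because they share
    the marginal \<open>\<nu>\<close>.\<close>
  define N where "N k = emeasure \<nu> {x. c x = k}" for k
  have N: "emeasure (\<pi> i) (E k) = N k" for i k
  proof -
    have "{x. c x = k} \<in> sets borel" using measurable_sets[OF c, of "{k}"] by (simp add: vimage_def)
    then have "emeasure (distr (\<pi> i) borel snd) {x. c x = k} = emeasure (\<pi> i) (snd -` {x. c x = k} \<inter> space (\<pi> i))"
      by (intro emeasure_distr) (simp_all add: measurable_cong_sets[OF sets_\<pi> refl] borel_measurable_continuous_onI continuous_on_snd)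
    also have "snd -` {x. c x = k} \<inter> space (\<pi> i) = E k"
      using sets_eq_imp_space_eq[OF sets_\<pi>[of i]] by (auto simp: E_def)
    finally show ?thesis by (simp add: snd_\<pi> N_def)
  qed
  have N_le: "N k \<le> 1" for k
    using N[of undefined k] prob_space.emeasure_le_1[OF prob] by metis
  \<comment> \<open>Inside cell \<open>k\<close> the product of the restricted plans gives marginal
    \<open>i\<close> an extra factor \<open>N k\<close> for each of the other
    \<open>CARD('n) - 1\<close> indices; the weight removes it. For a null cell the weight may be
    infinite, but then it multiplies 0.\<close>
  define wt where "wt k = inverse (N k) ^ (CARD('n) - 1)" for k
  define h where "h w = (\<Sum>k. wt k * (\<Prod>j\<in>UNIV. indicator (E k) (w j)))" for w :: "'n \<Rightarrow> 'a \<times> 'a"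
  have comp [measurable]: "(\<lambda>w. w i) \<in> measurable (Pi\<^sub>M UNIV \<pi>) (\<pi> i)" for i
    by (rule measurable_component_singleton) simp
  have ind [measurable]: "(\<lambda>w. indicator (E k) (w j) :: ennreal) \<in> borel_measurable (Pi\<^sub>M UNIV \<pi>)" for j k
    using measurable_compose[OF comp[of j] borel_measurable_indicator[OF E_\<pi>]] .
  have h_meas [measurable]: "h \<in> borel_measurable (Pi\<^sub>M UNIV \<pi>)"
    unfolding h_def[abs_def] by measurable
  have weight: "wt k * (N k ^ (CARD('n) - 1) * I) = I" if "I \<le> N k" for k and I :: ennreal
  proof (cases "N k = 0")
    case True
    then have "I = 0" using that by simp
    then show ?thesis by simp
  next
    case False
    have "N k \<noteq> top" using N_le[of k] by (auto simp: top_unique)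
    then have "inverse (N k) * N k = 1"
      using False by (metis ennreal_divide_self divide_ennreal_def mult.commute zero_less_iff_neq_zero less_top)
    then have "wt k * N k ^ (CARD('n) - 1) = 1" by (simp add: wt_def flip: power_mult_distrib)
    then show ?thesis by (simp add: mult.assoc[symmetric])
  qed
  have marginal: "(\<integral>\<^sup>+ w. h w * indicator A (w i) \<partial>Pi\<^sub>M UNIV \<pi>) = emeasure (\<pi> i) A"
    if A: "A \<in> sets borel" for A i
  proof -
    have A_\<pi>: "A \<in> sets (\<pi> i)" using A by (simp add: sets_\<pi>)
    have ind_A: "(\<lambda>w. indicator A (w i) :: ennreal) \<in> borel_measurable (Pi\<^sub>M UNIV \<pi>)"
      using measurable_compose[OF comp[of i] borel_measurable_indicator[OF A_\<pi>]] .
    have "(\<integral>\<^sup>+ w. h w * indicator A (w i) \<partial>Pi\<^sub>M UNIV \<pi>) =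
        (\<integral>\<^sup>+ w. (\<Sum>k. wt k * ((\<Prod>j\<in>UNIV. indicator (E k) (w j)) * indicator A (w i))) \<partial>Pi\<^sub>M UNIV \<pi>)"
      by (simp add: h_def ennreal_suminf_multc[symmetric] mult.assoc)
    also have "\<dots> = (\<Sum>k. \<integral>\<^sup>+ w. wt k * ((\<Prod>j\<in>UNIV. indicator (E k) (w j)) * indicator A (w i)) \<partial>Pi\<^sub>M UNIV \<pi>)"
      by (intro nn_integral_suminf borel_measurable_times_ennreal borel_measurable_const
          borel_measurable_prod_ennreal ind ind_A)
    also have "\<dots> = (\<Sum>k. emeasure (\<pi> i) (E k \<inter> A))"
    proof (rule suminf_cong)
      fix k
      \<comment> \<open>Absorbing \<open>A\<close> into factor \<open>i\<close> turns the integrand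
        into a product over the indices.\<close>
      define f where "f j = (if j = i then indicator (E k \<inter> A) else indicator (E k) :: 'a \<times> 'a \<Rightarrow> ennreal)" for j
      have f: "f j \<in> borel_measurable (\<pi> j)" for j using A_\<pi> by (auto simp: f_def)
      have "(\<Prod>j\<in>UNIV. indicator (E k) (w j)) * indicator A (w i) = (\<Prod>j\<in>UNIV. f j (w j))" for w
        by (simp add: prod.remove[of UNIV i] f_def indicator_inter_arith ac_simps)
      then have "(\<integral>\<^sup>+ w. wt k * ((\<Prod>j\<in>UNIV. indicator (E k) (w j)) * indicator A (w i)) \<partial>Pi\<^sub>M UNIV \<pi>) =
          wt k * (\<integral>\<^sup>+ w. (\<Prod>j\<in>UNIV. f j (w j)) \<partial>Pi\<^sub>M UNIV \<pi>)"
        by (simp, intro nn_integral_cmult borel_measurable_prod_ennreal measurable_compose[OF comp f])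
      also have "(\<integral>\<^sup>+ w. (\<Prod>j\<in>UNIV. f j (w j)) \<partial>Pi\<^sub>M UNIV \<pi>) = (\<Prod>j\<in>UNIV. integral\<^sup>N (\<pi> j) (f j))"
        using f by (intro product_nn_integral_prod) auto
      also have "\<dots> = emeasure (\<pi> i) (E k \<inter> A) * (\<Prod>j\<in>UNIV - {i}. N k)"
        using A_\<pi> by (simp add: prod.remove[of UNIV i] f_def N)
      also have "(\<Prod>j\<in>UNIV - {i}. N k) = N k ^ (CARD('n) - 1)" by (simp add: card_Diff_singleton)
      also have "wt k * (emeasure (\<pi> i) (E k \<inter> A) * N k ^ (CARD('n) - 1)) = emeasure (\<pi> i) (E k \<inter> A)"
      proof -
        have "emeasure (\<pi> i) (E k \<inter> A) \<le> N k" unfolding N[of i, symmetric] by (intro emeasure_mono) auto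
        then show ?thesis using weight by (simp add: mult.commute)
      qed
      finally show "(\<integral>\<^sup>+ w. wt k * ((\<Prod>j\<in>UNIV. indicator (E k) (w j)) * indicator A (w i)) \<partial>Pi\<^sub>M UNIV \<pi>) =
          emeasure (\<pi> i) (E k \<inter> A)" .
    qed
    also have "\<dots> = emeasure (\<pi> i) (\<Union>k. E k \<inter> A)"
    proof (rule suminf_emeasure)
      show "range (\<lambda>k. E k \<inter> A) \<subseteq> sets (\<pi> i)" using A_\<pi> by auto
      show "disjoint_family (\<lambda>k. E k \<inter> A)" by (auto simp: disjoint_family_on_def E_def)
    qed
    also have "(\<Union>k. E k \<inter> A) = A" by (auto simp: E_def)
    finally show ?thesis .
  qed
  define M where "M = density (Pi\<^sub>M UNIV \<pi>) h"
  have vl_PiM: "vec_lambda \<in> borel_measurable (Pi\<^sub>M UNIV \<pi>)"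
    by (rule borel_measurable_vec_lambda[OF sets_\<pi>])
  have sets_M: "sets M = sets (Pi\<^sub>M UNIV \<pi>)" by (simp add: M_def)
  have vl [measurable]: "vec_lambda \<in> borel_measurable M"
    using vl_PiM by (simp add: measurable_cong_sets[OF sets_M refl])
  define P where "P = distr M borel vec_lambda"
  have nth [measurable]: "(\<lambda>w. w $ i) \<in> borel_measurable (borel :: (('a \<times> 'a) ^ 'n) measure)" for i
    by (intro borel_measurable_continuous_onI continuous_intros)
  have P_marginal: "distr P borel (\<lambda>w. w $ i) = \<pi> i" for i
  proof (rule measure_eqI)
    fix A assume "A \<in> sets (distr P borel (\<lambda>w. w $ i))"
    then have A: "A \<in> sets borel" by simp
    have meas_i: "(\<lambda>w. w i) \<in> borel_measurable (Pi\<^sub>M UNIV \<pi>)"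
      using comp[of i] measurable_cong_sets[OF refl sets_\<pi>] by blast
    have "emeasure (distr P borel (\<lambda>w. w $ i)) A = emeasure (distr M borel (\<lambda>w. w i)) A"
      unfolding P_def by (subst distr_distr) (auto simp: comp_def)
    also have "\<dots> = emeasure M ((\<lambda>w. w i) -` A \<inter> space M)"
      using A meas_i by (intro emeasure_distr) (auto simp: measurable_cong_sets[OF sets_M refl])
    also have "\<dots> = (\<integral>\<^sup>+ w. h w * indicator ((\<lambda>w. w i) -` A \<inter> space (Pi\<^sub>M UNIV \<pi>)) w \<partial>Pi\<^sub>M UNIV \<pi>)"
      unfolding M_def using measurable_sets[OF meas_i A] h_meas by (simp add: emeasure_density)
    also have "\<dots> = (\<integral>\<^sup>+ w. h w * indicator A (w i) \<partial>Pi\<^sub>M UNIV \<pi>)"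
      by (intro nn_integral_cong) (auto simp: indicator_def)
    also have "\<dots> = emeasure (\<pi> i) A" by (rule marginal[OF A])
    finally show "emeasure (distr P borel (\<lambda>w. w $ i)) A = emeasure (\<pi> i) A" .
  qed (simp add: sets_\<pi>)
  have "prob_space P"
  proof
    have nth_P: "(\<lambda>w. w $ i) \<in> borel_measurable P" for i unfolding P_def by simp
    have "emeasure (distr P borel (\<lambda>w. w $ undefined)) UNIV = emeasure P (space P)"
      using nth_P by (subst emeasure_distr) auto
    then show "emeasure P (space P) = 1"
      using prob_space.emeasure_space_1[OF prob[of undefined]] sets_eq_imp_space_eq[OF sets_\<pi>[of undefined]]
      by (simp add: P_marginal)
  qed
  moreover have "AE w in P. \<forall>i j. dist (snd (w $ i)) (snd (w $ j)) \<le> \<epsilon>"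
  proof -
    have closed: "{w :: ('a \<times> 'a) ^ 'n. \<forall>i j. dist (snd (w $ i)) (snd (w $ j)) \<le> \<epsilon>} \<in> sets borel"
    proof -
      have "closed (\<Inter>i. \<Inter>j. {w :: ('a \<times> 'a) ^ 'n. dist (snd (w $ i)) (snd (w $ j)) \<le> \<epsilon>})"
        by (intro closed_INT ballI closed_Collect_le continuous_intros)
      moreover have "(\<Inter>i. \<Inter>j. {w :: ('a \<times> 'a) ^ 'n. dist (snd (w $ i)) (snd (w $ j)) \<le> \<epsilon>}) =
          {w. \<forall>i j. dist (snd (w $ i)) (snd (w $ j)) \<le> \<epsilon>}" by auto
      ultimately show ?thesis by simp
    qed
    \<comment> \<open>Where the density is positive, a single cell contains the second components of
      all coordinates.\<close>
    have "dist (snd (w i)) (snd (w j)) \<le> \<epsilon>" if "h w > 0" for w i j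
    proof -
      have "\<exists>k. wt k * (\<Prod>j\<in>UNIV. indicator (E k) (w j)) \<noteq> 0"
      proof (rule ccontr)
        assume "\<not> ?thesis"
        then have "wt k * (\<Prod>j\<in>UNIV. indicator (E k) (w j)) = 0" for k by blast
        then have "h w = 0" unfolding h_def by (simp only: suminf_zero)
        then show False using that by simp
      qed
      then obtain k where "(\<Prod>j\<in>UNIV. indicator (E k) (w j)) \<noteq> (0 :: ennreal)" by auto
      then have "w l \<in> E k" for l
        by (metis (mono_tags, lifting) UNIV_I finite indicator_simps(2) prod_zero)
      then show ?thesis by (intro c_dist) (simp add: E_def)
    qed
    then have "AE w in M. \<forall>i j. dist (snd (w i)) (snd (w j)) \<le> \<epsilon>"
      unfolding M_def by (subst AE_density) auto
    then show ?thesis unfolding P_def using closed by (subst AE_distr_iff) auto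
  qed
  ultimately show thesis using that[of P] P_marginal by (simp add: P_def)
qed

text \<open>The approximate gluings are tight because all their marginals are fixed. In a weak limit
  the marginals persist, the errors 1 / (k + 1) disappear, so that the second components coincide,
  and the cost can only drop.\<close>

lemma gluing_limit:
  fixes \<pi> :: "nat \<Rightarrow> 'n::finite \<Rightarrow> ('a::euclidean_space \<times> 'a) measure"
    and \<mu> :: "'n \<Rightarrow> 'a measure" and \<nu> :: "'a measure" and c :: "'n \<Rightarrow> 'a \<times> 'a \<Rightarrow> real"
  assumes prob_\<pi>: "\<And>k i. prob_space (\<pi> k i)" and sets_\<pi>: "\<And>k i. sets (\<pi> k i) = sets borel"
    and fst_\<pi>: "\<And>k i. distr (\<pi> k i) borel fst = \<mu> i"
    and snd_\<pi>: "\<And>k i. distr (\<pi> k i) borel snd = \<nu>"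
    and c_cont: "\<And>i. continuous_on UNIV (c i)" and c_nonneg: "\<And>i q. 0 \<le> c i q"
    and cost: "\<And>k. (\<Sum>i\<in>UNIV. \<integral>\<^sup>+ q. ennreal (c i q) \<partial>\<pi> k i) \<le> ennreal (C + 1 / real (Suc k))"
    and "C \<ge> 0"
  obtains Q :: "(('a \<times> 'a) ^ 'n) measure" where "prob_space Q" "sets Q = sets borel"
    "\<And>i. distr Q borel (\<lambda>w. fst (w $ i)) = \<mu> i" "\<And>i. distr Q borel (\<lambda>w. snd (w $ i)) = \<nu>"
    "\<And>i j. AE w in Q. snd (w $ i) = snd (w $ j)"
    "(\<integral>\<^sup>+ w. ennreal (\<Sum>i\<in>UNIV. c i (w $ i)) \<partial>Q) \<le> ennreal C"
proof -
  have "\<exists>P :: (('a \<times> 'a) ^ 'n) measure. prob_space P \<and> sets P = sets borel \<and>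
      (\<forall>i. distr P borel (\<lambda>w. w $ i) = \<pi> k i) \<and>
      (AE w in P. \<forall>i j. dist (snd (w $ i)) (snd (w $ j)) \<le> 1 / real (Suc k))" for k
  proof -
    have pos: "1 / real (Suc k) > 0" by simp
    obtain P :: "(('a \<times> 'a) ^ 'n) measure" where "prob_space P" "sets P = sets borel"
      "\<And>i. distr P borel (\<lambda>w. w $ i) = \<pi> k i"
      "AE w in P. \<forall>i j. dist (snd (w $ i)) (snd (w $ j)) \<le> 1 / real (Suc k)"
      using approximate_gluing[of "\<pi> k", OF prob_\<pi> sets_\<pi> snd_\<pi> pos] by blast
    then show ?thesis by blast
  qed
  then have "\<exists>P :: nat \<Rightarrow> (('a \<times> 'a) ^ 'n) measure. \<forall>k. prob_space (P k) \<and> sets (P k) = sets borel \<and>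
      (\<forall>i. distr (P k) borel (\<lambda>w. w $ i) = \<pi> k i) \<and>
      (AE w in P k. \<forall>i j. dist (snd (w $ i)) (snd (w $ j)) \<le> 1 / real (Suc k))"
    by (intro choice allI)
  then obtain P :: "nat \<Rightarrow> (('a \<times> 'a) ^ 'n) measure" where
    P: "\<forall>k. prob_space (P k) \<and> sets (P k) = sets borel \<and>
      (\<forall>i. distr (P k) borel (\<lambda>w. w $ i) = \<pi> k i) \<and>
      (AE w in P k. \<forall>i j. dist (snd (w $ i)) (snd (w $ j)) \<le> 1 / real (Suc k))" ..
  have prob_P: "prob_space (P k)" and sets_P: "sets (P k) = sets borel"
    and marg_P: "distr (P k) borel (\<lambda>w. w $ i) = \<pi> k i"
    and dist_P: "AE w in P k. \<forall>i j. dist (snd (w $ i)) (snd (w $ j)) \<le> 1 / real (Suc k)" for k i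
    using P[rule_format, of k] by (simp_all only: simp_thms)
  have space_P: "space (P k) = UNIV" for k using sets_eq_imp_space_eq[OF sets_P] by simp
  note cont_borel = borel_measurable_continuousI
  have nth_cont: "continuous_on UNIV (\<lambda>w :: ('a \<times> 'a) ^ 'n. w $ i)" for i by (intro continuous_intros)
  have pi1_cont: "continuous_on UNIV (\<lambda>w :: ('a \<times> 'a) ^ 'n. fst (w $ i))" for i by (intro continuous_intros)
  have pi2_cont: "continuous_on UNIV (\<lambda>w :: ('a \<times> 'a) ^ 'n. snd (w $ i))" for i by (intro continuous_intros)
  have fst_snd_borel: "fst \<in> borel_measurable (borel :: ('a \<times> 'a) measure)" "snd \<in> borel_measurable (borel :: ('a \<times> 'a) measure)"
    by (auto intro!: borel_measurable_continuous_onI continuous_intros)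
  have fst_P: "distr (P k) borel (\<lambda>w. fst (w $ i)) = \<mu> i" for k i
    using distr_distr[OF fst_snd_borel(1) cont_borel[OF nth_cont sets_P], of k i] marg_P fst_\<pi> by (simp add: comp_def)
  have snd_P: "distr (P k) borel (\<lambda>w. snd (w $ i)) = \<nu>" for k i
    using distr_distr[OF fst_snd_borel(2) cont_borel[OF nth_cont sets_P], of k i] marg_P snd_\<pi> by (simp add: comp_def)
  have prob_\<mu>: "prob_space (\<mu> i)" "sets (\<mu> i) = sets borel" for i
    using prob_space.prob_space_distr[OF prob_P cont_borel[OF pi1_cont sets_P], of 0 i]
      sets_distr[of "P 0" borel "\<lambda>w. fst (w $ i)"]
    by (simp_all only: fst_P)
  have prob_\<nu>: "prob_space \<nu>" "sets \<nu> = sets borel"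
    using prob_space.prob_space_distr[OF prob_P cont_borel[OF pi2_cont sets_P], of 0 undefined]
      sets_distr[of "P 0" borel "\<lambda>w. snd (w $ undefined)"]
    by (simp_all only: snd_P)
  have tight: "\<exists>R. \<forall>k. measure (P k) {w. R < norm w} \<le> \<epsilon>" if "\<epsilon> > 0" for \<epsilon> :: real
  proof -
    \<comment> \<open>Two tail events per index, hence \<open>2 * CARD('n)\<close> events, share the
      mass \<open>\<epsilon>\<close>.\<close>
    define \<delta> where "\<delta> = \<epsilon> / (2 * CARD('n))"
    have "\<delta> > 0" using that by (simp add: \<delta>_def)
    have tail: "\<exists>R\<ge>0. measure L {x. R < norm x} \<le> \<delta>" if L: "prob_space L" "sets L = sets borel" for L :: "'a measure"
    proof -
      have "(\<lambda>x. x) \<in> borel_measurable L" by (subst measurable_cong_sets[OF L(2) refl]) simp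
      from prob_space.tail_small[OF L(1) this \<open>\<delta> > 0\<close>] show ?thesis
        using sets_eq_imp_space_eq[OF L(2)] by simp
    qed
    obtain R1 where R1: "\<And>i. R1 i \<ge> 0" "\<And>i. measure (\<mu> i) {x. R1 i < norm x} \<le> \<delta>"
      using tail[OF prob_\<mu>] by metis
    obtain R2 where R2: "R2 \<ge> 0" "measure \<nu> {x. R2 < norm x} \<le> \<delta>" using tail[OF prob_\<nu>] by blast
    define R where "R = (\<Sum>i\<in>UNIV. R1 i) + R2"
    have "R1 i \<le> R" for i
      using member_le_sum[of i UNIV R1] R1(1) R2(1) by (simp add: R_def add_increasing2)
    moreover have "R2 \<le> R" using sum_nonneg[of UNIV R1] R1(1) by (simp add: R_def)
    ultimately have R: "R1 i \<le> R" "R2 \<le> R" for i by auto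
    show ?thesis
    proof (intro exI allI)
      fix k
      interpret prob_space "P k" by (rule prob_P)
      define A where "A i = {w :: ('a \<times> 'a) ^ 'n. R < norm (fst (w $ i))}" for i
      define B where "B i = {w :: ('a \<times> 'a) ^ 'n. R < norm (snd (w $ i))}" for i
      have "open (A i)" "open (B i)" for i
        unfolding A_def B_def by (intro open_Collect_less continuous_intros)+
      then have AB: "A i \<in> sets (P k)" "B i \<in> sets (P k)" for i by (auto simp: sets_P)
      have "prob (A i) \<le> \<delta>" for i
      proof -
        interpret \<mu>: prob_space "\<mu> i" by (rule prob_\<mu>)
        have "prob (A i) = measure (\<mu> i) {x. R < norm x}"
          by (subst fst_P[of k i, symmetric], subst measure_distr[OF cont_borel[OF pi1_cont sets_P]])
             (auto simp: A_def space_P vimage_def intro!: borel_open open_Collect_less continuous_intros)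
        also have "\<dots> \<le> measure (\<mu> i) {x. R1 i < norm x}"
          using R(1)[of i] by (intro \<mu>.finite_measure_mono)
             (auto simp: prob_\<mu>(2) intro!: borel_open open_Collect_less continuous_intros)
        finally show ?thesis using R1(2)[of i] by simp
      qed
      moreover have "prob (B i) \<le> \<delta>" for i
      proof -
        interpret \<nu>: prob_space \<nu> by (rule prob_\<nu>)
        have "prob (B i) = measure \<nu> {x. R < norm x}"
          by (subst snd_P[of k i, symmetric], subst measure_distr[OF cont_borel[OF pi2_cont sets_P]])
             (auto simp: B_def space_P vimage_def intro!: borel_open open_Collect_less continuous_intros)
        also have "\<dots> \<le> measure \<nu> {x. R2 < norm x}"
          using R(2) by (intro \<nu>.finite_measure_mono)
             (auto simp: prob_\<nu>(2) intro!: borel_open open_Collect_less continuous_intros)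
        finally show ?thesis using R2(2) by simp
      qed
      ultimately have AB_le: "prob (A i) + prob (B i) \<le> 2 * \<delta>" for i by (smt (verit))
      \<comment> \<open>If no component exceeds \<open>R\<close>, each pair has norm at most
        \<open>2 * R\<close>, and the Euclidean norm is at most the sum of the norms of the
        pairs.\<close>
      have sub: "{w. 2 * R * CARD('n) < norm w} \<subseteq> (\<Union>i. A i \<union> B i)"
      proof (rule ccontr)
        assume "\<not> ?thesis"
        then obtain w where w: "2 * R * CARD('n) < norm w" "\<And>i. w \<notin> A i" "\<And>i. w \<notin> B i" by auto
        have "norm (w $ i) \<le> 2 * R" for i
          using norm_Pair_le[of "fst (w $ i)" "snd (w $ i)"] w(2,3)[of i] by (simp add: A_def B_def not_less)
        then have "(\<Sum>i\<in>UNIV. norm (w $ i)) \<le> (\<Sum>i\<in>(UNIV :: 'n set). 2 * R)" by (intro sum_mono)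
        moreover have "norm w \<le> (\<Sum>i\<in>UNIV. norm (w $ i))" unfolding norm_vec_def by (rule L2_set_le_sum) simp
        ultimately show False using w(1) by (simp add: mult.commute)
      qed
      have "prob {w. 2 * R * CARD('n) < norm w} \<le> prob (\<Union>i. A i \<union> B i)"
        using AB by (intro finite_measure_mono sub) auto
      also have "\<dots> \<le> (\<Sum>i\<in>UNIV. prob (A i \<union> B i))"
        using AB by (intro measure_UNION_le) auto
      also have "\<dots> \<le> (\<Sum>i\<in>(UNIV :: 'n set). 2 * \<delta>)"
        using measure_Un_le[OF AB] AB_le by (intro sum_mono) (rule order_trans)
      also have "\<dots> = \<epsilon>" by (simp add: \<delta>_def)
      finally show "prob {w. 2 * R * CARD('n) < norm w} \<le> \<epsilon>" .
    qed
  qed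
  obtain r Q where r: "strict_mono r" and Q: "prob_space Q" "sets Q = sets borel" and
    conv: "\<And>(f :: ('a \<times> 'a) ^ 'n \<Rightarrow> real) B. continuous_on UNIV f \<Longrightarrow> (\<And>x. \<bar>f x\<bar> \<le> B) \<Longrightarrow>
      (\<lambda>k. \<integral>x. f x \<partial>P (r k)) \<longlonglongrightarrow> (\<integral>x. f x \<partial>Q)"
    using tight_imp_weakly_convergent_subsequence[OF prob_P sets_P tight] by blast
  interpret Q: prob_space Q by (rule Q(1))
  have marginal_limit: "distr Q borel g = L"
    if g: "continuous_on UNIV g" and L: "\<And>k. distr (P k) borel g = L" for g :: "('a \<times> 'a) ^ 'n \<Rightarrow> 'a" and L
  proof (rule borel_measure_eqI_continuous)
    note gQ = cont_borel[OF g Q(2)] and gP = cont_borel[OF g sets_P]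
    show "prob_space (distr Q borel g)" by (rule Q.prob_space_distr[OF gQ])
    show "prob_space L" "sets L = sets borel"
      using prob_space.prob_space_distr[OF prob_P gP, of 0] sets_distr[of "P 0" borel g] by (simp_all only: L)
    fix f :: "'a \<Rightarrow> real" and B assume f: "continuous_on UNIV f" "\<And>x. \<bar>f x\<bar> \<le> B"
    have fb: "f \<in> borel_measurable borel" using f(1) by (rule borel_measurable_continuous_onI)
    have "continuous_on UNIV (\<lambda>w. f (g w))" using continuous_on_compose2[OF f(1) g] by simp
    then have "(\<lambda>k. \<integral>w. f (g w) \<partial>P (r k)) \<longlonglongrightarrow> (\<integral>w. f (g w) \<partial>Q)" by (rule conv) (rule f(2))
    moreover have "(\<integral>w. f (g w) \<partial>P k) = (\<integral>x. f x \<partial>L)" for k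
      using integral_distr[OF gP fb, of k] L by simp
    moreover have "(\<integral>w. f (g w) \<partial>Q) = (\<integral>x. f x \<partial>distr Q borel g)"
      using integral_distr[OF gQ fb] by simp
    ultimately show "(\<integral>x. f x \<partial>distr Q borel g) = (\<integral>x. f x \<partial>L)"
      by (simp add: LIMSEQ_const_iff)
  qed simp
  have snd_eq: "AE w in Q. snd (w $ i) = snd (w $ j)" for i j
  proof -
    \<comment> \<open>The minimum with 1 makes the distance a bounded test function.\<close>
    define f where "f w = min 1 (dist (snd (w $ i)) (snd (w $ j)))" for w :: "('a \<times> 'a) ^ 'n"
    have fc: "continuous_on UNIV f" unfolding f_def by (intro continuous_intros)
    have f01: "0 \<le> f w" "f w \<le> 1" for w by (auto simp: f_def)
    have lim: "(\<lambda>k. \<integral>w. f w \<partial>P (r k)) \<longlonglongrightarrow> (\<integral>w. f w \<partial>Q)"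
      by (rule conv[OF fc, of 1]) (use f01 in auto)
    have le: "(\<integral>w. f w \<partial>P k) \<le> 1 / real (Suc k)" for k
    proof -
      interpret prob_space "P k" by (rule prob_P)
      have "(\<integral>w. f w \<partial>P k) \<le> (\<integral>w. 1 / real (Suc k) \<partial>P k)"
      proof (rule integral_mono_AE)
        show "integrable (P k) f"
          using f01 by (intro integrable_const_bound[where B = 1] cont_borel[OF fc sets_P]) auto
        show "AE w in P k. f w \<le> 1 / real (Suc k)"
          using dist_P[of k] by eventually_elim (auto simp: f_def intro: min.coboundedI2)
      qed simp
      then show ?thesis by (simp add: prob_space)
    qed
    have "(\<integral>w. f w \<partial>Q) \<le> 0"
    proof (rule LIMSEQ_le[OF lim])
      show "(\<lambda>k. 1 / real (Suc (r k))) \<longlonglongrightarrow> 0"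
        using LIMSEQ_subseq_LIMSEQ[OF LIMSEQ_inverse_real_of_nat r] by (simp add: comp_def inverse_eq_divide)
      show "\<exists>N. \<forall>k\<ge>N. (\<integral>w. f w \<partial>P (r k)) \<le> 1 / real (Suc (r k))" using le by blast
    qed
    moreover have "0 \<le> (\<integral>w. f w \<partial>Q)" using f01 by (intro integral_nonneg_AE) auto
    ultimately have "(\<integral>w. f w \<partial>Q) = 0" by (rule antisym)
    moreover have "integrable Q f"
      using f01 by (intro Q.integrable_const_bound[where B = 1] cont_borel[OF fc Q(2)]) auto
    ultimately have "AE w in Q. f w = 0"
      using f01 by (subst integral_nonneg_eq_0_iff_AE[symmetric]) auto
    then show ?thesis by eventually_elim (auto simp: f_def min_def split: if_splits)
  qed
  define F where "F w = (\<Sum>i\<in>UNIV. c i (w $ i))" for w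
  have Fc: "continuous_on UNIV F"
  proof -
    have "continuous_on UNIV (\<lambda>w. c i (w $ i))" for i
      using continuous_on_compose2[OF c_cont nth_cont] by simp
    then show ?thesis unfolding F_def by (intro continuous_intros)
  qed
  have F0: "0 \<le> F w" for w unfolding F_def using c_nonneg by (intro sum_nonneg) auto
  have F_P: "(\<integral>\<^sup>+ w. ennreal (F w) \<partial>P k) \<le> ennreal (C + 1 / real (Suc k))" for k
  proof -
    have cb: "(\<lambda>q. ennreal (c i q)) \<in> borel_measurable borel" for i
      using borel_measurable_continuous_onI[OF c_cont[of i]] by measurable
    have "(\<integral>\<^sup>+ w. ennreal (F w) \<partial>P k) = (\<integral>\<^sup>+ w. (\<Sum>i\<in>UNIV. ennreal (c i (w $ i))) \<partial>P k)"
      by (simp add: F_def sum_ennreal c_nonneg)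
    also have "\<dots> = (\<Sum>i\<in>UNIV. \<integral>\<^sup>+ w. ennreal (c i (w $ i)) \<partial>P k)"
      by (intro nn_integral_sum measurable_compose[OF cont_borel[OF nth_cont sets_P] cb])
    also have "\<dots> = (\<Sum>i\<in>UNIV. \<integral>\<^sup>+ q. ennreal (c i q) \<partial>\<pi> k i)"
    proof (rule sum.cong)
      fix i
      show "(\<integral>\<^sup>+ w. ennreal (c i (w $ i)) \<partial>P k) = (\<integral>\<^sup>+ q. ennreal (c i q) \<partial>\<pi> k i)"
        unfolding marg_P[of k i, symmetric]
        by (rule nn_integral_distr[OF cont_borel[OF nth_cont sets_P], symmetric]) (simp add: cb)
    qed simp
    finally show ?thesis using cost[of k] by simp
  qed
  \<comment> \<open>The cost is continuous but possibly unbounded, so weak convergence is applied to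
    its truncations; monotone convergence in \<open>K\<close> then recovers the full cost.\<close>
  have trunc: "(\<integral>\<^sup>+ w. ennreal (min (real K) (F w)) \<partial>Q) \<le> ennreal C" for K :: nat
  proof -
    define f where "f w = min (real K) (F w)" for w
    have fc: "continuous_on UNIV f" unfolding f_def using Fc by (intro continuous_intros)
    have f0: "0 \<le> f w" "f w \<le> real K" for w using F0 by (auto simp: f_def)
    have lim: "(\<lambda>k. \<integral>w. f w \<partial>P (r k)) \<longlonglongrightarrow> (\<integral>w. f w \<partial>Q)"
      by (rule conv[OF fc, of "real K"]) (use f0 in auto)
    have "(\<integral>w. f w \<partial>P k) \<le> C + 1 / real (Suc k)" for k
    proof -
      interpret prob_space "P k" by (rule prob_P)
      have "integrable (P k) f"
        using f0 by (intro integrable_const_bound[where B = "real K"] cont_borel[OF fc sets_P]) auto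
      then have "ennreal (\<integral>w. f w \<partial>P k) = (\<integral>\<^sup>+ w. ennreal (f w) \<partial>P k)"
        using f0 by (intro nn_integral_eq_integral[symmetric]) auto
      also have "\<dots> \<le> (\<integral>\<^sup>+ w. ennreal (F w) \<partial>P k)"
        by (intro nn_integral_mono ennreal_leI) (simp add: f_def)
      also have "\<dots> \<le> ennreal (C + 1 / real (Suc k))" by (rule F_P)
      finally show ?thesis using \<open>C \<ge> 0\<close> by (subst (asm) ennreal_le_iff) auto
    qed
    then have "(\<integral>w. f w \<partial>Q) \<le> C"
    proof (intro LIMSEQ_le[OF lim])
      have "(\<lambda>k. C + 1 / real (Suc (r k))) \<longlonglongrightarrow> C + 0"
        using LIMSEQ_subseq_LIMSEQ[OF LIMSEQ_inverse_real_of_nat r]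
        by (intro tendsto_add tendsto_const) (simp add: comp_def inverse_eq_divide)
      then show "(\<lambda>k. C + 1 / real (Suc (r k))) \<longlonglongrightarrow> C" by simp
    qed blast
    moreover have "integrable Q f"
      using f0 by (intro Q.integrable_const_bound[where B = "real K"] cont_borel[OF fc Q(2)]) auto
    then have "(\<integral>\<^sup>+ w. ennreal (f w) \<partial>Q) = ennreal (\<integral>w. f w \<partial>Q)"
      using f0 by (intro nn_integral_eq_integral) auto
    ultimately show ?thesis by (simp add: f_def ennreal_leI)
  qed
  have "(\<integral>\<^sup>+ w. ennreal (F w) \<partial>Q) = (\<integral>\<^sup>+ w. (SUP K. ennreal (min (real K) (F w))) \<partial>Q)"
  proof (rule nn_integral_cong)
    fix w
    show "ennreal (F w) = (SUP K. ennreal (min (real K) (F w)))"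
    proof (rule antisym)
      obtain K :: nat where "F w \<le> real K" using real_arch_simple by blast
      then have "ennreal (F w) = ennreal (min (real K) (F w))" by (simp add: min_def)
      also have "\<dots> \<le> (SUP K. ennreal (min (real K) (F w)))" by (rule SUP_upper) simp
      finally show "ennreal (F w) \<le> (SUP K. ennreal (min (real K) (F w)))" .
    qed (auto intro!: SUP_least ennreal_leI)
  qed
  also have "\<dots> = (SUP K. \<integral>\<^sup>+ w. ennreal (min (real K) (F w)) \<partial>Q)"
  proof (rule nn_integral_monotone_convergence_SUP)
    show "incseq (\<lambda>K w. ennreal (min (real K) (F w)))"
      by (auto simp: incseq_def le_fun_def intro!: ennreal_leI min.mono)
    show "(\<lambda>w. ennreal (min (real K) (F w))) \<in> borel_measurable Q" for K
      using cont_borel[OF Fc Q(2)] by measurable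
  qed
  also have "\<dots> \<le> ennreal C" using trunc by (intro SUP_least)
  finally have "(\<integral>\<^sup>+ w. ennreal (F w) \<partial>Q) \<le> ennreal C" .
  then show thesis
    using that[OF Q] marginal_limit[OF pi1_cont fst_P] marginal_limit[OF pi2_cont snd_P] snd_eq
    by (simp add: F_def)
qed

section \<open>Wasserstein barycenters\<close>

lemma prob_measures_momentD:
  assumes "\<mu> \<in> prob_measures_moment p"
  shows "prob_space \<mu>" "sets \<mu> = sets borel" "(\<integral>\<^sup>+ x. ennreal (norm x powr p) \<partial>\<mu>) < \<infinity>"
proof -
  show "prob_space \<mu>" "sets \<mu> = sets borel" using assms by (simp_all add: prob_measures_moment_def)
  have "integrable \<mu> (\<lambda>x. norm x powr p)" using assms by (simp add: prob_measures_moment_def)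
  then show "(\<integral>\<^sup>+ x. ennreal (norm x powr p) \<partial>\<mu>) < \<infinity>" by (simp add: integrable_iff_bounded)
qed

lemma norm_diff_powr_le:
  fixes x y :: "'a::real_normed_vector"
  assumes "p \<ge> 0"
  shows "norm (x - y) powr p \<le> 2 powr p * (norm x powr p + norm y powr p)"
proof -
  have "norm (x - y) \<le> 2 * max (norm x) (norm y)"
    using norm_triangle_ineq4[of x y] by (simp add: max_def)
  then have "norm (x - y) powr p \<le> (2 * max (norm x) (norm y)) powr p"
    using assms by (intro powr_mono2) auto
  also have "\<dots> = 2 powr p * max (norm x) (norm y) powr p" by (rule powr_mult)
  also have "\<dots> \<le> 2 powr p * (norm x powr p + norm y powr p)"
    by (intro mult_left_mono) (auto simp: max_def)
  finally show ?thesis .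
qed

lemma pair_in_transport_plans:
  fixes \<mu> \<nu> :: "'a::euclidean_space measure"
  assumes "prob_space \<mu>" "sets \<mu> = sets borel" "prob_space \<nu>" "sets \<nu> = sets borel"
  shows "\<mu> \<Otimes>\<^sub>M \<nu> \<in> transport_plans \<mu> \<nu>"
proof -
  interpret \<mu>: prob_space \<mu> by fact
  interpret \<nu>: prob_space \<nu> by fact
  interpret pair_prob_space \<mu> \<nu> ..
  have s: "sets (\<mu> \<Otimes>\<^sub>M \<nu>) = sets borel"
    unfolding borel_prod[symmetric] by (rule sets_pair_measure_cong[OF assms(2,4)])
  have "distr (\<mu> \<Otimes>\<^sub>M \<nu>) borel fst = distr (\<mu> \<Otimes>\<^sub>M \<nu>) \<mu> fst"
    by (rule distr_cong) (use assms in auto)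
  also have "\<dots> = \<mu>" by (rule \<nu>.distr_pair_fst)
  finally have "distr (\<mu> \<Otimes>\<^sub>M \<nu>) borel fst = \<mu>" .
  moreover have "distr (\<mu> \<Otimes>\<^sub>M \<nu>) borel snd = \<nu>"
  proof (rule measure_eqI)
    fix A assume "A \<in> sets (distr (\<mu> \<Otimes>\<^sub>M \<nu>) borel snd)"
    then have A: "A \<in> sets \<nu>" using assms by simp
    have "emeasure (distr (\<mu> \<Otimes>\<^sub>M \<nu>) borel snd) A = emeasure (\<mu> \<Otimes>\<^sub>M \<nu>) (snd -` A \<inter> space (\<mu> \<Otimes>\<^sub>M \<nu>))"
      using A assms(4) by (intro emeasure_distr)
        (auto simp: measurable_cong_sets[OF s refl] intro!: borel_measurable_continuous_onI continuous_intros)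
    also have "snd -` A \<inter> space (\<mu> \<Otimes>\<^sub>M \<nu>) = space \<mu> \<times> A"
      using sets.sets_into_space[OF A] by (auto simp: space_pair_measure)
    also have "emeasure (\<mu> \<Otimes>\<^sub>M \<nu>) (space \<mu> \<times> A) = emeasure \<nu> A"
      using A by (simp add: \<nu>.emeasure_pair_measure_Times \<mu>.emeasure_space_1)
    finally show "emeasure (distr (\<mu> \<Otimes>\<^sub>M \<nu>) borel snd) A = emeasure \<nu> A" .
  qed (simp add: assms)
  ultimately show ?thesis using s prob_space_axioms by (simp add: transport_plans_def)
qed

abbreviation transport_cost :: "real \<Rightarrow> ('a::euclidean_space \<times> 'a) measure \<Rightarrow> ennreal" where
  "transport_cost p \<pi> \<equiv> \<integral>\<^sup>+ z. ennreal (norm (fst z - snd z) powr p) \<partial>\<pi>"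

lemma borel_measurable_transport_cost:
  assumes "p > 1"
  shows "(\<lambda>z :: 'a::euclidean_space \<times> 'a. ennreal (norm (fst z - snd z) powr p)) \<in> borel_measurable borel"
proof -
  have "(\<lambda>z :: 'a \<times> 'a. norm (fst z - snd z) powr p) \<in> borel_measurable borel"
    using assms by (intro borel_measurable_continuous_onI continuous_intros)
  then show ?thesis by measurable
qed

text \<open>The product plan has finite cost by the moment assumptions, so \<open>enn2real\<close>
  preserves the infimum and the two powers cancel.\<close>

lemma wasserstein_powr:
  fixes \<mu> \<nu> :: "'a::euclidean_space measure"
  assumes p: "p > 1" and \<mu>: "\<mu> \<in> prob_measures_moment p" and \<nu>: "\<nu> \<in> prob_measures_moment p"
  shows "ennreal (wasserstein p \<mu> \<nu> powr p) =
    (INF \<pi>\<in>transport_plans \<mu> \<nu>. transport_cost p \<pi>)" (is "_ = ?I")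
proof -
  note \<mu>' = prob_measures_momentD[OF \<mu>] and \<nu>' = prob_measures_momentD[OF \<nu>]
  interpret \<mu>: prob_space \<mu> by (rule \<mu>')
  interpret \<nu>: prob_space \<nu> by (rule \<nu>')
  interpret pair_prob_space \<mu> \<nu> ..
  have nb: "(\<lambda>x. ennreal (norm x powr p)) \<in> borel_measurable L" if "sets L = sets borel" for L :: "'a measure"
    using that p by (subst measurable_cong_sets[OF that refl])
      (intro measurable_compose[OF _ measurable_ennreal] borel_measurable_continuous_onI continuous_intros)
  have "?I \<le> transport_cost p (\<mu> \<Otimes>\<^sub>M \<nu>)"
    by (rule INF_lower) (rule pair_in_transport_plans[OF \<mu>'(1,2) \<nu>'(1,2)])
  also have "\<dots> \<le> (\<integral>\<^sup>+ z. ennreal (2 powr p) * (ennreal (norm (fst z) powr p) + ennreal (norm (snd z) powr p)) \<partial>(\<mu> \<Otimes>\<^sub>M \<nu>))"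
    using norm_diff_powr_le[of p] p
    by (intro nn_integral_mono) (auto simp flip: ennreal_plus ennreal_mult intro!: ennreal_leI)
  also have "\<dots> = ennreal (2 powr p) * ((\<integral>\<^sup>+ z. ennreal (norm (fst z) powr p) \<partial>(\<mu> \<Otimes>\<^sub>M \<nu>)) + (\<integral>\<^sup>+ z. ennreal (norm (snd z) powr p) \<partial>(\<mu> \<Otimes>\<^sub>M \<nu>)))"
  proof -
    have "(\<lambda>z. ennreal (norm (fst z) powr p)) \<in> borel_measurable (\<mu> \<Otimes>\<^sub>M \<nu>)"
      "(\<lambda>z. ennreal (norm (snd z) powr p)) \<in> borel_measurable (\<mu> \<Otimes>\<^sub>M \<nu>)"
      using measurable_compose[OF measurable_fst nb[OF \<mu>'(2)]] measurable_compose[OF measurable_snd nb[OF \<nu>'(2)]]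
      by auto
    then show ?thesis by (simp add: nn_integral_cmult nn_integral_add)
  qed
  also have "(\<integral>\<^sup>+ z. ennreal (norm (fst z) powr p) \<partial>(\<mu> \<Otimes>\<^sub>M \<nu>)) = (\<integral>\<^sup>+ x. ennreal (norm x powr p) \<partial>\<mu>)"
    using nb[OF \<mu>'(2)] by (subst \<nu>.nn_integral_fst[symmetric]) (auto simp: \<nu>.emeasure_space_1)
  also have "(\<integral>\<^sup>+ z. ennreal (norm (snd z) powr p) \<partial>(\<mu> \<Otimes>\<^sub>M \<nu>)) = (\<integral>\<^sup>+ x. ennreal (norm x powr p) \<partial>\<nu>)"
    using nb[OF \<nu>'(2)] by (subst \<nu>.nn_integral_fst[symmetric]) (auto simp: \<mu>.emeasure_space_1)
  also have "ennreal (2 powr p) * ((\<integral>\<^sup>+ x. ennreal (norm x powr p) \<partial>\<mu>) + (\<integral>\<^sup>+ x. ennreal (norm x powr p) \<partial>\<nu>)) < \<infinity>"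
    using \<mu>'(3) \<nu>'(3) by (simp add: ennreal_mult_less_top)
  finally have "?I < top" by simp
  then have "ennreal (enn2real ?I) = ?I" by simp
  moreover have "(enn2real ?I powr (1 / p)) powr p = enn2real ?I" using p by (simp add: powr_powr)
  ultimately show ?thesis by (simp add: wasserstein_def)
qed

lemma ex_near_optimal_plan:
  fixes \<mu> \<nu> :: "'a::euclidean_space measure"
  assumes "p > 1" "\<mu> \<in> prob_measures_moment p" "\<nu> \<in> prob_measures_moment p" "\<epsilon> > 0"
  shows "\<exists>\<pi>\<in>transport_plans \<mu> \<nu>. transport_cost p \<pi> \<le> ennreal (wasserstein p \<mu> \<nu> powr p + \<epsilon>)"
proof -
  have "\<exists>\<pi>\<in>transport_plans \<mu> \<nu>. transport_cost p \<pi> < ennreal (wasserstein p \<mu> \<nu> powr p) + ennreal \<epsilon>"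
    by (rule INF_approx_ennreal[OF \<open>\<epsilon> > 0\<close> wasserstein_powr[OF assms(1-3)]]) simp
  then show ?thesis using \<open>\<epsilon> > 0\<close> by (auto simp flip: ennreal_plus intro: less_imp_le)
qed

context barycentric_weights
begin

lemma multi_plans_component:
  fixes \<gamma> :: "('a::euclidean_space ^ 'n) measure"
  assumes "\<gamma> \<in> multi_plans \<mu>"
  shows "prob_space \<gamma>" "sets \<gamma> = sets borel" "\<And>i. distr \<gamma> borel (\<lambda>x. x $ i) = \<mu> i"
  using assms by (auto simp: multi_plans_def)

lemma nn_integral_component_moment:
  fixes \<gamma> :: "('a::euclidean_space ^ 'n) measure"
  assumes \<gamma>: "\<gamma> \<in> multi_plans \<mu>" and \<mu>: "\<mu> i \<in> prob_measures_moment p"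
  shows "(\<integral>\<^sup>+ x. ennreal (norm (x $ i) powr p) \<partial>\<gamma>) < \<infinity>"
proof -
  note \<gamma>' = multi_plans_component[OF \<gamma>]
  have "(\<integral>\<^sup>+ y. ennreal (norm y powr p) \<partial>\<mu> i) = (\<integral>\<^sup>+ x. ennreal (norm (x $ i) powr p) \<partial>\<gamma>)"
    unfolding \<gamma>'(3)[symmetric]
  proof (rule nn_integral_distr)
    show "(\<lambda>x. x $ i) \<in> borel_measurable \<gamma>"
      by (subst measurable_cong_sets[OF \<gamma>'(2) refl]) (intro borel_measurable_continuous_onI continuous_intros)
    have "(\<lambda>y :: 'a. norm y powr p) \<in> borel_measurable borel"
      using p by (intro borel_measurable_continuous_onI continuous_intros)
    then show "(\<lambda>y. ennreal (norm y powr p)) \<in> borel_measurable (distr \<gamma> borel (\<lambda>x. x $ i))" by simp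
  qed
  then show ?thesis using prob_measures_momentD(3)[OF \<mu>] by simp
qed

text \<open>The cost is at most the objective at 0, which is a combination of p-th powers with
  finite moments.\<close>

lemma nn_integral_cost_finite:
  fixes \<gamma> :: "('a::euclidean_space ^ 'n) measure"
  assumes \<gamma>: "\<gamma> \<in> multi_plans \<mu>" and \<mu>: "\<And>i. \<mu> i \<in> prob_measures_moment p"
  shows "(\<integral>\<^sup>+ x. ennreal (cost x) \<partial>\<gamma>) < \<infinity>"
proof -
  note \<gamma>' = multi_plans_component[OF \<gamma>]
  have meas: "(\<lambda>x. ennreal (norm (x $ i) powr p)) \<in> borel_measurable \<gamma>" for i
    using p by (subst measurable_cong_sets[OF \<gamma>'(2) refl])
      (intro measurable_compose[OF _ measurable_ennreal] borel_measurable_continuous_onI continuous_intros)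
  have "(\<integral>\<^sup>+ x. ennreal (cost x) \<partial>\<gamma>) \<le> (\<integral>\<^sup>+ x. (\<Sum>i\<in>UNIV. ennreal (lam i) * ennreal (norm (x $ i) powr p)) \<partial>\<gamma>)"
  proof (rule nn_integral_mono)
    fix x
    have "ennreal (cost x) \<le> ennreal (objective x 0)" by (intro ennreal_leI cost_le)
    then show "ennreal (cost x) \<le> (\<Sum>i\<in>UNIV. ennreal (lam i) * ennreal (norm (x $ i) powr p))"
      using lam_pos by (simp add: bary_objective_def sum_ennreal less_imp_le flip: ennreal_mult)
  qed
  also have "\<dots> = (\<Sum>i\<in>UNIV. ennreal (lam i) * (\<integral>\<^sup>+ x. ennreal (norm (x $ i) powr p) \<partial>\<gamma>))"
    using meas by (subst nn_integral_sum) (auto intro!: sum.cong nn_integral_cmult)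
  also have "\<dots> < \<infinity>"
    using nn_integral_component_moment[OF \<gamma> \<mu>] by (auto simp: ennreal_mult_less_top)
  finally show ?thesis .
qed

text \<open>The joint law of \<open>x $ i\<close> and \<open>bary x\<close> is a transport plan
  between \<open>\<mu> i\<close> and the pushforward, and its weighted cost is the
  \<open>i\<close>-th term of the integrated minimal objective.\<close>

lemma pushforward_bary_competitor:
  fixes \<gamma> :: "('a::euclidean_space ^ 'n) measure"
  assumes \<gamma>: "\<gamma> \<in> multi_plans \<mu>" and \<mu>: "\<And>i. \<mu> i \<in> prob_measures_moment p"
  defines "\<nu> \<equiv> distr \<gamma> borel bary"
  shows "\<nu> \<in> prob_measures_moment p"
    and "ennreal (\<Sum>i\<in>UNIV. lam i * wasserstein p (\<mu> i) \<nu> powr p) \<le> (\<integral>\<^sup>+ x. ennreal (cost x) \<partial>\<gamma>)"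
proof -
  note \<gamma>' = multi_plans_component[OF \<gamma>]
  interpret prob_space \<gamma> by (rule \<gamma>'(1))
  note cont_borel = borel_measurable_continuousI[OF _ \<gamma>'(2)]
  have bary: "bary \<in> borel_measurable \<gamma>" by (intro cont_borel continuous_intros)
  have nb: "(\<lambda>y :: 'a. norm y powr p) \<in> borel_measurable borel"
    using p by (intro borel_measurable_continuous_onI continuous_intros)
  have bound: "norm (bary x) powr p \<le> 2 powr p * (\<Sum>i\<in>UNIV. norm (x $ i) powr p)" for x :: "'a ^ 'n"
  proof -
    \<comment> \<open>\<open>norm_bary_le\<close> asks for one radius for all coordinates; the
      largest norm is itself among the terms of the sum.\<close>
    define R where "R = Max (range (\<lambda>i. norm (x $ i)))"
    have "R \<in> range (\<lambda>i. norm (x $ i))" unfolding R_def by (rule Max_in) auto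
    then obtain j where j: "R = norm (x $ j)" by auto
    have "norm (x $ i) \<le> R" for i unfolding R_def by (rule Max_ge) auto
    then have "norm (bary x) \<le> 2 * R" by (rule norm_bary_le)
    then have "norm (bary x) powr p \<le> (2 * R) powr p" using p by (intro powr_mono2) auto
    also have "\<dots> = 2 powr p * norm (x $ j) powr p" by (simp add: powr_mult j)
    also have "\<dots> \<le> 2 powr p * (\<Sum>i\<in>UNIV. norm (x $ i) powr p)"
      by (intro mult_left_mono member_le_sum) auto
    finally show ?thesis .
  qed
  have "integrable \<gamma> (\<lambda>x. norm (x $ i) powr p)" for i
    using nn_integral_component_moment[OF \<gamma> \<mu>, of i] p
    by (auto simp: integrable_iff_bounded intro!: cont_borel continuous_intros)
  then have "integrable \<gamma> (\<lambda>x. 2 powr p * (\<Sum>i\<in>UNIV. norm (x $ i) powr p))"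
    by (intro integrable_mult_right Bochner_Integration.integrable_sum) auto
  then have "integrable \<gamma> (\<lambda>x. norm (bary x) powr p)"
    by (rule Bochner_Integration.integrable_bound)
       (use p in \<open>auto intro!: cont_borel continuous_intros AE_I2 bound order_trans[OF bound]\<close>)
  then have "integrable \<nu> (\<lambda>y. norm y powr p)"
    unfolding \<nu>_def by (subst integrable_distr_eq[OF bary nb])
  moreover have "prob_space \<nu>" unfolding \<nu>_def by (rule prob_space_distr[OF bary])
  ultimately show \<nu>: "\<nu> \<in> prob_measures_moment p" by (simp add: prob_measures_moment_def \<nu>_def)
  have W: "ennreal (wasserstein p (\<mu> i) \<nu> powr p) \<le> (\<integral>\<^sup>+ x. ennreal (norm (x $ i - bary x) powr p) \<partial>\<gamma>)" for i
  proof -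
    define \<pi> where "\<pi> = distr \<gamma> borel (\<lambda>x. (x $ i, bary x))"
    have m: "(\<lambda>x. (x $ i, bary x)) \<in> borel_measurable \<gamma>" by (intro cont_borel continuous_intros)
    have fs: "fst \<in> borel_measurable (borel :: ('a \<times> 'a) measure)" "snd \<in> borel_measurable (borel :: ('a \<times> 'a) measure)"
      by (auto intro!: borel_measurable_continuous_onI continuous_intros)
    have "distr \<pi> borel fst = \<mu> i" "distr \<pi> borel snd = \<nu>"
      unfolding \<pi>_def \<nu>_def \<gamma>'(3)[symmetric] distr_distr[OF fs(1) m] distr_distr[OF fs(2) m]
      by (simp_all add: comp_def)
    then have "\<pi> \<in> transport_plans (\<mu> i) \<nu>"
      using prob_space_distr[OF m] by (simp add: transport_plans_def \<pi>_def)
    then have "ennreal (wasserstein p (\<mu> i) \<nu> powr p) \<le> transport_cost p \<pi>"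
      unfolding wasserstein_powr[OF p \<mu> \<nu>] by (rule INF_lower)
    also have "\<dots> = (\<integral>\<^sup>+ x. ennreal (norm (x $ i - bary x) powr p) \<partial>\<gamma>)"
      unfolding \<pi>_def using borel_measurable_transport_cost[OF p] by (subst nn_integral_distr[OF m]) auto
    finally show ?thesis .
  qed
  have "ennreal (\<Sum>i\<in>UNIV. lam i * wasserstein p (\<mu> i) \<nu> powr p) =
      (\<Sum>i\<in>UNIV. ennreal (lam i) * ennreal (wasserstein p (\<mu> i) \<nu> powr p))"
    using lam_pos by (simp add: sum_ennreal less_imp_le flip: ennreal_mult)
  also have "\<dots> \<le> (\<Sum>i\<in>UNIV. ennreal (lam i) * (\<integral>\<^sup>+ x. ennreal (norm (x $ i - bary x) powr p) \<partial>\<gamma>))"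
    by (intro sum_mono mult_left_mono W) auto
  also have "\<dots> = (\<integral>\<^sup>+ x. (\<Sum>i\<in>UNIV. ennreal (lam i) * ennreal (norm (x $ i - bary x) powr p)) \<partial>\<gamma>)"
  proof -
    have "(\<lambda>x. ennreal (norm (x $ i - bary x) powr p)) \<in> borel_measurable \<gamma>" for i
      using p by (intro measurable_compose[OF _ measurable_ennreal] cont_borel continuous_intros)
    then show ?thesis by (subst nn_integral_sum) (auto intro!: sum.cong nn_integral_cmult[symmetric])
  qed
  also have "\<dots> = (\<integral>\<^sup>+ x. ennreal (cost x) \<partial>\<gamma>)"
    using lam_pos by (simp add: cost_eq bary_objective_def sum_ennreal less_imp_le flip: ennreal_mult)
  finally show "ennreal (\<Sum>i\<in>UNIV. lam i * wasserstein p (\<mu> i) \<nu> powr p) \<le> (\<integral>\<^sup>+ x. ennreal (cost x) \<partial>\<gamma>)" .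
qed

text \<open>For the glued plan the integrated cost is at most the integrated objective at the common
  second component, which is at most \<open>J \<nu>\<close>; by minimality of \<open>\<nu>\<close>
  this is at most the integrated cost of any plan. All are equal, so the second component is almost
  surely the barycenter of the first ones.\<close>

theorem barycenter_is_pushforward:
  fixes \<mu> :: "'n \<Rightarrow> 'a::euclidean_space measure"
  assumes sum_lam: "(\<Sum>i\<in>UNIV. lam i) = 1" and \<mu>: "\<And>i. \<mu> i \<in> prob_measures_moment p"
    and bary_\<nu>: "is_wasserstein_barycenter p lam \<mu> \<nu>"
  obtains \<gamma> where "\<gamma> \<in> multi_plans \<mu>" "\<nu> = distr \<gamma> borel bary"
    "\<And>\<gamma>'. \<gamma>' \<in> multi_plans \<mu> \<Longrightarrow> (\<integral>\<^sup>+ x. ennreal (cost x) \<partial>\<gamma>) \<le> (\<integral>\<^sup>+ x. ennreal (cost x) \<partial>\<gamma>')"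
proof -
  define J where "J \<nu> = (\<Sum>i\<in>UNIV. lam i * wasserstein p (\<mu> i) \<nu> powr p)" for \<nu>
  have \<nu>: "\<nu> \<in> prob_measures_moment p" and opt: "\<And>\<nu>'. \<nu>' \<in> prob_measures_moment p \<Longrightarrow> J \<nu> \<le> J \<nu>'"
    using bary_\<nu> by (auto simp: is_wasserstein_barycenter_def is_arg_min_def J_def not_less)
  have J0: "J \<nu> \<ge> 0" unfolding J_def using lam_pos by (intro sum_nonneg) (auto simp: less_imp_le)
  have "\<exists>\<pi>\<in>transport_plans (\<mu> i) \<nu>. transport_cost p \<pi>
      \<le> ennreal (wasserstein p (\<mu> i) \<nu> powr p + 1 / real (Suc k))" for k i
    by (rule ex_near_optimal_plan[OF p \<mu> \<nu>]) simp
  then have "\<forall>k i. \<exists>\<pi>. \<pi> \<in> transport_plans (\<mu> i) \<nu> \<and> transport_cost p \<pi>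
      \<le> ennreal (wasserstein p (\<mu> i) \<nu> powr p + 1 / real (Suc k))" by blast
  then obtain \<pi> where "\<forall>k i. \<pi> k i \<in> transport_plans (\<mu> i) \<nu> \<and> transport_cost p (\<pi> k i)
      \<le> ennreal (wasserstein p (\<mu> i) \<nu> powr p + 1 / real (Suc k))" unfolding choice_iff by (elim exE)
  then have \<pi>: "\<And>k i. \<pi> k i \<in> transport_plans (\<mu> i) \<nu>"
    "\<And>k i. transport_cost p (\<pi> k i)
      \<le> ennreal (wasserstein p (\<mu> i) \<nu> powr p + 1 / real (Suc k))" by (simp_all only: simp_thms)
  define c where "c i q = lam i * norm (fst q - snd q) powr p" for i and q :: "'a \<times> 'a"
  have c_cont: "continuous_on UNIV (c i)" for i
    unfolding c_def using p by (intro continuous_intros)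
  have c_nonneg: "0 \<le> c i q" for i q using lam_pos[of i] by (simp add: c_def)
  have cost_\<pi>: "(\<Sum>i\<in>UNIV. \<integral>\<^sup>+ q. ennreal (c i q) \<partial>\<pi> k i) \<le> ennreal (J \<nu> + 1 / real (Suc k))" for k
  proof -
    have "(\<integral>\<^sup>+ q. ennreal (c i q) \<partial>\<pi> k i) \<le> ennreal (lam i * (wasserstein p (\<mu> i) \<nu> powr p + 1 / real (Suc k)))" for i
    proof -
      have s: "sets (\<pi> k i) = sets borel" using \<pi>(1)[of k i] by (simp add: transport_plans_def)
      have "(\<integral>\<^sup>+ q. ennreal (c i q) \<partial>\<pi> k i) = ennreal (lam i) * transport_cost p (\<pi> k i)"
        using borel_measurable_transport_cost[OF p] lam_pos[of i]
        by (subst nn_integral_cmult[symmetric]) (simp_all add: c_def ennreal_mult less_imp_le measurable_cong_sets[OF s refl])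
      also have "\<dots> \<le> ennreal (lam i) * ennreal (wasserstein p (\<mu> i) \<nu> powr p + 1 / real (Suc k))"
        by (intro mult_left_mono \<pi>(2)) simp
      also have "\<dots> = ennreal (lam i * (wasserstein p (\<mu> i) \<nu> powr p + 1 / real (Suc k)))"
        using lam_pos[of i] by (intro ennreal_mult[symmetric]) auto
      finally show ?thesis .
    qed
    then have "(\<Sum>i\<in>UNIV. \<integral>\<^sup>+ q. ennreal (c i q) \<partial>\<pi> k i) \<le>
        (\<Sum>i\<in>UNIV. ennreal (lam i * (wasserstein p (\<mu> i) \<nu> powr p + 1 / real (Suc k))))"
      by (intro sum_mono)
    also have "\<dots> = ennreal (\<Sum>i\<in>UNIV. lam i * (wasserstein p (\<mu> i) \<nu> powr p + 1 / real (Suc k)))"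
      using lam_pos by (intro sum_ennreal) (auto simp: less_imp_le)
    \<comment> \<open>Since the weights sum to 1, the total error is again 1 / (k + 1).\<close>
    also have "(\<Sum>i\<in>UNIV. lam i * (wasserstein p (\<mu> i) \<nu> powr p + 1 / real (Suc k))) = J \<nu> + 1 / real (Suc k)"
      using sum_lam by (simp add: J_def distrib_left sum.distrib flip: sum_divide_distrib)
    finally show ?thesis .
  qed
  obtain Q :: "(('a \<times> 'a) ^ 'n) measure" where Q: "prob_space Q" "sets Q = sets borel"
    "\<And>i. distr Q borel (\<lambda>w. fst (w $ i)) = \<mu> i" "\<And>i. distr Q borel (\<lambda>w. snd (w $ i)) = \<nu>"
    "\<And>i j. AE w in Q. snd (w $ i) = snd (w $ j)"
    "(\<integral>\<^sup>+ w. ennreal (\<Sum>i\<in>UNIV. c i (w $ i)) \<partial>Q) \<le> ennreal (J \<nu>)"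
    by (rule gluing_limit[of \<pi> \<mu> \<nu> c "J \<nu>"])
       (use \<pi>(1) c_cont c_nonneg cost_\<pi> J0 in \<open>auto simp: transport_plans_def\<close>)
  interpret Q: prob_space Q by (rule Q(1))
  note cont_borel = borel_measurable_continuousI[OF _ Q(2)]
  define X where "X w = (\<chi> i. fst (w $ i))" for w :: "('a \<times> 'a) ^ 'n"
  \<comment> \<open>Any index may be taken, as the second components agree almost
    everywhere.\<close>
  define Z where "Z w = snd (w $ undefined)" for w :: "('a \<times> 'a) ^ 'n"
  have Xc: "continuous_on UNIV X" unfolding X_def by (intro continuous_intros)
  have Zc: "continuous_on UNIV Z" unfolding Z_def by (intro continuous_intros)
  define \<gamma> where "\<gamma> = distr Q borel X"
  have nth: "(\<lambda>x. x $ i) \<in> borel_measurable (borel :: ('a ^ 'n) measure)" for i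
    by (intro borel_measurable_continuous_onI continuous_intros)
  have "distr \<gamma> borel (\<lambda>x. x $ i) = \<mu> i" for i
    unfolding \<gamma>_def distr_distr[OF nth cont_borel[OF Xc]] Q(3)[symmetric] by (simp add: comp_def X_def)
  then have \<gamma>: "\<gamma> \<in> multi_plans \<mu>"
    using Q.prob_space_distr[OF cont_borel[OF Xc]] by (simp add: multi_plans_def \<gamma>_def)
  have cost_meas: "(\<lambda>x :: 'a ^ 'n. ennreal (cost x)) \<in> borel_measurable borel"
    by (intro measurable_compose[OF _ measurable_ennreal] borel_measurable_continuous_onI continuous_intros)
  have cost_\<gamma>: "(\<integral>\<^sup>+ x. ennreal (cost x) \<partial>\<gamma>) = (\<integral>\<^sup>+ w. ennreal (cost (X w)) \<partial>Q)"
    unfolding \<gamma>_def using cost_meas by (intro nn_integral_distr cont_borel Xc) simp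
  have obj: "(\<integral>\<^sup>+ w. ennreal (objective (X w) (Z w)) \<partial>Q) \<le> ennreal (J \<nu>)"
  proof -
    have "AE w in Q. \<forall>i\<in>UNIV. snd (w $ i) = Z w"
      unfolding Z_def using Q(5) by (intro AE_finite_allI) auto
    then have "AE w in Q. ennreal (objective (X w) (Z w)) = ennreal (\<Sum>i\<in>UNIV. c i (w $ i))"
      by eventually_elim (simp add: bary_objective_def X_def c_def)
    then have "(\<integral>\<^sup>+ w. ennreal (objective (X w) (Z w)) \<partial>Q) = (\<integral>\<^sup>+ w. ennreal (\<Sum>i\<in>UNIV. c i (w $ i)) \<partial>Q)"
      by (rule nn_integral_cong_AE)
    then show ?thesis using Q(6) by simp
  qed
  have le: "ennreal (J \<nu>) \<le> (\<integral>\<^sup>+ x. ennreal (cost x) \<partial>\<gamma>')" if "\<gamma>' \<in> multi_plans \<mu>" for \<gamma>'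
  proof -
    have "ennreal (J \<nu>) \<le> ennreal (J (distr \<gamma>' borel bary))"
      using opt pushforward_bary_competitor(1)[OF that \<mu>] by (intro ennreal_leI) auto
    also have "\<dots> \<le> (\<integral>\<^sup>+ x. ennreal (cost x) \<partial>\<gamma>')"
      unfolding J_def by (rule pushforward_bary_competitor(2)[OF that \<mu>])
    finally show ?thesis .
  qed
  have cost_obj: "(\<integral>\<^sup>+ w. ennreal (cost (X w)) \<partial>Q) \<le> (\<integral>\<^sup>+ w. ennreal (objective (X w) (Z w)) \<partial>Q)"
    by (intro nn_integral_mono ennreal_leI cost_le)
  have eq: "(\<integral>\<^sup>+ w. ennreal (cost (X w)) \<partial>Q) = ennreal (J \<nu>)"
    "(\<integral>\<^sup>+ w. ennreal (objective (X w) (Z w)) \<partial>Q) = ennreal (J \<nu>)"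
    using le[OF \<gamma>] cost_\<gamma> cost_obj obj by (auto intro!: antisym order_trans[OF cost_obj] elim: order_trans)
  have m1: "(\<lambda>w. ennreal (objective (X w) (Z w))) \<in> borel_measurable Q"
    and m2: "(\<lambda>w. ennreal (cost (X w))) \<in> borel_measurable Q"
  proof -
    show "(\<lambda>w. ennreal (objective (X w) (Z w))) \<in> borel_measurable Q"
      using Xc Zc by (intro measurable_compose[OF _ measurable_ennreal] cont_borel continuous_intros)
    show "(\<lambda>w. ennreal (cost (X w))) \<in> borel_measurable Q"
      using Xc by (intro measurable_compose[OF _ measurable_ennreal] cont_borel continuous_on_cost)
  qed
  \<comment> \<open>Both integrals equal the finite value \<open>J \<nu>\<close>, so the integral of
    the difference is 0. Subtraction in \<open>ennreal\<close> truncates at 0, so a zero difference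
    yields exactly this inequality.\<close>
  have "AE w in Q. ennreal (objective (X w) (Z w)) \<le> ennreal (cost (X w))"
  proof (rule AE_mp[OF nn_integral_0_iff_AE[THEN iffD1]])
    show m: "(\<lambda>w. ennreal (objective (X w) (Z w)) - ennreal (cost (X w))) \<in> borel_measurable Q"
      using m1 m2 by measurable
    show "(\<integral>\<^sup>+ w. ennreal (objective (X w) (Z w)) - ennreal (cost (X w)) \<partial>Q) = 0"
      using eq by (subst nn_integral_diff[OF m1 m2]) (auto intro!: AE_I2 ennreal_leI cost_le)
    show "AE w in Q. ennreal (objective (X w) (Z w)) - ennreal (cost (X w)) = 0 \<longrightarrow>
        ennreal (objective (X w) (Z w)) \<le> ennreal (cost (X w))"
      by (rule AE_I2) (simp add: diff_eq_0_iff_ennreal)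
  qed
  then have "AE w in Q. Z w = bary (X w)"
    by eventually_elim (simp add: ennreal_le_iff cost_nonneg bary_eq_if_cost)
  then have "distr Q borel Z = distr Q borel (\<lambda>w. bary (X w))"
    using Xc Zc by (intro distr_cong_AE cont_borel continuous_intros) auto
  moreover have "distr Q borel Z = \<nu>" using Q(4)[of undefined] by (simp add: Z_def[abs_def])
  moreover have "distr Q borel (\<lambda>w. bary (X w)) = distr \<gamma> borel bary"
    unfolding \<gamma>_def distr_distr[OF borel_measurable_bary cont_borel[OF Xc]] by (simp add: comp_def)
  ultimately have "\<nu> = distr \<gamma> borel bary" by simp
  then show thesis
    using that[OF \<gamma>] le cost_\<gamma> eq(1) by simp
qed

end

section \<open>Optimality of a plan implies monotonicity of its support\<close>

lemma continuous_on_swap_coords [continuous_intros]: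
  fixes f g :: "'b::topological_space \<Rightarrow> 'a::topological_space ^ 'n::finite"
  assumes "continuous_on A f" "continuous_on A g"
  shows "continuous_on A (\<lambda>t. swap_coords S (f t) (g t))"
  unfolding swap_coords_def
proof (rule continuous_on_vec_lambda)
  fix i
  show "continuous_on A (\<lambda>t. if i \<in> S then g t $ i else f t $ i)"
    using assms by (cases "i \<in> S") (auto intro!: continuous_intros)
qed

context barycentric_weights
begin

text \<open>Two independent samples of an optimal plan exchange the coordinates in \<open>S\<close> whenever this
  lowers the total cost. By symmetry the first sample still is a plan, and it is strictly cheaper
  if the exchange happens with positive probability.\<close>

lemma optimal_plan_swap:
  fixes \<gamma> :: "('a::euclidean_space ^ 'n) measure"
  assumes \<gamma>: "\<gamma> \<in> multi_plans \<mu>" and \<mu>: "\<And>i. \<mu> i \<in> prob_measures_moment p"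
    and opt: "\<And>\<gamma>'. \<gamma>' \<in> multi_plans \<mu> \<Longrightarrow> (\<integral>\<^sup>+ x. ennreal (cost x) \<partial>\<gamma>) \<le> (\<integral>\<^sup>+ x. ennreal (cost x) \<partial>\<gamma>')"
    and a: "a \<in> measure_support \<gamma>" and b: "b \<in> measure_support \<gamma>"
  shows "cost a + cost b \<le> cost (swap_coords S a b) + cost (swap_coords S b a)"
proof (rule ccontr)
  assume viol: "\<not> ?thesis"
  note \<gamma>' = multi_plans_component[OF \<gamma>]
  interpret \<gamma>: prob_space \<gamma> by (rule \<gamma>'(1))
  interpret M: pair_prob_space \<gamma> \<gamma> ..
  let ?M = "\<gamma> \<Otimes>\<^sub>M \<gamma>"
  have sets_M: "sets ?M = sets borel"
    unfolding borel_prod[symmetric] by (rule sets_pair_measure_cong[OF \<gamma>'(2) \<gamma>'(2)])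
  have space_M: "space ?M = UNIV" using sets_eq_imp_space_eq[OF sets_M] by simp
  note cont_borel = borel_measurable_continuousI[OF _ sets_M]
  \<comment> \<open>The saving achieved by the exchange; it is symmetric in the two samples, so both
    take the same decision.\<close>
  define D where "D q = cost (fst q) + cost (snd q) - cost (swap_coords S (fst q) (snd q))
      - cost (swap_coords S (snd q) (fst q))" for q :: "('a ^ 'n) \<times> ('a ^ 'n)"
  have Dc: "continuous_on UNIV D" unfolding D_def by (intro continuous_intros)
  define V where "V = {q. 0 < D q}"
  have "open V" unfolding V_def using Dc by (intro open_Collect_less continuous_intros)
  then have V_M: "V \<in> sets ?M" by (simp add: sets_M)
  define T where "T q = (if q \<in> V then swap_coords S (fst q) (snd q) else fst q)" for q
  have "D (prod.swap q) = D q" for q by (simp add: D_def)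
  then have V_swap: "prod.swap q \<in> V \<longleftrightarrow> q \<in> V" for q by (simp add: V_def)
  have T_meas: "T \<in> borel_measurable ?M"
    unfolding T_def[abs_def] using V_M
    by (intro measurable_If_set cont_borel continuous_intros) (simp add: space_M)
  have swap_eq: "prod.swap = (\<lambda>(x, y). (y, x))" by (rule ext) auto
  have swap_meas: "prod.swap \<in> measurable ?M ?M" unfolding swap_eq by (rule measurable_pair_swap')
  have flip: "distr ?M ?M prod.swap = ?M" unfolding swap_eq by (rule M.distr_pair_swap[symmetric])
  have fst_law: "distr ?M \<gamma> fst = \<gamma>" by (rule \<gamma>.distr_pair_fst)
  define \<gamma>2 where "\<gamma>2 = distr ?M borel T"
  have nth_borel: "(\<lambda>x. x $ i) \<in> borel_measurable (borel :: ('a ^ 'n) measure)" for i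
    by (intro borel_measurable_continuous_onI continuous_intros)
  have "distr \<gamma>2 borel (\<lambda>x. x $ i) = \<mu> i" for i
  proof (rule measure_eqI)
    show "sets (distr \<gamma>2 borel (\<lambda>x. x $ i)) = sets (\<mu> i)" using prob_measures_momentD(2)[OF \<mu>] by simp
    fix A assume "A \<in> sets (distr \<gamma>2 borel (\<lambda>x. x $ i))"
    then have A: "A \<in> sets borel" by simp
    define f where "f q = (indicator A (fst q $ i) :: ennreal)" for q :: "('a ^ 'n) \<times> ('a ^ 'n)"
    have ind: "(\<lambda>x. indicator A (x $ i) :: ennreal) \<in> borel_measurable borel"
      using measurable_compose[OF nth_borel borel_measurable_indicator[OF A]] .
    have f: "f \<in> borel_measurable ?M"
      unfolding f_def by (rule measurable_compose[OF cont_borel ind]) (intro continuous_intros)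
    have f_swap: "(\<lambda>q. f (prod.swap q)) \<in> borel_measurable ?M" by (rule measurable_compose[OF swap_meas f])
    have indV: "(indicator V :: _ \<Rightarrow> ennreal) \<in> borel_measurable ?M" using V_M by simp
    have indV': "(indicator (- V) :: _ \<Rightarrow> ennreal) \<in> borel_measurable ?M"
      using sets.compl_sets[OF V_M] by (simp add: space_M Compl_eq_Diff_UNIV)
    \<comment> \<open>The product measure and \<open>V\<close> are invariant under interchange of
      the samples, so a coordinate received from the second sample has the same law on
      \<open>V\<close> as the one given away.\<close>
    have sym: "(\<integral>\<^sup>+ q. indicator V q * f (prod.swap q) \<partial>?M) = (\<integral>\<^sup>+ q. indicator V q * f q \<partial>?M)"
    proof -
      have "(\<integral>\<^sup>+ q. indicator V q * f q \<partial>?M) = (\<integral>\<^sup>+ q. indicator V q * f q \<partial>distr ?M ?M prod.swap)"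
        by (simp only: flip)
      also have "\<dots> = (\<integral>\<^sup>+ q. indicator V (prod.swap q) * f (prod.swap q) \<partial>?M)"
        using indV f by (intro nn_integral_distr swap_meas) auto
      finally show ?thesis using V_swap by (simp add: indicator_def)
    qed
    have "emeasure (distr \<gamma>2 borel (\<lambda>x. x $ i)) A = emeasure (distr ?M borel (\<lambda>q. T q $ i)) A"
      unfolding \<gamma>2_def distr_distr[OF nth_borel T_meas] by (simp add: comp_def)
    also have "\<dots> = (\<integral>\<^sup>+ x. indicator A x \<partial>distr ?M borel (\<lambda>q. T q $ i))" using A by simp
    also have "\<dots> = (\<integral>\<^sup>+ q. indicator A (T q $ i) \<partial>?M)"
      using A by (intro nn_integral_distr measurable_compose[OF T_meas nth_borel]) simp
    also have "\<dots> = (\<integral>\<^sup>+ q. f q \<partial>?M)"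
    proof (cases "i \<in> S")
      case True
      have "(\<integral>\<^sup>+ q. indicator A (T q $ i) \<partial>?M) = (\<integral>\<^sup>+ q. indicator V q * f (prod.swap q) + indicator (- V) q * f q \<partial>?M)"
        using True by (intro nn_integral_cong) (auto simp: T_def f_def swap_coords_def)
      also have "\<dots> = (\<integral>\<^sup>+ q. indicator V q * f (prod.swap q) \<partial>?M) + (\<integral>\<^sup>+ q. indicator (- V) q * f q \<partial>?M)"
        using indV indV' f f_swap by (intro nn_integral_add borel_measurable_times_ennreal)
      also have "\<dots> = (\<integral>\<^sup>+ q. indicator V q * f q \<partial>?M) + (\<integral>\<^sup>+ q. indicator (- V) q * f q \<partial>?M)"
        by (simp only: sym)
      also have "\<dots> = (\<integral>\<^sup>+ q. indicator V q * f q + indicator (- V) q * f q \<partial>?M)"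
        using indV indV' f by (intro nn_integral_add[symmetric] borel_measurable_times_ennreal)
      also have "\<dots> = (\<integral>\<^sup>+ q. f q \<partial>?M)" by (intro nn_integral_cong) (simp add: indicator_def)
      finally show ?thesis .
    qed (intro nn_integral_cong, simp add: T_def f_def swap_coords_def)
    also have "\<dots> = (\<integral>\<^sup>+ x. indicator A (x $ i) \<partial>distr ?M \<gamma> fst)"
      unfolding f_def using ind
      by (intro nn_integral_distr[symmetric]) (simp_all add: measurable_cong_sets[OF \<gamma>'(2) refl])
    also have "\<dots> = (\<integral>\<^sup>+ x. indicator A x \<partial>distr \<gamma> borel (\<lambda>x. x $ i))"
      unfolding fst_law using A nth_borel
      by (intro nn_integral_distr[symmetric]) (simp_all add: measurable_cong_sets[OF \<gamma>'(2) refl])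
    also have "\<dots> = emeasure (\<mu> i) A" using A prob_measures_momentD(2)[OF \<mu>] by (simp add: \<gamma>'(3))
    finally show "emeasure (distr \<gamma>2 borel (\<lambda>x. x $ i)) A = emeasure (\<mu> i) A" .
  qed
  then have \<gamma>2: "\<gamma>2 \<in> multi_plans \<mu>"
    using M.prob_space_distr[OF T_meas] by (simp add: multi_plans_def \<gamma>2_def)
  have cost_borel: "cost \<in> borel_measurable (borel :: ('a ^ 'n) measure)"
    by (intro borel_measurable_continuous_onI continuous_intros)
  have cost_int: "integrable \<eta> cost" if "\<eta> \<in> multi_plans \<mu>" for \<eta>
  proof (rule integrableI_bounded)
    show "cost \<in> borel_measurable \<eta>"
      using cost_borel by (subst measurable_cong_sets[OF multi_plans_component(2)[OF that] refl])
    show "(\<integral>\<^sup>+ x. ennreal (norm (cost x)) \<partial>\<eta>) < \<infinity>"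
      using nn_integral_cost_finite[OF that \<mu>] by (simp add: cost_nonneg)
  qed
  have "(\<integral>x. cost x \<partial>\<gamma>) \<le> (\<integral>x. cost x \<partial>\<gamma>2)"
  proof -
    have "ennreal (\<integral>x. cost x \<partial>\<gamma>) \<le> ennreal (\<integral>x. cost x \<partial>\<gamma>2)"
      using opt[OF \<gamma>2] nn_integral_eq_integral[OF cost_int[OF \<gamma>]] nn_integral_eq_integral[OF cost_int[OF \<gamma>2]]
      by (simp add: cost_nonneg)
    then show ?thesis by (subst (asm) ennreal_le_iff) (auto simp: cost_nonneg)
  qed
  moreover have "(\<integral>x. cost x \<partial>\<gamma>2) = (\<integral>q. cost (T q) \<partial>?M)"
    unfolding \<gamma>2_def by (rule integral_distr[OF T_meas cost_borel])
  moreover have "(\<integral>x. cost x \<partial>\<gamma>) = (\<integral>q. cost (fst q) \<partial>?M)"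
    using integral_distr[of fst ?M \<gamma> cost] cost_borel by (simp add: fst_law measurable_cong_sets[OF \<gamma>'(2) refl])
  moreover have T_int: "integrable ?M (\<lambda>q. cost (T q))"
    using cost_int[OF \<gamma>2] unfolding \<gamma>2_def by (subst (asm) integrable_distr_eq[OF T_meas cost_borel])
  moreover have fst_int: "integrable ?M (\<lambda>q. cost (fst q))"
    using cost_int[OF \<gamma>] integrable_distr_eq[of fst ?M \<gamma> cost] cost_borel
    by (simp add: fst_law measurable_cong_sets[OF \<gamma>'(2) refl])
  moreover have swap_int: "integrable ?M (\<lambda>q. g (prod.swap q))" "(\<integral>q. g (prod.swap q) \<partial>?M) = (\<integral>q. g q \<partial>?M)"
    if "integrable ?M g" for g :: "('a ^ 'n) \<times> ('a ^ 'n) \<Rightarrow> real"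
    using integrable_distr_eq[OF swap_meas borel_measurable_integrable[OF that]]
      integral_distr[OF swap_meas borel_measurable_integrable[OF that]] that by (simp_all add: flip)
  \<comment> \<open>After the exchange the second sample is \<open>T (prod.swap q)\<close> and has
    the same expected cost as the first, so the expected saving is twice a nonpositive number.
    Pointwise, however, it is the positive part of \<open>D\<close>.\<close>
  ultimately have "(\<integral>q. (cost (fst q) + cost (snd q)) - (cost (T q) + cost (T (prod.swap q))) \<partial>?M) \<le> 0"
    using swap_int[OF T_int] swap_int[OF fst_int] by simp
  moreover have max: "(cost (fst q) + cost (snd q)) - (cost (T q) + cost (T (prod.swap q))) = max 0 (D q)" for q
    using V_swap[of q] by (auto simp: T_def V_def D_def)
  moreover have "integrable ?M (\<lambda>q. (cost (fst q) + cost (snd q)) - (cost (T q) + cost (T (prod.swap q))))"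
    using swap_int(1)[OF T_int] swap_int(1)[OF fst_int] T_int fst_int by simp
  ultimately have int: "integrable ?M (\<lambda>q. max 0 (D q))" "(\<integral>q. max 0 (D q) \<partial>?M) \<le> 0" by (simp_all only:)
  then have "(\<integral>q. max 0 (D q) \<partial>?M) = 0"
    by (intro antisym integral_nonneg_AE) auto
  then have "AE q in ?M. max 0 (D q) = 0"
    using int(1) by (subst (asm) integral_nonneg_eq_0_iff_AE) auto
  then have "AE q in ?M. q \<notin> V" by eventually_elim (auto simp: V_def)
  then have "emeasure ?M V = 0" using V_M by (simp add: AE_iff_null_sets null_setsD1)
  \<comment> \<open>Neighbourhoods of support points have positive mass, so an open set containing
    the pair cannot be null for the product measure.\<close>
  have "(a, b) \<in> V" using viol by (simp add: V_def D_def)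
  then obtain A B where AB: "open A" "open B" "a \<in> A" "b \<in> B" "A \<times> B \<subseteq> V"
    using \<open>open V\<close> by (auto elim!: open_prod_elim)
  have "emeasure \<gamma> A > 0" "emeasure \<gamma> B > 0" using a b AB by (auto simp: measure_support_def)
  then have "0 < emeasure \<gamma> A * emeasure \<gamma> B" by (simp add: ennreal_zero_less_mult_iff)
  also have "\<dots> = emeasure ?M (A \<times> B)"
    using AB \<gamma>'(2) by (intro \<gamma>.emeasure_pair_measure_Times[symmetric]) auto
  also have "\<dots> \<le> emeasure ?M V" by (intro emeasure_mono AB V_M)
  finally show False using \<open>emeasure ?M V = 0\<close> by simp
qed

text \<open>A permutation of {1, 2} either fixes both points or exchanges them, so a family of such
  permutations amounts to the set \<open>S\<close> of exchanged coordinates.\<close>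

lemma cp_monotone_support_of_optimal:
  fixes \<gamma> :: "('a::euclidean_space ^ 'n) measure"
  assumes "\<gamma> \<in> multi_plans \<mu>" "\<And>i. \<mu> i \<in> prob_measures_moment p"
    and "\<And>\<gamma>'. \<gamma>' \<in> multi_plans \<mu> \<Longrightarrow> (\<integral>\<^sup>+ x. ennreal (cost x) \<partial>\<gamma>) \<le> (\<integral>\<^sup>+ x. ennreal (cost x) \<partial>\<gamma>')"
  shows "cp_monotone p lam (measure_support \<gamma>)"
  unfolding cp_monotone_def
proof (intro allI impI, elim conjE)
  fix x :: "nat \<Rightarrow> 'a ^ 'n" and \<sigma> :: "'n \<Rightarrow> nat \<Rightarrow> nat"
  assume x: "x 1 \<in> measure_support \<gamma>" "x 2 \<in> measure_support \<gamma>" and \<sigma>: "\<forall>i. \<sigma> i permutes {1, 2}"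
  define S where "S = {i. \<sigma> i 1 = 2}"
  have \<sigma>_cases: "\<sigma> i 1 = 1 \<and> \<sigma> i 2 = 2 \<or> \<sigma> i 1 = 2 \<and> \<sigma> i 2 = 1" for i
  proof -
    have per: "\<sigma> i permutes {1, 2}" using \<sigma> ..
    have "\<sigma> i 1 \<in> {1, 2}" "\<sigma> i 2 \<in> {1, 2}" using permutes_in_image[OF per] by blast+
    moreover have "\<sigma> i 1 \<noteq> \<sigma> i 2" using inj_eq[OF permutes_inj[OF per], of 1 2] by simp
    ultimately show ?thesis by auto
  qed
  have "x (\<sigma> i 1) $ i = swap_coords S (x 1) (x 2) $ i" "x (\<sigma> i 2) $ i = swap_coords S (x 2) (x 1) $ i" for i
    using \<sigma>_cases[of i] by (auto simp: S_def swap_coords_def)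
  then have "(\<chi> i. x (\<sigma> i 1) $ i) = swap_coords S (x 1) (x 2)" "(\<chi> i. x (\<sigma> i 2) $ i) = swap_coords S (x 2) (x 1)"
    by (simp_all only: vec_eq_iff vec_lambda_beta) simp_all
  then show "cost (x 1) + cost (x 2) \<le> cost (\<chi> i. x (\<sigma> i 1) $ i) + cost (\<chi> i. x (\<sigma> i 2) $ i)"
    using optimal_plan_swap[OF assms x] by simp
qed

end

theorem theorem2p4:
  fixes p :: real
    and lam :: "'n::finite \<Rightarrow> real"
    and \<mu> :: "'n \<Rightarrow> (real ^ 'd) measure"
    and i1 :: 'n
  assumes "1 < p"
    and "CARD('n) \<ge> 2"
    and "\<And>i. lam i > 0"
    and "(\<Sum>i\<in>UNIV. lam i) = 1"
    and "\<And>i. \<mu> i \<in> prob_measures_moment p"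
    and "absolutely_continuous lborel (\<mu> i1)"
  shows "(\<forall>\<gamma> \<in> multi_plans \<mu>. cp_monotone p lam (measure_support \<gamma>) \<longrightarrow>
            absolutely_continuous lborel (distr \<gamma> borel (bary_point p lam)))
       \<and> (\<forall>\<nu>. is_wasserstein_barycenter p lam \<mu> \<nu> \<longrightarrow> absolutely_continuous lborel \<nu>)"
proof -
  interpret barycentric_weights p lam by unfold_locales (use assms in auto)
  have ac: "absolutely_continuous lborel (distr \<gamma> borel (bary_point p lam))"
    if "\<gamma> \<in> multi_plans \<mu>" "cp_monotone p lam (measure_support \<gamma>)" for \<gamma>
    using absolutely_continuous_bary[OF that assms(6)] .
  moreover have "absolutely_continuous lborel \<nu>" if \<nu>: "is_wasserstein_barycenter p lam \<mu> \<nu>" for \<nu>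
  proof -
    obtain \<gamma> where \<gamma>: "\<gamma> \<in> multi_plans \<mu>" "\<nu> = distr \<gamma> borel (bary_point p lam)"
      "\<And>\<gamma>'. \<gamma>' \<in> multi_plans \<mu> \<Longrightarrow>
        (\<integral>\<^sup>+ x. ennreal (bary_cost p lam x) \<partial>\<gamma>) \<le> (\<integral>\<^sup>+ x. ennreal (bary_cost p lam x) \<partial>\<gamma>')"
      using barycenter_is_pushforward[OF assms(4,5) \<nu>] by blast
    then show ?thesis using ac cp_monotone_support_of_optimal[OF \<gamma>(1) assms(5) \<gamma>(3)] by simp
  qed
  ultimately show ?thesis by blast
qed

end
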